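(* Let $d>1$, let $\phi\in\mathrm{BMO}_r(\mathbb T^d)$, and let $\mathbf n=(n_1,\dots,n_d)\in\mathbb N^d$. Then $$\frac1{\sqrt d}\,\sigma_{\mathbf n}(\Gamma_\phi)\le\delta(\phi,\mathrm{BMOA}_r+R_{\mathbf n})\le\sigma_{\mathbf n}(\Gamma_\phi).$$
   Context: $\mathbb T=\mathbb R/2\pi\mathbb Z$ carries normalized Lebesgue measure. Notation: - $H^2(\mathbb T^d)=\{f\in L^2(\mathbb T^d):\hat f(n)=0 \text{ unless all } n_k\ge0\}$, with orthogonal projection $P$; for $\psi\in L^2$, $\Gamma_\psi f=(I-P)(\psi f)$ is the big Hankel operator with symbol $\psi$. - $P_{x_j}$ is the orthogonal projection onto $\{\hat f(n)=0 \text{ for } n_j<0\}$. - $\mathrm{BMO}_r(\mathbb T^d)$ is the set of $\psi\in L^2(\mathbb T^d)$ for which there exist $\varphi_0,\dots,\varphi_d\in L^\infty(\mathbb T^d)$ with $(I-P_{x_j})\psi=(I-P_{x_j})\varphi_j$ ($j=1,\dots,d$) and $P_{x_1}\cdots P_{x_d}\psi=P_{x_1}\cdots P_{x_d}\varphi_0$. Its norm is the infimum of $\max_j\|\varphi_j\|_\infty$ (set to $+\infty$ if $\psi\notin\mathrm{BMO}_r$). - $\mathrm{BMOA}_r=\mathrm{BMO}_r(\mathbb T^d)\cap H^2(\mathbb T^d)$. - $\mathcal B_{\mathbf n}$ is the set of functions $b(x)=b_1(x_1)\cdots b_d(x_d)$, where each $b_k$ is a one-variable finite Blaschke product with at most $n_k$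 factors (a unimodular constant allowed). With this notation: - $\sigma_{\mathbf n}(\Gamma_\phi)=\inf\{\|\Gamma_{b\phi}\|:b\in\mathcal B_{\mathbf n}\}$. Equivalently, it is the infimum of $\|\Gamma_\phi|_{\mathcal I}\|$ over the shift-invariant subspaces $\mathcal I=bH^2(\mathbb T^d)$ with $b\in\mathcal B_{\mathbf n}$. - $\delta(\phi,\mathrm{BMOA}_r+R_{\mathbf n})=\inf\{\|b\phi-h\|_{\mathrm{BMO}_r}:h\in\mathrm{BMOA}_r,\ b\in\mathcal B_{\mathbf n}\}$. *)

theory Defs
  imports "HOL-Probability.Probability"
begin

text \<open>The torus T = R / 2 pi Z is represented by the interval [0, 2 pi] with normalized
Lebesgue measure; T^d is indexed by a finite type 'd (d = CARD('d)). A point of T^d is a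
function x :: 'd \<Rightarrow> real, a multi-index is n :: 'd \<Rightarrow> int.\<close>

definition torus :: "real measure" where
  "torus = uniform_measure lborel {0..2*pi}"

definition torusd :: "('d::finite \<Rightarrow> real) measure" where
  "torusd = PiM UNIV (\<lambda>_. torus)"

definition esqrt :: "ennreal \<Rightarrow> ennreal" where
  "esqrt x = (if x = \<infinity> then \<infinity> else ennreal (sqrt (enn2real x)))"

definition L2 :: "(('d::finite \<Rightarrow> real) \<Rightarrow> complex) set" where
  "L2 = {f. f \<in> borel_measurable torusd \<and> integrable torusd (\<lambda>x. (norm (f x))^2)}"

definition L2norm :: "(('d::finite \<Rightarrow> real) \<Rightarrow> complex) \<Rightarrow> ennreal" where
  "L2norm f = esqrt (\<integral>\<^sup>+ x. ennreal ((norm (f x))^2) \<partial>torusd)"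

definition Linfnorm :: "(('d::finite \<Rightarrow> real) \<Rightarrow> complex) \<Rightarrow> ennreal" where
  "Linfnorm f = esssup torusd (\<lambda>x. ennreal (norm (f x)))"

definition Linf :: "(('d::finite \<Rightarrow> real) \<Rightarrow> complex) set" where
  "Linf = {f. f \<in> borel_measurable torusd \<and> Linfnorm f < \<infinity>}"

definition fcoeff :: "(('d::finite \<Rightarrow> real) \<Rightarrow> complex) \<Rightarrow> ('d \<Rightarrow> int) \<Rightarrow> complex" where
  "fcoeff f n = (LINT x|torusd. f x * exp (- \<i> * complex_of_real (\<Sum>k\<in>UNIV. of_int (n k) * x k)))"

definition H2 :: "(('d::finite \<Rightarrow> real) \<Rightarrow> complex) set" where
  "H2 = {f \<in> L2. \<forall>n. (\<exists>k. n k < 0) \<longrightarrow> fcoeff f n = 0}"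

text \<open>L^2 norm of (I - P) g, computed from the Fourier coefficients (Parseval).\<close>
definition antiproj_norm :: "(('d::finite \<Rightarrow> real) \<Rightarrow> complex) \<Rightarrow> ennreal" where
  "antiproj_norm g = esqrt (\<integral>\<^sup>+ n. ennreal ((norm (fcoeff g n))^2)
      \<partial>count_space {n :: 'd \<Rightarrow> int. \<exists>k. n k < 0})"

definition hankel_norm :: "(('d::finite \<Rightarrow> real) \<Rightarrow> complex) \<Rightarrow> ennreal" where
  "hankel_norm \<psi> = (SUP f \<in> {f \<in> H2. L2norm f \<le> 1}. antiproj_norm (\<lambda>x. \<psi> x * f x))"

definition bmo_admissible ::
  "(('d::finite \<Rightarrow> real) \<Rightarrow> complex) \<Rightarrow> (('d \<Rightarrow> real) \<Rightarrow> complex)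
     \<Rightarrow> ('d \<Rightarrow> ('d \<Rightarrow> real) \<Rightarrow> complex) \<Rightarrow> bool" where
  "bmo_admissible \<psi> \<phi>0 \<Phi> \<longleftrightarrow>
     \<phi>0 \<in> Linf \<and> (\<forall>j. \<Phi> j \<in> Linf) \<and>
     (\<forall>j n. n j < 0 \<longrightarrow> fcoeff \<psi> n = fcoeff (\<Phi> j) n) \<and>
     (\<forall>n. (\<forall>k. n k \<ge> 0) \<longrightarrow> fcoeff \<psi> n = fcoeff \<phi>0 n)"

definition BMOr :: "(('d::finite \<Rightarrow> real) \<Rightarrow> complex) set" where
  "BMOr = {\<psi> \<in> L2. \<exists>\<phi>0 \<Phi>. bmo_admissible \<psi> \<phi>0 \<Phi>}"

definition bmo_norm :: "(('d::finite \<Rightarrow> real) \<Rightarrow> complex) \<Rightarrow> ennreal" where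
  "bmo_norm \<psi> = (if \<psi> \<in> BMOr then
      (INF (\<phi>0, \<Phi>) \<in> {(\<phi>0, \<Phi>). bmo_admissible \<psi> \<phi>0 \<Phi>}.
         max (Linfnorm \<phi>0) (Max (range (\<lambda>j. Linfnorm (\<Phi> j)))))
    else \<infinity>)"

definition BMOAr :: "(('d::finite \<Rightarrow> real) \<Rightarrow> complex) set" where
  "BMOAr = BMOr \<inter> H2"

definition blaschke1 :: "complex \<Rightarrow> complex list \<Rightarrow> real \<Rightarrow> complex" where
  "blaschke1 c as t = c * (\<Prod>a\<leftarrow>as. (cis t - a) / (1 - cnj a * cis t))"

definition Blaschke_set :: "('d::finite \<Rightarrow> nat) \<Rightarrow> (('d \<Rightarrow> real) \<Rightarrow> complex) set" where
  "Blaschke_set n = {b. \<exists>c as. (\<forall>k. norm (c k) = 1 \<and> length (as k) \<le> n k \<and>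
        (\<forall>a\<in>set (as k). norm a < 1)) \<and>
        b = (\<lambda>x. \<Prod>k\<in>UNIV. blaschke1 (c k) (as k) (x k))}"

definition sigma_n :: "('d::finite \<Rightarrow> nat) \<Rightarrow> (('d \<Rightarrow> real) \<Rightarrow> complex) \<Rightarrow> ennreal" where
  "sigma_n n \<phi> = (INF b \<in> Blaschke_set n. hankel_norm (\<lambda>x. b x * \<phi> x))"

definition delta_n :: "('d::finite \<Rightarrow> nat) \<Rightarrow> (('d \<Rightarrow> real) \<Rightarrow> complex) \<Rightarrow> ennreal" where
  "delta_n n \<phi> = (INF (h, b) \<in> BMOAr \<times> Blaschke_set n. bmo_norm (\<lambda>x. b x * \<phi> x - h x))"

end

theory Submission
  imports Defs "HOL-Library.Function_Algebras"
begin

text \<open>Lower bound: if the function b \<phi> - h is represented by bounded symbols \<Phi>_j, then for f in H2 the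
  coefficients of b \<phi> f and of \<Phi>_j f agree at all frequencies that are negative in the variable j, and
  Bessel's inequality for the d functions \<Phi>_j f gives the factor sqrt d.

  Upper bound: put \<psi> = b \<phi> and let h be the projection of \<psi> to H2. Multiplication by Blaschke products
  preserves BMOr, so h lies in BMOAr. The remaining symbols are provided by a Nehari theorem in a single
  variable: translating frequencies in the other variables, the Hankel norm s of \<psi> bounds the bilinear
  form f, g \<mapsto> \<integral> \<psi> f g for f analytic in the variable j and g analytic and vanishing at 0 there. A
  trigonometric polynomial F of the latter kind factors as exp q times F exp(-q), where
  2 Re q is a polynomial approximation of log (|F| + \<epsilon>), so that |\<integral> \<psi> F| \<le> s \<integral> |F|. Duality then yields
  a symbol of sup norm at most s.\<close>

subsection \<open>The space L2\<close>

text \<open>The obstacle behind the upper bound is that projecting onto the nonnegative frequencies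
  does not preserve boundedness. A bounded symbol for the nonnegative part of \<phi> therefore gives
  none for that of \<open>b \<phi>\<close> by mere multiplication, although \<open>delta_n\<close>
  admits only \<open>h\<close> in \<open>BMOAr\<close>; this symbol is corrected explicitly, one
  Blaschke factor at a time. The Nehari step can be done in a single variable because
  \<open>BMOr\<close> asks for a separate symbol on each half space n_j < 0. Functions analytic in
  all variables jointly have no sharp factorization, but splitting a real polynomial into an
  analytic part and a conjugate only involves the sign of n_j, so on a half space the one-variable
  argument survives. The two constants differ because the complement of the cone of nonnegative
  frequencies is a union of d overlapping half spaces. Combining d symbols costs sqrt d in the L2
  estimate, whereas the norm of \<open>BMOr\<close> is a maximum, so going from the operator to the
  symbols costs nothing.\<close>

lemma space_torus [simp]: "space torus = UNIV"
  and sets_torus [measurable_cong, simp]: "sets torus = sets borel"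
  by (simp_all add: torus_def)

lemma prob_space_torus: "prob_space torus"
  unfolding torus_def by (rule prob_space_uniform_measure) (auto simp: ennreal_mult_less_top)

lemma prob_space_torusd: "prob_space torusd"
  unfolding torusd_def by (intro prob_space_PiM prob_space_torus)

interpretation torus: prob_space torus
  by (rule prob_space_torus)

interpretation torusd: prob_space torusd
  by (rule prob_space_torusd)

lemma space_torusd [simp]: "space torusd = UNIV"
  by (auto simp: torusd_def space_PiM)

lemma sets_torusd [measurable_cong]: "sets torusd = sets (PiM UNIV (\<lambda>_. borel))"
  unfolding torusd_def by (rule sets_PiM_cong) simp_all

lemma component_measurable [measurable]: "(\<lambda>x. x k) \<in> borel_measurable torusd"
  by measurable

lemma AE_torus: "AE t in torus. t \<in> {0..2*pi}"
  unfolding torus_def by (rule AE_uniform_measureI) auto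

lemma AE_torusd: "AE x in (torusd :: ('d::finite \<Rightarrow> real) measure). \<forall>k. x k \<in> {0..2*pi}"
proof -
  have "AE x in torusd. x k \<in> {0..2*pi}" for k :: 'd
    unfolding torusd_def by (rule AE_PiM_component[OF prob_space_torus]) (use AE_torus in auto)
  then show ?thesis by (simp add: AE_all_countable)
qed

text \<open>A real-valued companion of \<open>L2norm\<close>, convenient for limits and subtraction.
  A non-integrable square would give the default value 0, so the estimates below carry membership in
  \<open>L2\<close> or a bound that implies it.\<close>

definition nrm :: "(('d::finite \<Rightarrow> real) \<Rightarrow> complex) \<Rightarrow> real" where
  "nrm f = sqrt (LINT x|torusd. (norm (f x))\<^sup>2)"

lemma nrm_nonneg [simp]: "0 \<le> nrm f"
  by (simp add: nrm_def)

lemma nrm_sq: "(nrm f)\<^sup>2 = (LINT x|torusd. (norm (f x))\<^sup>2)"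
  by (simp add: nrm_def)

lemma L2_measurable: "f \<in> L2 \<Longrightarrow> f \<in> borel_measurable torusd"
  by (simp add: L2_def)

lemma L2_square_integrable: "f \<in> L2 \<Longrightarrow> integrable torusd (\<lambda>x. (norm (f x))\<^sup>2)"
  by (simp add: L2_def)

lemma L2_bounded_AE:
  assumes "f \<in> borel_measurable torusd" "AE x in torusd. norm (f x) \<le> C"
  shows "f \<in> L2"
proof -
  have "integrable torusd (\<lambda>x. (norm (f x))\<^sup>2)"
  proof (rule torusd.integrable_const_bound[where B="C\<^sup>2"])
    show "AE x in torusd. norm ((norm (f x))\<^sup>2) \<le> C\<^sup>2"
      using assms(2) by eventually_elim (auto intro!: power_mono)
  qed (use assms(1) in measurable)
  with assms(1) show ?thesis by (simp add: L2_def)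
qed

lemma L2_bounded:
  assumes "f \<in> borel_measurable torusd" "\<And>x. norm (f x) \<le> C"
  shows "f \<in> L2"
  using L2_bounded_AE[OF assms(1), of C] assms(2) by auto

lemma two_mult_le_squares: "2 * (a * b) \<le> a\<^sup>2 + (b::real)\<^sup>2"
  using zero_le_power2[of "a - b"] by (simp add: power2_diff)

lemma L2_mult_integrable:
  assumes "f \<in> L2" "g \<in> L2"
  shows "integrable torusd (\<lambda>x. f x * g x)"
proof (rule Bochner_Integration.integrable_bound)
  show "integrable torusd (\<lambda>x. (norm (f x))\<^sup>2 + (norm (g x))\<^sup>2)"
    using assms by (simp add: L2_def)
  show "(\<lambda>x. f x * g x) \<in> borel_measurable torusd"
    using assms[THEN L2_measurable] by measurable
  show "AE x in torusd. norm (f x * g x) \<le> norm ((norm (f x))\<^sup>2 + (norm (g x))\<^sup>2)"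
  proof (rule AE_I2)
    fix x :: "'a \<Rightarrow> real"
    have "0 \<le> norm (f x) * norm (g x)" by simp
    then show "norm (f x * g x) \<le> norm ((norm (f x))\<^sup>2 + (norm (g x))\<^sup>2)"
      using two_mult_le_squares[of "norm (f x)" "norm (g x)"]
      unfolding norm_mult real_norm_def by linarith
  qed
qed

lemma L2_const [simp]: "(\<lambda>x. c) \<in> L2"
  by (rule L2_bounded[of _ "norm c"]) auto

lemma L2_integrable: "f \<in> L2 \<Longrightarrow> integrable torusd f"
  using L2_mult_integrable[OF _ L2_const[of 1], of f] by simp

lemma L2_add [intro]:
  assumes "f \<in> L2" "g \<in> L2"
  shows "(\<lambda>x. f x + g x) \<in> L2"
proof -
  have [measurable]: "f \<in> borel_measurable torusd" "g \<in> borel_measurable torusd"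
    using assms by (auto simp: L2_def)
  have "integrable torusd (\<lambda>x. (norm (f x + g x))\<^sup>2)"
  proof (rule Bochner_Integration.integrable_bound)
    show "integrable torusd (\<lambda>x. 2 * (norm (f x))\<^sup>2 + 2 * (norm (g x))\<^sup>2)"
      using assms by (simp add: L2_def)
    show "AE x in torusd. norm ((norm (f x + g x))\<^sup>2) \<le> norm (2 * (norm (f x))\<^sup>2 + 2 * (norm (g x))\<^sup>2)"
    proof (rule AE_I2)
      fix x :: "'a \<Rightarrow> real"
      have "(norm (f x + g x))\<^sup>2 \<le> (norm (f x) + norm (g x))\<^sup>2"
        by (intro power_mono norm_triangle_ineq) simp
      then show "norm ((norm (f x + g x))\<^sup>2) \<le> norm (2 * (norm (f x))\<^sup>2 + 2 * (norm (g x))\<^sup>2)"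
        using two_mult_le_squares[of "norm (f x)" "norm (g x)"] by (simp add: power2_sum)
    qed
  qed measurable
  then show ?thesis by (simp add: L2_def)
qed

lemma L2_bounded_mult:
  assumes "m \<in> borel_measurable torusd" "AE x in torusd. norm (m x) \<le> C" "f \<in> L2"
  shows "(\<lambda>x. m x * f x) \<in> L2"
proof -
  have [measurable]: "m \<in> borel_measurable torusd" "f \<in> borel_measurable torusd"
    using assms by (auto simp: L2_def)
  have "integrable torusd (\<lambda>x. (norm (m x * f x))\<^sup>2)"
  proof (rule Bochner_Integration.integrable_bound)
    show "integrable torusd (\<lambda>x. C\<^sup>2 * (norm (f x))\<^sup>2)"
      using assms by (simp add: L2_def)
    show "AE x in torusd. norm ((norm (m x * f x))\<^sup>2) \<le> norm (C\<^sup>2 * (norm (f x))\<^sup>2)"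
      using assms(2)
    proof eventually_elim
      case (elim x)
      then have "(norm (m x))\<^sup>2 \<le> C\<^sup>2" by (intro power_mono) auto
      then show ?case by (simp add: norm_mult power_mult_distrib mult_right_mono)
    qed
  qed measurable
  then show ?thesis by (simp add: L2_def)
qed

lemma L2_cmult [intro]: "f \<in> L2 \<Longrightarrow> (\<lambda>x. c * f x) \<in> L2"
  by (rule L2_bounded_mult[of _ "norm c"]) auto

lemma L2_diff [intro]:
  assumes "f \<in> L2" "g \<in> L2"
  shows "(\<lambda>x. f x - g x) \<in> L2"
  using L2_add[OF assms(1) L2_cmult[OF assms(2), of "-1"]] by simp

lemma L2_cnj: "f \<in> L2 \<Longrightarrow> (\<lambda>x. cnj (f x)) \<in> L2"
proof -
  assume f: "f \<in> L2"
  have "cnj \<in> borel_measurable borel"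
    by (intro borel_measurable_continuous_onI continuous_intros)
  with f show ?thesis by (auto simp: L2_def intro: measurable_compose)
qed

lemma nn_integral_L2:
  assumes "f \<in> L2"
  shows "(\<integral>\<^sup>+ x. ennreal ((norm (f x))\<^sup>2) \<partial>torusd) = ennreal ((nrm f)\<^sup>2)"
  using L2_square_integrable[OF assms] by (simp add: nrm_sq nn_integral_eq_integral)

lemma esqrt_ennreal: "0 \<le> x \<Longrightarrow> esqrt (ennreal x) = ennreal (sqrt x)"
  by (simp add: esqrt_def)

lemma L2norm_eq: "f \<in> L2 \<Longrightarrow> L2norm f = ennreal (nrm f)"
  by (simp add: L2norm_def nn_integral_L2 esqrt_ennreal)

lemma Cauchy_Schwarz_norm:
  assumes "f \<in> L2" "g \<in> L2"
  shows "(LINT x|torusd. norm (f x * g x)) \<le> nrm f * nrm g"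
proof -
  have [measurable]: "f \<in> borel_measurable torusd" "g \<in> borel_measurable torusd"
    using assms by (auto simp: L2_def)
  let ?I = "LINT x|torusd. norm (f x * g x)"
  have i: "integrable torusd (\<lambda>x. norm (f x * g x))"
    by (intro integrable_norm L2_mult_integrable assms)
  have eq: "(\<integral>\<^sup>+ x. ennreal (norm (f x)) * ennreal (norm (g x)) \<partial>torusd) = ennreal ?I"
    using nn_integral_eq_integral[OF i] by (simp add: norm_mult ennreal_mult)
  have "(\<integral>\<^sup>+ x. ennreal (norm (f x)) * ennreal (norm (g x)) \<partial>torusd)\<^sup>2
      \<le> (\<integral>\<^sup>+ x. (ennreal (norm (f x)))\<^sup>2 \<partial>torusd) * (\<integral>\<^sup>+ x. (ennreal (norm (g x)))\<^sup>2 \<partial>torusd)"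
    by (rule Cauchy_Schwarz_nn_integral) measurable
  then have "(ennreal ?I)\<^sup>2 \<le> ennreal ((nrm f)\<^sup>2) * ennreal ((nrm g)\<^sup>2)"
    unfolding eq by (simp add: ennreal_power nn_integral_L2 assms)
  then have "?I\<^sup>2 \<le> (nrm f * nrm g)\<^sup>2"
    by (simp add: ennreal_power flip: ennreal_mult power_mult_distrib)
  then show ?thesis
    by (rule power2_le_imp_le) simp
qed

lemma Cauchy_Schwarz:
  assumes "f \<in> L2" "g \<in> L2"
  shows "norm (LINT x|torusd. f x * g x) \<le> nrm f * nrm g"
  by (rule order_trans[OF integral_norm_bound Cauchy_Schwarz_norm[OF assms]])

lemma nrm_triangle:
  assumes "f \<in> L2" "g \<in> L2"
  shows "nrm (\<lambda>x. f x + g x) \<le> nrm f + nrm g"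
proof -
  have i: "integrable torusd (\<lambda>x. norm (f x * g x))"
    by (intro integrable_norm L2_mult_integrable assms)
  have "(nrm (\<lambda>x. f x + g x))\<^sup>2
      \<le> (LINT x|torusd. (norm (f x))\<^sup>2 + (norm (g x))\<^sup>2 + 2 * norm (f x * g x))"
    unfolding nrm_sq
  proof (rule integral_mono)
    fix x :: "'a \<Rightarrow> real"
    have "(norm (f x + g x))\<^sup>2 \<le> (norm (f x) + norm (g x))\<^sup>2"
      by (intro power_mono norm_triangle_ineq) simp
    then show "(norm (f x + g x))\<^sup>2 \<le> (norm (f x))\<^sup>2 + (norm (g x))\<^sup>2 + 2 * norm (f x * g x)"
      by (simp add: power2_sum norm_mult)
  next
    show "integrable torusd (\<lambda>x. (norm (f x + g x))\<^sup>2)"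
      by (rule L2_square_integrable[OF L2_add[OF assms]])
    show "integrable torusd (\<lambda>x. (norm (f x))\<^sup>2 + (norm (g x))\<^sup>2 + 2 * norm (f x * g x))"
      by (intro Bochner_Integration.integrable_add integrable_mult_right i L2_square_integrable assms)
  qed
  also have "\<dots> = (nrm f)\<^sup>2 + (nrm g)\<^sup>2 + 2 * (LINT x|torusd. norm (f x * g x))"
    using i assms by (simp add: nrm_sq L2_def)
  also have "\<dots> \<le> (nrm f)\<^sup>2 + (nrm g)\<^sup>2 + 2 * (nrm f * nrm g)"
    using Cauchy_Schwarz_norm[OF assms] by simp
  also have "\<dots> = (nrm f + nrm g)\<^sup>2" by (simp add: power2_sum)
  finally show ?thesis by (rule power2_le_imp_le) simp
qed

lemma nrm_cmult: "nrm (\<lambda>x. c * f x) = norm c * nrm f"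
  by (simp add: nrm_def norm_mult power_mult_distrib real_sqrt_mult)

lemma nrm_minus_commute: "nrm (\<lambda>x. f x - g x) = nrm (\<lambda>x. g x - f x)"
  by (simp add: nrm_def norm_minus_commute)

lemma nrm_mono_AE:
  assumes "f \<in> borel_measurable torusd" "g \<in> L2" "AE x in torusd. norm (f x) \<le> norm (g x)"
  shows "nrm f \<le> nrm g"
proof -
  have "(LINT x|torusd. (norm (f x))\<^sup>2) \<le> (LINT x|torusd. (norm (g x))\<^sup>2)"
    using assms
    by (intro integral_mono_AE' L2_square_integrable)
       (auto elim!: eventually_mono intro!: power_mono)
  then show ?thesis by (simp add: nrm_def)
qed

lemma nrm_bounded_mult:
  assumes "m \<in> borel_measurable torusd" "AE x in torusd. norm (m x) \<le> C" "0 \<le> C" "f \<in> L2"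
  shows "nrm (\<lambda>x. m x * f x) \<le> C * nrm f"
proof -
  have [measurable]: "f \<in> borel_measurable torusd" using assms by (simp add: L2_def)
  have "nrm (\<lambda>x. m x * f x) \<le> nrm (\<lambda>x. complex_of_real C * f x)"
  proof (rule nrm_mono_AE)
    show "(\<lambda>x. m x * f x) \<in> borel_measurable torusd" using assms(1) by measurable
    show "AE x in torusd. norm (m x * f x) \<le> norm (complex_of_real C * f x)"
      using assms(2) by eventually_elim (use assms(3) in \<open>auto simp: norm_mult intro!: mult_right_mono\<close>)
  qed (use assms in auto)
  then show ?thesis using assms(3) by (simp add: nrm_cmult)
qed

lemma nrm_const_bound:
  assumes "f \<in> borel_measurable torusd" "AE x in torusd. norm (f x) \<le> C" "0 \<le> C"
  shows "nrm f \<le> C"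
proof -
  have "nrm (\<lambda>x. f x * 1) \<le> C * nrm (\<lambda>x::'a \<Rightarrow> real. 1)"
    by (rule nrm_bounded_mult) (use assms in auto)
  then show ?thesis by (simp add: nrm_def torusd.prob_space[unfolded space_torusd])
qed

subsection \<open>Fourier coefficients\<close>

definition expo :: "('d \<Rightarrow> int) \<Rightarrow> ('d::finite \<Rightarrow> real) \<Rightarrow> complex" where
  "expo n x = exp (\<i> * complex_of_real (\<Sum>k\<in>UNIV. of_int (n k) * x k))"

lemma expo_add: "expo (m + n) x = expo m x * expo n x"
  by (simp add: expo_def exp_add[symmetric] algebra_simps sum.distrib)

lemma expo_zero [simp]: "expo 0 x = 1"
  by (simp add: expo_def zero_fun_def)

lemma norm_expo [simp]: "norm (expo n x) = 1"
  by (simp add: expo_def)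

lemma cnj_expo: "cnj (expo n x) = expo (- n) x"
  unfolding expo_def exp_cnj by (simp add: sum_negf)

lemma expo_mult_uminus [simp]: "expo n x * expo (- n) x = 1"
  by (simp flip: expo_add)

lemma expo_prod: "expo n x = (\<Prod>k\<in>UNIV. cis (of_int (n k) * x k))"
  by (simp add: expo_def cis_conv_exp sum_distrib_left exp_sum)

lemma expo_measurable [measurable]: "expo n \<in> borel_measurable torusd"
  unfolding expo_def[abs_def] by measurable

lemma expo_L2 [simp]: "expo n \<in> L2"
  by (rule L2_bounded[of _ 1]) auto

lemma fcoeff_expo: "fcoeff f n = (LINT x|torusd. f x * expo (- n) x)"
  by (simp add: fcoeff_def expo_def sum_negf)

lemma integral_torus:
  fixes f :: "real \<Rightarrow> complex"
  assumes [measurable]: "f \<in> borel_measurable borel"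
  shows "(LINT t|torus. f t) = (LINT t|lborel. indicator {0..2*pi} t *\<^sub>R f t) /\<^sub>R (2 * pi)"
proof -
  have "torus = density lborel (\<lambda>x. ennreal (indicator {0..2*pi} x / (2*pi)))"
    unfolding torus_def uniform_measure_def
    by (rule density_cong) (auto simp: indicator_def divide_ennreal simp flip: ennreal_1)
  then have "(LINT t|torus. f t) = (LINT t|lborel. (indicator {0..2*pi} t / (2*pi)) *\<^sub>R f t)"
    using integral_density[of f lborel "\<lambda>x. indicator {0..2*pi} x / (2*pi)"] by simp
  also have "\<dots> = (LINT t|lborel. inverse (2*pi) *\<^sub>R (indicator {0..2*pi} t *\<^sub>R f t))"
    by (intro Bochner_Integration.integral_cong refl) (simp only: divide_inverse mult.commute scaleR_scaleR)
  finally show ?thesis by (simp only: integral_scaleR_right)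
qed

lemma integral_cis: "(LINT t|torus. cis (of_int m * t)) = of_bool (m = 0)"
proof (cases "m = 0")
  case True
  then show ?thesis using torus.prob_space by simp
next
  case False
  have "(\<integral>t. indicator {0..2*pi} t *\<^sub>R cis (of_int m * t) \<partial>lborel)
      = cis (of_int m * (2*pi)) / (\<i> * of_int m) - cis (of_int m * 0) / (\<i> * of_int m)"
  proof (rule integral_FTC_Icc)
    fix x :: real
    show "((\<lambda>t. cis (of_int m * t) / (\<i> * of_int m)) has_vector_derivative cis (of_int m * x))
      (at x within {0..2*pi})"
      unfolding cis_conv_exp using False
      by (auto intro!: derivative_eq_intros has_vector_derivative_real_field simp: field_simps)
  qed (auto intro!: continuous_intros)
  also have "cis (of_int m * (2*pi)) = 1"
    by (metis cis_multiple_2pi Ints_of_int mult.commute)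
  finally show ?thesis using False
    by (subst integral_torus)
       (auto intro!: borel_measurable_continuous_onI continuous_intros)
qed

interpretation torus_prod: product_sigma_finite "\<lambda>_::'d. torus"
  by unfold_locales

lemma cis_measurable_torus [measurable]: "(\<lambda>t. cis (c * t)) \<in> borel_measurable torus"
proof -
  have "(\<lambda>t. cis (c * t)) \<in> borel_measurable borel"
    by (intro borel_measurable_continuous_onI continuous_intros)
  then show ?thesis by (simp cong: measurable_cong_sets)
qed

lemma integral_expo: "(LINT x|torusd. expo n x) = of_bool (n = 0)"
proof -
  have "(LINT x|torusd. expo n x) = (\<Prod>k\<in>UNIV. LINT t|torus. cis (of_int (n k) * t))"
    unfolding torusd_def expo_prod
    by (rule torus_prod.product_integral_prod)
       (auto intro!: torus.integrable_const_bound[where B=1])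
  also have "\<dots> = of_bool (n = 0)"
    by (auto simp: integral_cis fun_eq_iff of_bool_def)
  finally show ?thesis .
qed

lemma fcoeff_expo_mult: "fcoeff (\<lambda>x. expo m x * f x) n = fcoeff f (n - m)"
proof -
  have "expo (- (n - m)) x = expo m x * expo (- n) x" for x :: "'a \<Rightarrow> real"
    by (simp flip: expo_add)
  then show ?thesis by (simp add: fcoeff_expo mult_ac)
qed

lemma fcoeff_of_expo: "fcoeff (expo m) n = of_bool (n = m)"
  unfolding fcoeff_expo by (simp add: integral_expo flip: expo_add)

lemma integrable_mult_expo:
  assumes "integrable torusd f" shows "integrable torusd (\<lambda>x. f x * expo n x)"
proof (rule Bochner_Integration.integrable_bound[OF assms])
  show "(\<lambda>x. f x * expo n x) \<in> borel_measurable torusd"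
    using borel_measurable_integrable[OF assms] by measurable
qed (simp add: norm_mult)

lemma fcoeff_add:
  "integrable torusd f \<Longrightarrow> integrable torusd g \<Longrightarrow>
    fcoeff (\<lambda>x. f x + g x) n = fcoeff f n + fcoeff g n"
  by (simp add: fcoeff_expo algebra_simps integrable_mult_expo)

lemma fcoeff_cmult: "fcoeff (\<lambda>x. c * f x) n = c * fcoeff f n"
  by (simp add: fcoeff_expo mult.assoc)

lemma fcoeff_diff:
  "integrable torusd f \<Longrightarrow> integrable torusd g \<Longrightarrow>
    fcoeff (\<lambda>x. f x - g x) n = fcoeff f n - fcoeff g n"
  by (simp add: fcoeff_expo algebra_simps integrable_mult_expo)

lemma fcoeff_zero [simp]: "fcoeff (\<lambda>x. 0) n = 0"
  by (simp add: fcoeff_expo)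

lemma fcoeff_sum:
  "(\<And>i. i \<in> S \<Longrightarrow> integrable torusd (f i)) \<Longrightarrow>
    fcoeff (\<lambda>x. \<Sum>i\<in>S. f i x) n = (\<Sum>i\<in>S. fcoeff (f i) n)"
  by (simp add: fcoeff_expo sum_distrib_right integrable_mult_expo)

lemma norm_fcoeff_le_L1: "norm (fcoeff f n) \<le> (LINT x|torusd. norm (f x))"
  unfolding fcoeff_expo by (rule order_trans[OF integral_norm_bound]) (simp add: norm_mult)

lemma nrm_expo [simp]: "nrm (expo n) = 1"
  by (simp add: nrm_def torusd.prob_space[unfolded space_torusd])

lemma norm_fcoeff_le: "f \<in> L2 \<Longrightarrow> norm (fcoeff f n) \<le> nrm f"
  using Cauchy_Schwarz[of f "expo (- n)"] by (simp add: fcoeff_expo)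

text \<open>Keeping the finite set and the coefficients apart makes \<open>tsum F (fcoeff f)\<close>
  the Fourier partial sum of \<open>f\<close> over \<open>F\<close>, and lets a spectral restriction
  be an intersection of index sets.\<close>

definition tsum :: "('d \<Rightarrow> int) set \<Rightarrow> (('d \<Rightarrow> int) \<Rightarrow> complex) \<Rightarrow> ('d::finite \<Rightarrow> real) \<Rightarrow> complex" where
  "tsum F c x = (\<Sum>n\<in>F. c n * expo n x)"

lemma tsum_measurable [measurable]: "tsum F c \<in> borel_measurable torusd"
  unfolding tsum_def[abs_def] by measurable

lemma norm_tsum_le: "norm (tsum F c x) \<le> (\<Sum>n\<in>F. norm (c n))"
  unfolding tsum_def by (rule order_trans[OF norm_sum]) (simp add: norm_mult)

lemma tsum_L2 [simp]: "tsum F c \<in> L2"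
  by (rule L2_bounded[OF tsum_measurable norm_tsum_le])

lemma fcoeff_tsum: "finite F \<Longrightarrow> fcoeff (tsum F c) n = (if n \<in> F then c n else 0)"
  unfolding tsum_def[abs_def]
  by (subst fcoeff_sum) (auto simp: fcoeff_cmult fcoeff_of_expo L2_integrable L2_cmult sum.delta' if_distrib of_bool_def cong: if_cong)

lemma integral_mult_cnj_tsum:
  assumes "integrable torusd f"
  shows "(LINT x|torusd. f x * cnj (tsum F c x)) = (\<Sum>n\<in>F. cnj (c n) * fcoeff f n)"
proof -
  have "(LINT x|torusd. f x * cnj (tsum F c x))
      = (LINT x|torusd. (\<Sum>n\<in>F. cnj (c n) * (f x * expo (- n) x)))"
    by (intro Bochner_Integration.integral_cong)
       (auto simp: tsum_def sum_distrib_left cnj_expo mult_ac)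
  also have "\<dots> = (\<Sum>n\<in>F. cnj (c n) * fcoeff f n)"
    by (subst Bochner_Integration.integral_sum)
       (auto simp: fcoeff_expo intro!: integrable_mult_right integrable_mult_expo assms)
  finally show ?thesis .
qed

lemma nrm_diff_sq:
  assumes "f \<in> L2" "g \<in> L2"
  shows "(nrm (\<lambda>x. f x - g x))\<^sup>2
    = (nrm f)\<^sup>2 - 2 * Re (LINT x|torusd. f x * cnj (g x)) + (nrm g)\<^sup>2"
proof -
  have i: "integrable torusd (\<lambda>x. f x * cnj (g x))"
    by (intro L2_mult_integrable L2_cnj assms)
  have "(nrm (\<lambda>x. f x - g x))\<^sup>2
      = (LINT x|torusd. (norm (f x))\<^sup>2 - 2 * Re (f x * cnj (g x)) + (norm (g x))\<^sup>2)"
    unfolding nrm_sq by (intro Bochner_Integration.integral_cong refl) (simp only: cmod_power2, simp add: power2_eq_square algebra_simps)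
  also have "\<dots> = (nrm f)\<^sup>2 - 2 * (LINT x|torusd. Re (f x * cnj (g x))) + (nrm g)\<^sup>2"
    using assms integrable_Re[OF i] by (simp add: nrm_sq L2_def del: times_complex.sel)
  finally show ?thesis by (simp only: integral_Re[OF i])
qed

lemma nrm_sq_complex: "complex_of_real ((nrm f)\<^sup>2) = (LINT x|torusd. f x * cnj (f x))"
  unfolding nrm_sq by (simp only: complex_norm_square flip: integral_complex_of_real)

lemma nrm_tsum: "finite F \<Longrightarrow> (nrm (tsum F c))\<^sup>2 = (\<Sum>n\<in>F. (norm (c n))\<^sup>2)"
proof -
  assume F: "finite F"
  have "complex_of_real ((nrm (tsum F c))\<^sup>2) = (\<Sum>n\<in>F. cnj (c n) * fcoeff (tsum F c) n)"
    by (simp only: nrm_sq_complex integral_mult_cnj_tsum[OF L2_integrable[OF tsum_L2]])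
  also have "\<dots> = complex_of_real (\<Sum>n\<in>F. (norm (c n))\<^sup>2)"
    by (simp only: of_real_sum complex_norm_square) (simp add: fcoeff_tsum F mult.commute)
  finally show ?thesis by (simp only: of_real_eq_iff)
qed

text \<open>Completing the square in the coefficients: only the last sum depends on
  \<open>c\<close>. The choice \<open>c = fcoeff f\<close> gives \<open>Bessel\<close>, and dropping
  the last sum shows that Fourier partial sums are the best approximations with frequencies in
  \<open>F\<close>.\<close>

lemma nrm_diff_tsum:
  assumes "f \<in> L2" "finite F"
  shows "(nrm (\<lambda>x. f x - tsum F c x))\<^sup>2
    = (nrm f)\<^sup>2 - (\<Sum>n\<in>F. (norm (fcoeff f n))\<^sup>2) + (\<Sum>n\<in>F. (norm (c n - fcoeff f n))\<^sup>2)"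
proof -
  have "(nrm (\<lambda>x. f x - tsum F c x))\<^sup>2
      = (nrm f)\<^sup>2 - 2 * Re (\<Sum>n\<in>F. cnj (c n) * fcoeff f n) + (\<Sum>n\<in>F. (norm (c n))\<^sup>2)"
    by (simp only: nrm_diff_sq[OF assms(1) tsum_L2] integral_mult_cnj_tsum[OF L2_integrable[OF assms(1)]]
        nrm_tsum[OF assms(2)])
  also have "(\<Sum>n\<in>F. (norm (c n - fcoeff f n))\<^sup>2)
      = (\<Sum>n\<in>F. (norm (c n))\<^sup>2) - 2 * Re (\<Sum>n\<in>F. cnj (c n) * fcoeff f n) + (\<Sum>n\<in>F. (norm (fcoeff f n))\<^sup>2)"
    unfolding Re_sum sum_distrib_left sum_subtractf[symmetric] sum.distrib[symmetric]
    by (intro sum.cong refl) (simp only: cmod_power2, simp add: power2_eq_square algebra_simps)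
  ultimately show ?thesis by simp
qed

lemma Bessel:
  assumes "f \<in> L2" "finite F"
  shows "(\<Sum>n\<in>F. (norm (fcoeff f n))\<^sup>2) \<le> (nrm f)\<^sup>2"
proof -
  have "0 \<le> (nrm (\<lambda>x. f x - tsum F (fcoeff f) x))\<^sup>2" by simp
  then show ?thesis unfolding nrm_diff_tsum[OF assms] by simp
qed

lemma nrm_diff_partial_sum_le:
  assumes "f \<in> L2" "finite F"
  shows "nrm (\<lambda>x. f x - tsum F (fcoeff f) x) \<le> nrm (\<lambda>x. f x - tsum F c x)"
  by (rule power2_le_imp_le) (auto simp: nrm_diff_tsum[OF assms] intro: sum_nonneg)

section \<open>Exhausting the frequency lattice by finite cubes\<close>

definition cube :: "nat \<Rightarrow> ('d \<Rightarrow> int) set" where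
  "cube N = {n. \<forall>k. \<bar>n k\<bar> \<le> int N}"

lemma finite_cube [simp]: "finite (cube N :: ('d::finite \<Rightarrow> int) set)"
proof -
  have "cube N = PiE (UNIV :: 'd set) (\<lambda>_. {- int N..int N})"
    by (auto simp: cube_def abs_le_iff PiE_iff minus_le_iff)
  then show ?thesis by (simp add: finite_PiE)
qed

lemma cube_mono: "M \<le> N \<Longrightarrow> cube M \<subseteq> cube N"
  unfolding cube_def by (auto intro: order_trans)

lemma ex_cube: "\<exists>N. n \<in> cube N" for n :: "'d::finite \<Rightarrow> int"
proof
  show "n \<in> cube (nat (Max (range (\<lambda>k. \<bar>n k\<bar>))))"
  proof (unfold cube_def, intro CollectI allI)
    fix k
    have "\<bar>n k\<bar> \<le> Max (range (\<lambda>k. \<bar>n k\<bar>))" by (rule Max_ge) auto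
    then show "\<bar>n k\<bar> \<le> int (nat (Max (range (\<lambda>k. \<bar>n k\<bar>))))" by linarith
  qed
qed

text \<open>Monotone convergence along the cubes reduces the infinite sum to finite ones, so
  Bessel's inequality for finite sets is all that is needed later.\<close>

lemma nn_integral_count_space_le:
  fixes u :: "('d::finite \<Rightarrow> int) \<Rightarrow> ennreal"
  assumes "\<And>F. finite F \<Longrightarrow> F \<subseteq> A \<Longrightarrow> sum u F \<le> C"
  shows "(\<integral>\<^sup>+ n. u n \<partial>count_space A) \<le> C"
proof -
  let ?v = "\<lambda>N n. u n * indicator (cube N) n"
  have "(SUP N. ?v N n) = u n" for n
  proof (rule antisym)
    obtain N where "n \<in> cube N" using ex_cube by blast
    then show "u n \<le> (SUP N. ?v N n)" by (intro SUP_upper2[of N]) auto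
  qed (auto intro!: SUP_least simp: indicator_def)
  then have "(\<integral>\<^sup>+ n. u n \<partial>count_space A) = (\<integral>\<^sup>+ n. (SUP N. ?v N n) \<partial>count_space A)"
    by simp
  also have "\<dots> = (SUP N. \<integral>\<^sup>+ n. ?v N n \<partial>count_space A)"
    by (rule nn_integral_monotone_convergence_SUP)
       (auto simp: incseq_def le_fun_def indicator_def dest: cube_mono)
  also have "\<dots> \<le> C"
  proof (rule SUP_least)
    fix N
    have "(\<integral>\<^sup>+ n. ?v N n \<partial>count_space A) = (\<Sum>n\<in>A \<inter> cube N. ?v N n)"
      by (rule nn_integral_count_space') (auto simp: indicator_def)
    also have "\<dots> = sum u (A \<inter> cube N)" by (intro sum.cong) auto
    also have "\<dots> \<le> C" by (rule assms) auto
    finally show "(\<integral>\<^sup>+ n. ?v N n \<partial>count_space A) \<le> C" .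
  qed
  finally show ?thesis .
qed

lemma sum_le_nn_integral_count_space:
  assumes "finite F" "F \<subseteq> A"
  shows "sum u F \<le> (\<integral>\<^sup>+ n. u n \<partial>count_space A)"
proof -
  have "sum u F = (\<integral>\<^sup>+ n. u n * indicator F n \<partial>count_space A)"
    using assms by (subst nn_integral_count_space'[of F]) (auto simp: indicator_def intro!: sum.cong)
  also have "\<dots> \<le> (\<integral>\<^sup>+ n. u n \<partial>count_space A)"
    by (intro nn_integral_mono) (auto simp: indicator_def)
  finally show ?thesis .
qed

subsection \<open>Trigonometric polynomials\<close>

text \<open>The set \<open>K\<close> records the spectrum. With K the half space n_j \<ge> 0 or n_j
  \<ge> 1, membership means analyticity in the variable j, possibly with a zero at the origin, and
  \<open>trigs_mult\<close> turns products into sums of spectra.\<close>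

definition trigs :: "('d \<Rightarrow> int) set \<Rightarrow> (('d::finite \<Rightarrow> real) \<Rightarrow> complex) set" where
  "trigs K = {p. \<exists>F c. finite F \<and> F \<subseteq> K \<and> p = tsum F c}"

lemma trigs_tsum: "finite F \<Longrightarrow> F \<subseteq> K \<Longrightarrow> tsum F c \<in> trigs K"
  by (auto simp: trigs_def)

lemma trigs_L2: "p \<in> trigs K \<Longrightarrow> p \<in> L2"
  by (auto simp: trigs_def)

lemma trigs_measurable: "p \<in> trigs K \<Longrightarrow> p \<in> borel_measurable torusd"
  by (auto simp: trigs_def)

lemma trigs_bounded:
  assumes "p \<in> trigs K" obtains C where "0 \<le> C" "\<And>x. norm (p x) \<le> C"
proof -
  from assms obtain F c where p: "p = tsum F c" by (auto simp: trigs_def)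
  show ?thesis
    by (rule that[of "\<Sum>n\<in>F. norm (c n)"]) (auto simp: p norm_tsum_le sum_nonneg)
qed

lemma trigs_mono: "p \<in> trigs K \<Longrightarrow> K \<subseteq> L \<Longrightarrow> p \<in> trigs L"
  by (auto simp: trigs_def)

lemma trigs_fcoeff: "p \<in> trigs K \<Longrightarrow> n \<notin> K \<Longrightarrow> fcoeff p n = 0"
  by (auto simp: trigs_def fcoeff_tsum)

lemma trigs_zero [simp]: "(\<lambda>x. 0) \<in> trigs K"
proof -
  have "tsum {} c \<in> trigs K" for c by (rule trigs_tsum) auto
  then show ?thesis by (simp add: tsum_def[abs_def])
qed

lemma trigs_expo: "n \<in> K \<Longrightarrow> expo n \<in> trigs K"
  using trigs_tsum[of "{n}" K "\<lambda>_. 1"] by (simp add: tsum_def[abs_def])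

lemma trigs_cmult: "p \<in> trigs K \<Longrightarrow> (\<lambda>x. c * p x) \<in> trigs K"
proof -
  assume "p \<in> trigs K"
  then obtain F a where F: "finite F" "F \<subseteq> K" "p = tsum F a" by (auto simp: trigs_def)
  have "(\<lambda>x. c * p x) = tsum F (\<lambda>n. c * a n)"
    by (auto simp: F tsum_def fun_eq_iff sum_distrib_left mult_ac)
  then show ?thesis using F by (auto simp: trigs_def)
qed

lemma trigs_add:
  assumes "p \<in> trigs K" "q \<in> trigs K" shows "(\<lambda>x. p x + q x) \<in> trigs K"
proof -
  from assms obtain F a G b where F: "finite F" "F \<subseteq> K" "p = tsum F a"
    and G: "finite G" "G \<subseteq> K" "q = tsum G b" by (auto simp: trigs_def)
  have *: "tsum F a x = tsum (F \<union> G) (\<lambda>n. if n \<in> F then a n else 0) x" for x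
    unfolding tsum_def by (rule sum.mono_neutral_cong_left) (use F G in auto)
  have **: "tsum G b x = tsum (F \<union> G) (\<lambda>n. if n \<in> G then b n else 0) x" for x
    unfolding tsum_def by (rule sum.mono_neutral_cong_left) (use F G in auto)
  have "(\<lambda>x. p x + q x)
      = tsum (F \<union> G) (\<lambda>n. (if n \<in> F then a n else 0) + (if n \<in> G then b n else 0))"
    unfolding F(3) G(3) * ** by (simp add: fun_eq_iff tsum_def sum.distrib distrib_right)
  then show ?thesis using F G by (auto simp: trigs_def)
qed

lemma trigs_sum: "(\<And>i. i \<in> S \<Longrightarrow> p i \<in> trigs K) \<Longrightarrow> (\<lambda>x. \<Sum>i\<in>S. p i x) \<in> trigs K"
  by (induction S rule: infinite_finite_induct) (auto intro: trigs_add)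

lemma trigs_mult:
  assumes "p \<in> trigs K" "q \<in> trigs L" "\<And>m n. m \<in> K \<Longrightarrow> n \<in> L \<Longrightarrow> m + n \<in> J"
  shows "(\<lambda>x. p x * q x) \<in> trigs J"
proof -
  from assms obtain F a G b where F: "finite F" "F \<subseteq> K" "p = tsum F a"
    and G: "finite G" "G \<subseteq> L" "q = tsum G b" by (auto simp: trigs_def)
  have "(\<lambda>x. p x * q x) = (\<lambda>x. \<Sum>m\<in>F. \<Sum>n\<in>G. (a m * b n) * expo (m + n) x)"
    by (simp add: F G tsum_def fun_eq_iff sum_product expo_add mult_ac)
  also have "\<dots> \<in> trigs J"
    using F G assms(3) by (intro trigs_sum trigs_cmult trigs_expo) auto
  finally show ?thesis .
qed

lemma trigs_cnj: "p \<in> trigs K \<Longrightarrow> (\<lambda>x. cnj (p x)) \<in> trigs (uminus ` K)"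
proof -
  assume "p \<in> trigs K"
  then obtain F a where F: "finite F" "F \<subseteq> K" "p = tsum F a" by (auto simp: trigs_def)
  have "(\<lambda>x. cnj (p x)) = (\<lambda>x. \<Sum>n\<in>F. cnj (a n) * expo (- n) x)"
    by (simp add: F tsum_def fun_eq_iff cnj_expo)
  also have "\<dots> \<in> trigs (uminus ` K)"
    using F by (intro trigs_sum trigs_cmult trigs_expo) auto
  finally show ?thesis .
qed

section \<open>Density of the trigonometric polynomials in L2\<close>

lemma nrm_tendsto_zero:
  assumes "\<And>i. g i \<in> borel_measurable torusd" "w \<in> L2"
    and "AE x in torusd. (\<lambda>i. g i x) \<longlonglongrightarrow> 0"
    and "\<And>i. AE x in torusd. norm (g i x) \<le> norm (w x)"
  shows "(\<lambda>i. nrm (g i)) \<longlonglongrightarrow> 0"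
proof -
  have "(\<lambda>i. LINT x|torusd. (norm (g i x))\<^sup>2) \<longlonglongrightarrow> (LINT x|(torusd :: ('a \<Rightarrow> real) measure). 0)"
  proof (rule integral_dominated_convergence)
    show "integrable torusd (\<lambda>x. (norm (w x))\<^sup>2)" using assms(2) by (simp add: L2_def)
    show "AE x in torusd. (\<lambda>i. (norm (g i x))\<^sup>2) \<longlonglongrightarrow> 0"
      using assms(3)
    proof eventually_elim
      case (elim x)
      then have "(\<lambda>i. (norm (g i x))\<^sup>2) \<longlonglongrightarrow> (norm (0::complex))\<^sup>2"
        by (intro tendsto_intros)
      then show ?case by simp
    qed
    show "AE x in torusd. norm ((norm (g i x))\<^sup>2) \<le> (norm (w x))\<^sup>2" for i
      using assms(4)[of i] by eventually_elim (auto intro!: power_mono)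
    show "(\<lambda>x. (norm (g i x))\<^sup>2) \<in> borel_measurable torusd" for i
      using assms(1)[of i] by measurable
  qed simp
  then have "(\<lambda>i. sqrt (LINT x|torusd. (norm (g i x))\<^sup>2)) \<longlonglongrightarrow> sqrt 0"
    by (intro tendsto_intros) simp
  then show ?thesis by (simp add: nrm_def)
qed

definition trig_closure :: "(('d::finite \<Rightarrow> real) \<Rightarrow> complex) set" where
  "trig_closure = {f \<in> L2. \<forall>e>0. \<exists>p\<in>trigs UNIV. nrm (\<lambda>x. f x - p x) < e}"

lemma trig_closureD: "f \<in> trig_closure \<Longrightarrow> f \<in> L2"
  by (simp add: trig_closure_def)

lemma trigs_trig_closure: "p \<in> trigs K \<Longrightarrow> p \<in> trig_closure"
  unfolding trig_closure_def
  by (auto intro: trigs_L2 intro!: bexI[of _ p] trigs_mono[of p K] simp: nrm_def)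

lemma trig_closure_closed:
  assumes f: "f \<in> L2" and *: "\<And>e. e > 0 \<Longrightarrow> \<exists>g\<in>trig_closure. nrm (\<lambda>x. f x - g x) < e"
  shows "f \<in> trig_closure"
  unfolding trig_closure_def
proof (intro CollectI conjI allI impI f)
  fix e :: real assume "e > 0"
  then obtain g where g: "g \<in> trig_closure" "nrm (\<lambda>x. f x - g x) < e/2"
    using *[of "e/2"] by auto
  then obtain p where p: "p \<in> trigs UNIV" "nrm (\<lambda>x. g x - p x) < e/2"
    using \<open>e > 0\<close> by (auto simp: trig_closure_def dest!: spec[of _ "e/2"])
  have "nrm (\<lambda>x. (f x - g x) + (g x - p x)) \<le> nrm (\<lambda>x. f x - g x) + nrm (\<lambda>x. g x - p x)"
    by (intro nrm_triangle L2_diff f trig_closureD g trigs_L2[OF p(1)])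
  with g p show "\<exists>p\<in>trigs UNIV. nrm (\<lambda>x. f x - p x) < e"
    by (intro bexI[of _ p]) auto
qed

lemma trig_closure_add:
  assumes "f \<in> trig_closure" "g \<in> trig_closure"
  shows "(\<lambda>x. f x + g x) \<in> trig_closure"
proof (rule trig_closure_closed)
  show "(\<lambda>x. f x + g x) \<in> L2" by (intro L2_add trig_closureD assms)
  fix e :: real assume "e > 0"
  then obtain p q where p: "p \<in> trigs UNIV" "nrm (\<lambda>x. f x - p x) < e/2"
    and q: "q \<in> trigs UNIV" "nrm (\<lambda>x. g x - q x) < e/2"
    using assms unfolding trig_closure_def by (auto dest!: spec[of _ "e/2"])
  have "nrm (\<lambda>x. (f x - p x) + (g x - q x)) \<le> nrm (\<lambda>x. f x - p x) + nrm (\<lambda>x. g x - q x)"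
    by (intro nrm_triangle L2_diff trig_closureD assms trigs_L2[OF p(1)] trigs_L2[OF q(1)])
  with p q show "\<exists>h\<in>trig_closure. nrm (\<lambda>x. f x + g x - h x) < e"
    by (intro bexI[of _ "\<lambda>x. p x + q x"] trigs_trig_closure[OF trigs_add]) (auto simp: algebra_simps)
qed

lemma trig_closure_bounded_mult:
  assumes "f \<in> trig_closure" "m \<in> borel_measurable torusd" "AE x in torusd. norm (m x) \<le> C"
    and *: "\<And>p. p \<in> trigs UNIV \<Longrightarrow> (\<lambda>x. m x * p x) \<in> trig_closure"
  shows "(\<lambda>x. m x * f x) \<in> trig_closure"
proof (rule trig_closure_closed)
  have C: "AE x in torusd. norm (m x) \<le> \<bar>C\<bar> + 1"
    using assms(3) by eventually_elim auto
  show "(\<lambda>x. m x * f x) \<in> L2"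
    by (rule L2_bounded_mult[OF assms(2,3) trig_closureD[OF assms(1)]])
  fix e :: real assume "e > 0"
  \<comment> \<open>Dividing by \<open>\<bar>C\<bar> + 1\<close> keeps the tolerance positive even
    when the bound \<open>C\<close> is 0 or negative.\<close>
  then obtain p where p: "p \<in> trigs UNIV" "nrm (\<lambda>x. f x - p x) < e / (\<bar>C\<bar> + 1)"
    using assms(1) unfolding trig_closure_def by (auto dest!: spec[of _ "e / (\<bar>C\<bar> + 1)"])
  have "nrm (\<lambda>x. m x * (f x - p x)) \<le> (\<bar>C\<bar> + 1) * nrm (\<lambda>x. f x - p x)"
    by (intro nrm_bounded_mult assms(2) C L2_diff trig_closureD[OF assms(1)] trigs_L2[OF p(1)]) auto
  also have "\<dots> < e" using p(2) by (simp add: field_simps)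
  finally show "\<exists>g\<in>trig_closure. nrm (\<lambda>x. m x * f x - g x) < e"
    by (intro bexI[OF _ *[OF p(1)]]) (auto simp: algebra_simps)
qed

lemma trig_closure_trigs_mult:
  assumes "q \<in> trigs UNIV" "f \<in> trig_closure"
  shows "(\<lambda>x. q x * f x) \<in> trig_closure"
proof -
  obtain C where C: "\<And>x. norm (q x) \<le> C" using trigs_bounded[OF assms(1)] by auto
  show ?thesis
    by (rule trig_closure_bounded_mult[OF assms(2) trigs_measurable[OF assms(1)], of C])
       (auto simp: C intro!: trigs_trig_closure trigs_mult[OF assms(1)])
qed

lemma trig_closure_cmult: "f \<in> trig_closure \<Longrightarrow> (\<lambda>x. c * f x) \<in> trig_closure"
  using trig_closure_trigs_mult[OF trigs_cmult[OF trigs_expo[of 0 UNIV], of c], of f] by simp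

text \<open>The real multipliers of the closure form an algebra stable under bounded pointwise limits;
  starting from the coordinates' sines and cosines it is shown to contain all indicators.\<close>

definition mults :: "(('d::finite \<Rightarrow> real) \<Rightarrow> real) set" where
  "mults = {m. m \<in> borel_measurable torusd \<and> (\<exists>C. AE x in torusd. \<bar>m x\<bar> \<le> C) \<and>
     (\<forall>f\<in>trig_closure. (\<lambda>x. complex_of_real (m x) * f x) \<in> trig_closure)}"

lemma mults_const: "(\<lambda>x. c) \<in> mults"
  by (auto simp: mults_def trig_closure_cmult)

lemma mults_add:
  assumes "m \<in> mults" "l \<in> mults" shows "(\<lambda>x. m x + l x) \<in> mults"
proof -
  obtain C D where C: "AE x in torusd. \<bar>m x\<bar> \<le> C" and D: "AE x in torusd. \<bar>l x\<bar> \<le> D"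
    using assms by (auto simp: mults_def)
  have "AE x in torusd. \<bar>m x + l x\<bar> \<le> C + D" using C D by eventually_elim auto
  then show ?thesis using assms
    by (auto simp: mults_def distrib_right intro!: trig_closure_add)
qed

lemma mults_mult:
  assumes "m \<in> mults" "l \<in> mults" shows "(\<lambda>x. m x * l x) \<in> mults"
proof -
  obtain C D where C: "AE x in torusd. \<bar>m x\<bar> \<le> C" and D: "AE x in torusd. \<bar>l x\<bar> \<le> D"
    using assms by (auto simp: mults_def)
  have "AE x in torusd. \<bar>m x * l x\<bar> \<le> C * D"
    using C D by eventually_elim (auto simp: abs_mult intro!: mult_mono)
  then show ?thesis using assms
    by (auto simp: mults_def mult.assoc)
qed

text \<open>The bound \<open>C\<close> is common to all \<open>m i\<close>, which makes
  \<open>2 * C * f\<close> a dominating function for the differences of products. They tend to 0 in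
  L2, and the closure absorbs the limit.\<close>

lemma mults_limit:
  assumes m: "\<And>i. m i \<in> mults" and l: "l \<in> borel_measurable torusd"
    and bd: "\<And>i. AE x in torusd. \<bar>m i x\<bar> \<le> C"
    and lim: "AE x in torusd. (\<lambda>i. m i x) \<longlonglongrightarrow> l x"
  shows "l \<in> mults"
proof -
  have [measurable]: "m i \<in> borel_measurable torusd" for i using m by (simp add: mults_def)
  note l [measurable]
  have "AE x in torusd. \<forall>i. \<bar>m i x\<bar> \<le> C" using bd by (simp add: AE_all_countable)
  then have lC: "AE x in torusd. \<bar>l x\<bar> \<le> C"
    using lim
  proof eventually_elim
    case (elim x)
    then have "(\<lambda>i. \<bar>m i x\<bar>) \<longlonglongrightarrow> \<bar>l x\<bar>" by (intro tendsto_intros)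
    then show ?case by (rule LIMSEQ_le_const2) (use elim in auto)
  qed
  have "(\<lambda>x. complex_of_real (l x) * f x) \<in> trig_closure" if f: "f \<in> trig_closure" for f
  proof (rule trig_closure_closed)
    have f2: "f \<in> L2" by (rule trig_closureD[OF f])
    have [measurable]: "f \<in> borel_measurable torusd" by (rule L2_measurable[OF f2])
    show "(\<lambda>x. complex_of_real (l x) * f x) \<in> L2"
      by (rule L2_bounded_mult[of _ C]) (use lC f2 in auto)
    have "(\<lambda>i. nrm (\<lambda>x. complex_of_real (l x) * f x - complex_of_real (m i x) * f x)) \<longlonglongrightarrow> 0"
    proof (rule nrm_tendsto_zero)
      show "(\<lambda>x. complex_of_real (2 * C) * f x) \<in> L2" by (rule L2_cmult[OF f2])
      show "AE x in torusd. (\<lambda>i. complex_of_real (l x) * f x - complex_of_real (m i x) * f x) \<longlonglongrightarrow> 0"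
        using lim
      proof eventually_elim
        case (elim x)
        then have "(\<lambda>i. complex_of_real (l x) * f x - complex_of_real (m i x) * f x)
            \<longlonglongrightarrow> complex_of_real (l x) * f x - complex_of_real (l x) * f x"
          by (intro tendsto_intros)
        then show ?case by simp
      qed
      show "AE x in torusd. norm (complex_of_real (l x) * f x - complex_of_real (m i x) * f x)
          \<le> norm (complex_of_real (2 * C) * f x)" for i
        using lC bd[of i]
      proof eventually_elim
        case (elim x)
        then have "norm (complex_of_real (l x - m i x)) \<le> 2 * C"
          unfolding norm_of_real by linarith
        then have "norm (complex_of_real (l x - m i x)) * norm (f x) \<le> 2 * C * norm (f x)"
          by (intro mult_right_mono) auto
        moreover have "norm (complex_of_real (2 * C)) = 2 * C" using elim unfolding norm_of_real by linarith
        ultimately show ?case by (metis left_diff_distrib norm_mult of_real_diff)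
      qed
    qed measurable
    then show "\<exists>g\<in>trig_closure. nrm (\<lambda>x. complex_of_real (l x) * f x - g x) < e" if "e > 0" for e
      using that order_tendstoD(2)[of _ 0 sequentially e] m f
      by (fastforce simp: mults_def eventually_sequentially)
  qed
  with l lC show ?thesis by (auto simp: mults_def)
qed

lemma mults_polynomial:
  fixes p :: "real \<Rightarrow> real"
  assumes "real_polynomial_function p" "m \<in> mults"
  shows "(\<lambda>x. p (m x)) \<in> mults"
  using assms(1)
proof induction
  case (linear h)
  have "h y = h 1 * y" for y
    using linear_scale[OF bounded_linear.linear[OF linear], of y 1] by (simp add: mult.commute)
  then have "(\<lambda>x. h (m x)) = (\<lambda>x. h 1 * m x)" by (rule ext)
  then show ?case using mults_mult[OF mults_const assms(2), of "h 1"] by simp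
qed (auto intro: mults_const mults_add mults_mult)

text \<open>Since \<open>m\<close> takes values in the compact set \<open>S\<close> almost
  everywhere, uniform polynomial approximation of \<open>g\<close> on \<open>S\<close> becomes
  bounded convergence of multipliers. Only almost every value of \<open>m\<close> has to lie in
  \<open>S\<close>, which suits multipliers that are essentially bounded.\<close>

lemma mults_continuous:
  fixes g :: "real \<Rightarrow> real"
  assumes m: "m \<in> mults" and S: "compact S" "AE x in torusd. m x \<in> S"
    and g: "continuous_on S g" "(\<lambda>x. g (m x)) \<in> borel_measurable torusd"
  shows "(\<lambda>x. g (m x)) \<in> mults"
proof -
  have "\<forall>i. \<exists>p. real_polynomial_function p \<and> (\<forall>y\<in>S. \<bar>g y - p y\<bar> < 1 / Suc i)"
  proof
    fix i :: nat
    show "\<exists>p. real_polynomial_function p \<and> (\<forall>y\<in>S. \<bar>g y - p y\<bar> < 1 / Suc i)"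
      by (rule Stone_Weierstrass_real_polynomial_function[OF S(1) g(1), of "1 / Suc i"]) auto
  qed
  then obtain p where p: "\<And>i. real_polynomial_function (p i)"
      "\<And>i y. y \<in> S \<Longrightarrow> \<bar>g y - p i y\<bar> < 1 / Suc i"
    by metis
  obtain B where B: "\<And>y. y \<in> S \<Longrightarrow> \<bar>g y\<bar> \<le> B"
    using compact_imp_bounded[OF compact_continuous_image[OF g(1) S(1)]]
    by (auto simp: bounded_iff)
  show ?thesis
  proof (rule mults_limit[OF mults_polynomial[OF p(1) m] g(2)])
    fix i
    show "AE x in torusd. \<bar>p i (m x)\<bar> \<le> B + 1"
      using S(2)
    proof eventually_elim
      case (elim x)
      have "1 / real (Suc i) \<le> 1" by simp
      with p(2)[OF elim, of i] B[OF elim] show ?case by linarith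
    qed
  next
    show "AE x in torusd. (\<lambda>i. p i (m x)) \<longlonglongrightarrow> g (m x)"
      using S(2)
    proof eventually_elim
      case (elim x)
      have "(\<lambda>i. p i (m x) - g (m x)) \<longlonglongrightarrow> 0"
      proof (rule Lim_null_comparison)
        show "\<forall>\<^sub>F i in sequentially. norm (p i (m x) - g (m x)) \<le> 1 / real (Suc i)"
          using p(2)[OF elim] by (auto simp: abs_minus_commute less_imp_le)
        show "(\<lambda>i. 1 / real (Suc i)) \<longlonglongrightarrow> 0" by (rule LIMSEQ_Suc[OF lim_1_over_n])
      qed
      then show ?case by (rule LIM_zero_cancel)
    qed
  qed
qed

lemma mults_at_least:
  assumes m: "m \<in> mults"
  shows "(\<lambda>x. indicator {a..} (m x)) \<in> mults"
proof -
  have [measurable]: "m \<in> borel_measurable torusd" using m by (simp add: mults_def)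
  obtain C where C: "AE x in torusd. \<bar>m x\<bar> \<le> C" using m by (auto simp: mults_def)
  \<comment> \<open>A ramp equal to 1 on \<open>{a..}\<close> that falls linearly to 0 within
    distance 1/i to the left of \<open>a\<close> (for i > 0). The limit is the indicator of the
    closed half line.\<close>
  define g :: "nat \<Rightarrow> real \<Rightarrow> real" where "g i y = max 0 (min 1 (1 + real i * (y - a)))" for i y
  show ?thesis
  proof (rule mults_limit[where m="\<lambda>i x. g i (m x)" and C=1])
    fix i
    have cont: "continuous_on UNIV (g i)" unfolding g_def by (intro continuous_intros)
    have "AE x in torusd. m x \<in> {-C..C}" using C by eventually_elim auto
    then show "(\<lambda>x. g i (m x)) \<in> mults"
      by (intro mults_continuous[OF m, of "{-C..C}"])
         (auto intro: continuous_on_subset[OF cont] measurable_compose[OF _ borel_measurable_continuous_onI[OF cont]])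
  next
    show "AE x in torusd. (\<lambda>i. g i (m x)) \<longlonglongrightarrow> indicator {a..} (m x)"
    proof (rule AE_I2)
      fix x
      show "(\<lambda>i. g i (m x)) \<longlonglongrightarrow> indicator {a..} (m x)"
      proof (cases "a \<le> m x")
        case True
        then have "g i (m x) = 1" for i by (simp add: g_def)
        then show ?thesis using True by simp
      next
        case False
        obtain N :: nat where N: "1 / (a - m x) < real N" using reals_Archimedean2 by blast
        have "g i (m x) = 0" if "N \<le> i" for i
        proof -
          have "1 / (a - m x) \<le> real i" using N that by simp
          then have "1 \<le> real i * (a - m x)" using False by (simp add: field_simps)
          then have "1 + real i * (m x - a) \<le> 0" by (simp add: algebra_simps)
          then show ?thesis by (simp add: g_def)
        qed
        then have "\<forall>\<^sub>F i in sequentially. g i (m x) = 0" by (auto simp: eventually_sequentially)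
        then show ?thesis using False by (simp add: tendsto_eventually)
      qed
    qed
  qed (auto simp: g_def)
qed

definition basis_freq :: "'d \<Rightarrow> 'd \<Rightarrow> int" where "basis_freq k = (\<lambda>i. of_bool (i = k))"

lemma expo_basis_freq: "expo (basis_freq k) x = cis (x k)"
proof -
  have "expo (basis_freq k) x = (\<Prod>i\<in>UNIV. if i = k then cis (x k) else 1)"
    unfolding expo_prod by (intro prod.cong) (auto simp: basis_freq_def)
  then show ?thesis by simp
qed

lemma mults_cos: "(\<lambda>x. cos (x k)) \<in> mults"
proof -
  have "(\<lambda>x. complex_of_real (cos (x k)) * f x) \<in> trig_closure" if "f \<in> trig_closure" for f
  proof -
    have "complex_of_real (cos (x k)) = 1/2 * expo (basis_freq k) x + 1/2 * expo (- basis_freq k) x" for x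
      unfolding cnj_expo[symmetric] expo_basis_freq by (simp add: complex_eq_iff)
    then have "(\<lambda>x. complex_of_real (cos (x k))) \<in> trigs UNIV"
      by (simp only:) (intro trigs_add trigs_cmult trigs_expo UNIV_I)
    from trig_closure_trigs_mult[OF this that] show ?thesis .
  qed
  then show ?thesis by (auto simp: mults_def intro!: exI[of _ 1])
qed

lemma mults_sin: "(\<lambda>x. sin (x k)) \<in> mults"
proof -
  have "(\<lambda>x. complex_of_real (sin (x k)) * f x) \<in> trig_closure" if "f \<in> trig_closure" for f
  proof -
    have "complex_of_real (sin (x k)) = (-\<i>/2) * expo (basis_freq k) x + (\<i>/2) * expo (- basis_freq k) x" for x
      unfolding cnj_expo[symmetric] expo_basis_freq by (simp add: complex_eq_iff)
    then have "(\<lambda>x. complex_of_real (sin (x k))) \<in> trigs UNIV"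
      by (simp only:) (intro trigs_add trigs_cmult trigs_expo UNIV_I)
    from trig_closure_trigs_mult[OF this that] show ?thesis .
  qed
  then show ?thesis by (auto simp: mults_def intro!: exI[of _ 1])
qed

lemma AE_torusd_less: "AE x in (torusd :: ('d::finite \<Rightarrow> real) measure). \<forall>k. x k < 2*pi"
proof -
  have "AE t in torus. t < 2*pi"
    unfolding torus_def by (rule AE_uniform_measureI) (use AE_lborel_singleton[of "2*pi"] in auto)
  then have "AE x in torusd. x k < 2*pi" for k :: 'd
    unfolding torusd_def by (intro AE_PiM_component[OF prob_space_torus]) auto
  then show ?thesis by (simp add: AE_all_countable)
qed

lemma mults_cong_AE:
  assumes m: "m \<in> mults" and l: "l \<in> borel_measurable torusd" "AE x in torusd. m x = l x"
  shows "l \<in> mults"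
proof -
  obtain C where "AE x in torusd. \<bar>m x\<bar> \<le> C" using m by (auto simp: mults_def)
  moreover have "AE x in torusd. (\<lambda>i::nat. m x) \<longlonglongrightarrow> l x"
    using l(2) by eventually_elim simp
  ultimately show ?thesis
    by (rule mults_limit[where m="\<lambda>_. m", OF m l(1)])
qed

text \<open>The coordinate is not periodic, but on one period it is a bounded measurable function of
  sine and cosine: it is \<open>arccos (cos t)\<close> on the upper half circle and 2 pi minus this
  on the lower one, and the sign of the sine selects the half.\<close>

lemma mults_component: "(\<lambda>x. x k) \<in> mults"
proof -
  have [measurable]: "(\<lambda>x. arccos (cos (x k))) \<in> borel_measurable torusd"
  proof -
    have "(\<lambda>t. arccos (cos t)) \<in> borel_measurable borel"
      by (intro borel_measurable_continuous_onI continuous_on_arccos continuous_intros) auto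
    then show ?thesis by measurable
  qed
  have a: "(\<lambda>x. arccos (cos (x k))) \<in> mults"
    by (rule mults_continuous[OF mults_cos, of "{-1..1}"])
       (auto intro!: continuous_intros)
  have s: "(\<lambda>x. indicator {0..} (sin (x k))) \<in> mults"
    by (rule mults_at_least[OF mults_sin])
  let ?s = "\<lambda>x. indicator {0..} (sin (x k)) :: real" and ?a = "\<lambda>x. arccos (cos (x k))"
  have "(\<lambda>x. ?s x * ?a x + (1 + (-1) * ?s x) * (2 * pi + (-1) * ?a x)) \<in> mults"
    by (intro mults_add mults_mult mults_const a s)
  then show ?thesis
  proof (rule mults_cong_AE)
    \<comment> \<open>At the endpoint 2 pi the sine is 0 and the formula returns 0 instead of 2 pi,
      so that null set has to be excluded by \<open>AE_torusd_less\<close>.\<close>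
    show "AE x in torusd. ?s x * ?a x + (1 + (-1) * ?s x) * (2 * pi + (-1) * ?a x) = x k"
      using AE_torusd AE_torusd_less
    proof eventually_elim
      case (elim x)
      then have k: "0 \<le> x k" "x k < 2*pi" by auto
      show ?case
      proof (cases "x k \<le> pi")
        case True
        then show ?thesis using k by (simp add: sin_ge_zero arccos_cos)
      next
        case False
        have "cos (x k) = cos (2*pi - x k)" by simp
        moreover have "arccos (cos (2*pi - x k)) = 2*pi - x k"
          by (rule arccos_cos) (use k False in auto)
        moreover have "sin (x k) < 0" using k False by (intro sin_lt_zero) auto
        ultimately show ?thesis by simp
      qed
    qed
  qed measurable
qed

lemma mults_indicator_compl:
  "indicator A \<in> mults \<Longrightarrow> indicator (UNIV - A) \<in> mults"
proof -
  assume "indicator A \<in> mults"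
  then have "(\<lambda>x. 1 + (-1) * indicator A x) \<in> mults"
    by (intro mults_add mults_mult mults_const) auto
  moreover have "(\<lambda>x. 1 + (-1) * indicator A x) = (indicator (UNIV - A) :: _ \<Rightarrow> real)"
    by (auto simp: indicator_def)
  ultimately show ?thesis by simp
qed

lemma mults_indicator_UN:
  assumes "\<And>i::nat. indicator (A i) \<in> mults" "\<And>i. A i \<in> sets torusd"
  shows "indicator (\<Union>i. A i) \<in> mults"
proof -
  have fin: "indicator (\<Union>i<n. A i) \<in> mults" for n
  proof (induction n)
    case 0
    have "(indicator {} :: ('a \<Rightarrow> real) \<Rightarrow> real) = (\<lambda>x. 0)" by (auto simp: indicator_def)
    then show ?case using mults_const[of 0] by simp
  next
    case (Suc n)
    have "(\<lambda>x. indicator (\<Union>i<n. A i) x + (indicator (A n) x + (-1) * (indicator (\<Union>i<n. A i) x * indicator (A n) x))) \<in> mults"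
      by (intro mults_add mults_mult mults_const) (auto intro: Suc assms(1))
    moreover have "(\<lambda>x. indicator (\<Union>i<n. A i) x + (indicator (A n) x + (-1) * (indicator (\<Union>i<n. A i) x * indicator (A n) x)))
        = (indicator (\<Union>i<Suc n. A i) :: _ \<Rightarrow> real)"
      by (auto simp: indicator_def fun_eq_iff less_Suc_eq)
    ultimately show ?case by simp
  qed
  show ?thesis
  proof (rule mults_limit[OF fin, where C=1])
    show "indicator (\<Union>i. A i) \<in> borel_measurable torusd" using assms(2) by measurable
    show "AE x in torusd. (\<lambda>n. indicator (\<Union>i<n. A i) x) \<longlonglongrightarrow> (indicator (\<Union>i. A i) x :: real)"
      by (intro AE_I2 LIMSEQ_indicator_UN)
  qed (auto simp: indicator_def)
qed

text \<open>Induction over the sigma algebra generated by the half lines \<open>{a..}\<close>.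
  Measurability of the set is carried along because the step for countable unions passes to a limit
  and needs a measurable limit function.\<close>

lemma mults_indicator_component:
  assumes "B \<in> sets borel" shows "indicator {x. x k \<in> B} \<in> mults"
proof -
  have "B \<in> sigma_sets UNIV (range (\<lambda>a::real. {a..}))"
    using assms by (simp add: borel_Ici sets_measure_of)
  then have "indicator {x. x k \<in> B} \<in> mults \<and> {x. x k \<in> B} \<in> sets torusd"
  proof induction
    case (Basic B)
    then obtain a where B: "B = {a..}" by auto
    have "(indicator {x. x k \<in> B} :: _ \<Rightarrow> real) = (\<lambda>x. indicator {a..} (x k))"
      by (auto simp: B indicator_def)
    moreover have "{x. x k \<in> B} \<in> sets torusd"
      using measurable_sets[OF component_measurable[of k], of B] B by (simp add: vimage_def)
    ultimately show ?case using mults_at_least[OF mults_component] by simp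
  next
    case Empty
    have "(indicator {} :: ('a \<Rightarrow> real) \<Rightarrow> real) = (\<lambda>x. 0)" by (auto simp: indicator_def)
    then show ?case using mults_const[of 0] by simp
  next
    case (Compl B)
    have "{x. x k \<in> UNIV - B} = UNIV - {x. x k \<in> B}" by auto
    then show ?case using Compl mults_indicator_compl[of "{x. x k \<in> B}"]
      sets.compl_sets[of "{x. x k \<in> B}" torusd] by simp
  next
    case (Union B)
    have "{x. x k \<in> \<Union> (range B)} = (\<Union>i. {x. x k \<in> B i})" by auto
    then show ?case using Union mults_indicator_UN[of "\<lambda>i. {x. x k \<in> B i}"]
      sets.countable_UN[of "\<lambda>i. {x. x k \<in> B i}" UNIV torusd] by auto
  qed
  then show ?thesis ..
qed

lemma mults_indicator:
  assumes "A \<in> sets torusd" shows "indicator A \<in> mults"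
proof -
  have "A \<in> sigma_sets UNIV {{f. f i \<in> B} | i B. B \<in> sets borel}"
    using assms unfolding sets_torusd sets_PiM_single by simp
  then have "indicator A \<in> mults \<and> A \<in> sets torusd"
  proof induction
    case (Basic A)
    then obtain k B where A: "A = {f. f k \<in> B}" "B \<in> sets borel" by auto
    then show ?case
      using measurable_sets[OF component_measurable[of k], of B] mults_indicator_component[of B k]
      by (simp add: vimage_def)
  next
    case Empty
    have "(indicator {} :: ('a \<Rightarrow> real) \<Rightarrow> real) = (\<lambda>x. 0)" by (auto simp: indicator_def)
    then show ?case using mults_const[of 0] by simp
  next
    case (Compl B)
    then show ?case using mults_indicator_compl[of B] sets.compl_sets[of B torusd] by simp
  next
    case (Union B)
    then show ?case using mults_indicator_UN[of B] sets.countable_UN[of B UNIV torusd] by auto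
  qed
  then show ?thesis ..
qed

text \<open>Each indicator multiplies the constant 1 into the closure, hence simple functions belong
  to it, and these are dense.\<close>

lemma trig_closure_eq: "trig_closure = L2"
proof (intro equalityI subsetI)
  fix f :: "('a \<Rightarrow> real) \<Rightarrow> complex" assume f: "f \<in> L2"
  have [measurable]: "f \<in> borel_measurable torusd" by (rule L2_measurable[OF f])
  obtain s where s: "\<And>i. simple_function torusd (s i)"
      "\<And>x. x \<in> space torusd \<Longrightarrow> (\<lambda>i. s i x) \<longlonglongrightarrow> f x"
      "\<And>i x. x \<in> space torusd \<Longrightarrow> dist (s i x) 0 \<le> 2 * dist (f x) 0"
    using borel_measurable_implies_sequence_metric[of f torusd 0] by auto
  have [measurable]: "s i \<in> borel_measurable torusd" for i
    by (rule borel_measurable_simple_function[OF s(1)])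
  have one: "(\<lambda>x::'a \<Rightarrow> real. 1) \<in> trig_closure"
  proof -
    have "expo 0 = (\<lambda>x::'a \<Rightarrow> real. 1)" by (simp add: fun_eq_iff)
    moreover have "(expo 0 :: ('a \<Rightarrow> real) \<Rightarrow> complex) \<in> trig_closure"
      by (rule trigs_trig_closure[OF trigs_expo[of 0 UNIV]]) simp
    ultimately show ?thesis by simp
  qed
  have st: "s i \<in> trig_closure" for i
  proof -
    have fin: "finite (range (s i))" using s(1)[of i] by (simp add: simple_function_def)
    have sets: "s i -` {v} \<in> sets torusd" for v
      using measurable_sets[of "s i" torusd borel "{v}"] by simp
    have eq: "s i = (\<lambda>x. \<Sum>v\<in>range (s i). v * (complex_of_real (indicator (s i -` {v}) x) * 1))"
    proof
      fix x
      have "(\<Sum>v\<in>range (s i). v * (complex_of_real (indicator (s i -` {v}) x) * 1))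
          = (\<Sum>v\<in>range (s i). if v = s i x then v else 0)"
        by (intro sum.cong) (auto simp: indicator_def)
      then show "s i x = (\<Sum>v\<in>range (s i). v * (complex_of_real (indicator (s i -` {v}) x) * 1))"
        using fin by simp
    qed
    have "(\<lambda>x. \<Sum>v\<in>V. v * (complex_of_real (indicator (s i -` {v}) x) * 1)) \<in> trig_closure"
      if "finite V" for V
      using that
    proof induction
      case empty then show ?case using trigs_trig_closure[OF trigs_zero] by simp
    next
      case (insert v V)
      have "(\<lambda>x. complex_of_real (indicator (s i -` {v}) x) * 1) \<in> trig_closure"
        using mults_indicator[OF sets[of v]] one by (auto simp: mults_def)
      from trig_closure_add[OF trig_closure_cmult[OF this, of v] insert.IH] insert.hyps
      show ?case by simp
    qed
    from this[OF fin] eq show ?thesis by simp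
  qed
  have "(\<lambda>i. nrm (\<lambda>x. f x - s i x)) \<longlonglongrightarrow> 0"
  proof (rule nrm_tendsto_zero)
    \<comment> \<open>The approximants satisfy |s i| \<le> 2 |f|, so the differences are dominated
      by 3 |f|.\<close>
    show "(\<lambda>x. 3 * f x) \<in> L2" by (rule L2_cmult[OF f])
    show "AE x in torusd. (\<lambda>i. f x - s i x) \<longlonglongrightarrow> 0"
    proof (rule AE_I2)
      fix x
      have "(\<lambda>i. f x - s i x) \<longlonglongrightarrow> f x - f x" by (intro tendsto_intros s(2)) auto
      then show "(\<lambda>i. f x - s i x) \<longlonglongrightarrow> 0" by simp
    qed
    show "AE x in torusd. norm (f x - s i x) \<le> norm (3 * f x)" for i
    proof (rule AE_I2)
      fix x
      have "norm (f x - s i x) \<le> norm (f x) + norm (s i x)" by (rule norm_triangle_ineq4)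
      also have "\<dots> \<le> norm (3 * f x)" using s(3)[of x i] by (simp add: norm_mult)
      finally show "norm (f x - s i x) \<le> norm (3 * f x)" .
    qed
  qed measurable
  then have "\<exists>g\<in>trig_closure. nrm (\<lambda>x. f x - g x) < e" if "e > 0" for e
    using order_tendstoD(2)[of _ 0 sequentially e] that st by (fastforce simp: eventually_sequentially)
  then show "f \<in> trig_closure" by (intro trig_closure_closed f)
qed (rule trig_closureD)

theorem Fourier_approx:
  assumes "f \<in> L2" "e > 0"
  obtains F where "finite F" "nrm (\<lambda>x. f x - tsum F (fcoeff f) x) < e"
proof -
  have "f \<in> trig_closure" using assms(1) by (simp add: trig_closure_eq)
  with assms(2) obtain F c where "finite F" "nrm (\<lambda>x. f x - tsum F c x) < e"
    by (auto simp: trig_closure_def trigs_def)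
  with nrm_diff_partial_sum_le[OF assms(1), of F c] show ?thesis
    by (intro that[of F]) auto
qed

text \<open>Formally the coefficient is the convolution of the two coefficient families, each term
  of which vanishes by assumption. Replacing \<open>f\<close> by a Fourier partial sum makes the
  convolution finite, and the approximation property controls the rest. This is the tool for all
  statements on the spectrum of a product with an H2 function.\<close>

lemma fcoeff_mult_eq_0:
  assumes f: "f \<in> L2" and g: "g \<in> L2"
    and *: "\<And>m. fcoeff f m \<noteq> 0 \<Longrightarrow> fcoeff g (n - m) = 0"
  shows "fcoeff (\<lambda>x. f x * g x) n = 0"
proof (rule ccontr)
  assume nz: "fcoeff (\<lambda>x. f x * g x) n \<noteq> 0"
  \<comment> \<open>Chosen so that the error \<open>e * nrm g\<close> stays strictly below the
    supposedly nonzero coefficient; the summand 1 covers \<open>nrm g = 0\<close>.\<close>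
  define e where "e = norm (fcoeff (\<lambda>x. f x * g x) n) / (nrm g + 1)"
  have "e > 0" using nz by (auto simp: e_def intro!: divide_pos_pos add_nonneg_pos)
  then obtain F where F: "finite F" "nrm (\<lambda>x. f x - tsum F (fcoeff f) x) < e"
    by (rule Fourier_approx[OF f])
  let ?p = "tsum F (fcoeff f)"
  have "(\<lambda>x. ?p x * g x) = (\<lambda>x. \<Sum>m\<in>F. fcoeff f m * (expo m x * g x))"
    by (simp add: tsum_def fun_eq_iff sum_distrib_right mult.assoc)
  then have "fcoeff (\<lambda>x. ?p x * g x) n = (\<Sum>m\<in>F. fcoeff f m * fcoeff g (n - m))"
    by (simp add: fcoeff_sum fcoeff_cmult fcoeff_expo_mult L2_integrable L2_cmult L2_mult_integrable g)
  also have "\<dots> = 0" using * by (intro sum.neutral) auto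
  finally have p0: "fcoeff (\<lambda>x. ?p x * g x) n = 0" .
  have "fcoeff (\<lambda>x. f x * g x) n = fcoeff (\<lambda>x. f x * g x - ?p x * g x) n"
    by (subst fcoeff_diff) (auto simp: p0 intro!: L2_mult_integrable f g)
  also have "\<dots> = fcoeff (\<lambda>x. (f x - ?p x) * g x) n" by (simp add: left_diff_distrib)
  also have "norm \<dots> \<le> (LINT x|torusd. norm ((f x - ?p x) * g x))" by (rule norm_fcoeff_le_L1)
  also have "\<dots> \<le> nrm (\<lambda>x. f x - ?p x) * nrm g"
    by (intro Cauchy_Schwarz_norm L2_diff f g tsum_L2)
  also have "\<dots> \<le> e * nrm g" by (intro mult_right_mono) (use F in auto)
  also have "\<dots> < e * (nrm g + 1)" using \<open>e > 0\<close> by (intro mult_strict_left_mono) auto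
  also have "\<dots> = norm (fcoeff (\<lambda>x. f x * g x) n)" by (simp add: e_def add_nonneg_pos[THEN less_imp_neq, symmetric])
  finally show False by simp
qed

subsection \<open>Completeness and spectral projections\<close>

lemma L1_le_nrm: "f \<in> L2 \<Longrightarrow> (LINT x|torusd. norm (f x)) \<le> nrm f"
  using Cauchy_Schwarz_norm[of f "expo 0"] by simp

lemma nrm_le_of_nn_integral:
  assumes "f \<in> borel_measurable torusd" "0 \<le> e"
    and "(\<integral>\<^sup>+ x. ennreal ((norm (f x))\<^sup>2) \<partial>torusd) \<le> ennreal (e\<^sup>2)"
  shows "f \<in> L2" "nrm f \<le> e"
proof -
  have "integrable torusd (\<lambda>x. (norm (f x))\<^sup>2)"
    using assms by (intro integrableI_bounded) (auto simp: le_less_trans[OF _ ennreal_less_top])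
  with assms(1) show f: "f \<in> L2" by (simp add: L2_def)
  from assms(3) have "(nrm f)\<^sup>2 \<le> e\<^sup>2" by (simp add: nn_integral_L2[OF f])
  then show "nrm f \<le> e" using assms(2) by (rule power2_le_imp_le)
qed

text \<open>The almost everywhere convergent subsequence of the Riesz-Fischer argument is part of
  the conclusion because a pointwise bound on symbols has to survive the passage to the
  limit.\<close>

lemma L2_complete:
  assumes f: "\<And>i. f i \<in> L2"
    and Cauchy: "\<And>e. e > 0 \<Longrightarrow> \<exists>N. \<forall>i\<ge>N. \<forall>j\<ge>N. nrm (\<lambda>x. f i x - f j x) < e"
  obtains g r where "g \<in> L2" "(\<lambda>i. nrm (\<lambda>x. f i x - g x)) \<longlonglongrightarrow> 0"
    "strict_mono r" "AE x in torusd. (\<lambda>i. f (r i) x) \<longlonglongrightarrow> g x"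
proof -
  have fm [measurable]: "f i \<in> borel_measurable torusd" for i by (rule L2_measurable[OF f])
  have "\<forall>k. \<exists>N. \<forall>i\<ge>N. \<forall>j\<ge>N. nrm (\<lambda>x. f i x - f j x) < (1/2)^k"
    by (intro allI Cauchy) simp
  then obtain N where N: "\<And>k i j. N k \<le> i \<Longrightarrow> N k \<le> j \<Longrightarrow> nrm (\<lambda>x. f i x - f j x) < (1/2)^k"
    by metis
  \<comment> \<open>Strictly increasing with \<open>N k \<le> r k\<close>, so that consecutive terms
    along \<open>r\<close> differ by less than 2^(-k) and the differences are summable.\<close>
  define r where "r = rec_nat (N 0) (\<lambda>k p. max (Suc p) (N (Suc k)))"
  have r_Suc: "r (Suc k) = max (Suc (r k)) (N (Suc k))" for k by (simp add: r_def)
  have mono: "strict_mono r" unfolding strict_mono_Suc_iff by (simp add: r_Suc less_max_iff_disj)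
  have rN: "N k \<le> r k" for k by (cases k) (auto simp: r_def)
  define D where "D i x = f (r (Suc i)) x - f (r i) x" for i x
  have D2: "D i \<in> L2" for i unfolding D_def by (intro L2_diff f)
  have Dm [measurable]: "D i \<in> borel_measurable torusd" for i by (rule L2_measurable[OF D2])
  have D: "(LINT x|torusd. norm (D i x)) \<le> (1/2)^i" for i
  proof -
    have "r i \<le> r (Suc i)" by (simp add: r_Suc)
    then have "N i \<le> r (Suc i)" using rN[of i] by simp
    from N[OF this rN[of i]] L1_le_nrm[OF D2, of i] show ?thesis unfolding D_def by linarith
  qed
  have "(\<integral>\<^sup>+ x. (\<Sum>i. ennreal (norm (D i x))) \<partial>torusd) = (\<Sum>i. \<integral>\<^sup>+ x. ennreal (norm (D i x)) \<partial>torusd)"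
    by (rule nn_integral_suminf) measurable
  also have "\<dots> = (\<Sum>i. ennreal (LINT x|torusd. norm (D i x)))"
    by (rule suminf_cong, rule nn_integral_eq_integral[OF integrable_norm[OF L2_integrable[OF D2]]]) simp
  also have "\<dots> \<le> (\<Sum>i. ennreal ((1/2)^i))"
    by (intro suminf_le ennreal_leI D) auto
  also have "\<dots> = ennreal (\<Sum>i. (1/2)^i)"
    by (rule suminf_ennreal2) (auto intro: summable_geometric)
  also have "\<dots> < \<infinity>" by simp
  finally have "AE x in torusd. (\<Sum>i. ennreal (norm (D i x))) \<noteq> \<infinity>"
    by (intro nn_integral_noteq_infinite) auto
  then have conv: "AE x in torusd. convergent (\<lambda>i. f (r i) x)"
  proof eventually_elim
    case (elim x)
    then have "summable (\<lambda>i. norm (D i x))"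
      by (intro summable_suminf_not_top) (auto simp: top_ennreal_def)
    then have "convergent (\<lambda>n. \<Sum>i<n. D i x)"
      unfolding summable_iff_convergent[symmetric] by (rule summable_norm_cancel)
    then have "convergent (\<lambda>n. f (r 0) x + (\<Sum>i<n. D i x))"
      by (intro convergent_add convergent_const)
    moreover have "f (r 0) x + (\<Sum>i<n. D i x) = f (r n) x" for n
    proof (induction n)
      case (Suc n)
      then show ?case by (simp add: D_def flip: add.assoc)
    qed simp
    ultimately show ?case by simp
  qed
  define g where "g x = lim (\<lambda>i. f (r i) x)" for x
  have [measurable]: "g \<in> borel_measurable torusd"
    unfolding g_def by (rule borel_measurable_lim_metric) measurable
  have lim: "AE x in torusd. (\<lambda>i. f (r i) x) \<longlonglongrightarrow> g x"
    using conv by eventually_elim (simp add: g_def convergent_LIMSEQ_iff)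
  \<comment> \<open>Fatou's lemma along the subsequence \<open>r\<close>: it bounds the distance to
    \<open>g\<close> and at the same time shows that the difference is square integrable.\<close>
  have close: "(\<lambda>x. f i x - g x) \<in> L2 \<and> nrm (\<lambda>x. f i x - g x) \<le> e"
    if "e > 0" and i: "\<And>j. j \<ge> M \<Longrightarrow> nrm (\<lambda>x. f i x - f j x) < e" for i e M
  proof -
    let ?u = "\<lambda>k x. ennreal ((norm (f i x - f (r k) x))\<^sup>2)"
    have "(\<integral>\<^sup>+ x. ennreal ((norm (f i x - g x))\<^sup>2) \<partial>torusd) = (\<integral>\<^sup>+ x. liminf (\<lambda>k. ?u k x) \<partial>torusd)"
    proof (rule nn_integral_cong_AE)
      show "AE x in torusd. ennreal ((norm (f i x - g x))\<^sup>2) = liminf (\<lambda>k. ?u k x)"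
        using lim
      proof eventually_elim
        case (elim x)
        then have "(\<lambda>k. ?u k x) \<longlonglongrightarrow> ennreal ((norm (f i x - g x))\<^sup>2)"
          by (intro tendsto_intros)
        then show ?case by (intro lim_imp_Liminf[symmetric]) auto
      qed
    qed
    also have "\<dots> \<le> liminf (\<lambda>k. \<integral>\<^sup>+ x. ?u k x \<partial>torusd)"
      by (rule nn_integral_liminf) measurable
    also have "\<dots> \<le> liminf (\<lambda>k. ennreal (e\<^sup>2))"
    proof (rule Liminf_mono)
      show "\<forall>\<^sub>F k in sequentially. (\<integral>\<^sup>+ x. ?u k x \<partial>torusd) \<le> ennreal (e\<^sup>2)"
        unfolding eventually_sequentially
      proof (intro exI allI impI)
        fix k assume "M \<le> k"
        then have "M \<le> r k" using strict_mono_imp_increasing[OF mono, of k] by simp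
        then have "nrm (\<lambda>x. f i x - f (r k) x) < e" by (rule i)
        then show "(\<integral>\<^sup>+ x. ?u k x \<partial>torusd) \<le> ennreal (e\<^sup>2)"
          by (subst nn_integral_L2[OF L2_diff[OF f f]]) (auto intro!: ennreal_leI power_mono)
      qed
    qed
    also have "\<dots> = ennreal (e\<^sup>2)" by (simp add: Liminf_const)
    finally show ?thesis using \<open>e > 0\<close> by (intro conjI nrm_le_of_nn_integral) auto
  qed
  show thesis
  proof (rule that[OF _ _ mono lim])
    obtain M where M: "\<forall>i\<ge>M. \<forall>j\<ge>M. nrm (\<lambda>x. f i x - f j x) < 1" using Cauchy[of 1] by auto
    then have "(\<lambda>x. f M x - g x) \<in> L2" using close[of 1 M M] by auto
    from L2_diff[OF f[of M] this] show "g \<in> L2" by simp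
    show "(\<lambda>i. nrm (\<lambda>x. f i x - g x)) \<longlonglongrightarrow> 0"
    proof (rule LIMSEQ_I)
      fix e :: real assume "e > 0"
      then obtain M where M: "\<forall>i\<ge>M. \<forall>j\<ge>M. nrm (\<lambda>x. f i x - f j x) < e/2"
        using Cauchy[of "e/2"] by auto
      have "nrm (\<lambda>x. f i x - g x) < e" if "i \<ge> M" for i
        using close[of "e/2" M i] M that \<open>e > 0\<close> by auto
      then show "\<exists>no. \<forall>n\<ge>no. norm (nrm (\<lambda>x. f n x - g x) - 0) < e" by auto
    qed
  qed
qed

lemma fcoeff_tendsto:
  assumes "\<And>i. f i \<in> L2" "g \<in> L2" "(\<lambda>i. nrm (\<lambda>x. f i x - g x)) \<longlonglongrightarrow> 0"
  shows "(\<lambda>i. fcoeff (f i) n) \<longlonglongrightarrow> fcoeff g n"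
proof -
  have "(\<lambda>i. fcoeff (f i) n - fcoeff g n) \<longlonglongrightarrow> 0"
  proof (rule Lim_null_comparison[OF _ assms(3)])
    show "\<forall>\<^sub>F i in sequentially. norm (fcoeff (f i) n - fcoeff g n) \<le> nrm (\<lambda>x. f i x - g x)"
      using norm_fcoeff_le[OF L2_diff[OF assms(1,2)]] assms(1,2)
      by (intro always_eventually allI) (simp add: fcoeff_diff L2_integrable)
  qed
  then show ?thesis by (rule LIM_zero_cancel)
qed

text \<open>Restricting the frequencies to \<open>Q\<close> does not increase the distance between
  partial sums, by Bessel. The restricted partial sums are therefore Cauchy, and their limit is the
  wanted function.\<close>

lemma spectral_projection:
  assumes \<psi>: "\<psi> \<in> L2"
  obtains h where "h \<in> L2" "\<And>n. fcoeff h n = (if n \<in> Q then fcoeff \<psi> n else 0)"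
proof -
  have "\<forall>k. \<exists>F. finite F \<and> nrm (\<lambda>x. \<psi> x - tsum F (fcoeff \<psi>) x) < 1 / Suc k"
  proof
    fix k :: nat
    have "1 / real (Suc k) > 0" by simp
    then show "\<exists>F. finite F \<and> nrm (\<lambda>x. \<psi> x - tsum F (fcoeff \<psi>) x) < 1 / Suc k"
      by (rule Fourier_approx[OF \<psi>]) blast
  qed
  then obtain F where F: "\<And>k. finite (F k)"
      "\<And>k. nrm (\<lambda>x. \<psi> x - tsum (F k) (fcoeff \<psi>) x) < 1 / Suc k"
    by metis
  define S where "S k = tsum (F k) (fcoeff \<psi>)" for k
  define p where "p k = tsum (F k \<inter> Q) (fcoeff \<psi>)" for k
  have S2: "S k \<in> L2" and p2: "p k \<in> L2" for k by (simp_all add: S_def p_def)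
  have S: "nrm (\<lambda>x. \<psi> x - S k x) < 1 / Suc k" for k using F(2) by (simp add: S_def)
  have pS: "nrm (\<lambda>x. p k x - p l x) \<le> nrm (\<lambda>x. S k x - S l x)" for k l
  proof -
    define G where "G = (F k \<union> F l) \<inter> Q"
    have G: "finite G" using F(1) by (auto simp: G_def)
    let ?D = "\<lambda>x. S k x - S l x"
    have D: "fcoeff ?D n = (if n \<in> F k then fcoeff \<psi> n else 0) - (if n \<in> F l then fcoeff \<psi> n else 0)" for n
      by (simp add: fcoeff_diff L2_integrable S2) (simp add: S_def fcoeff_tsum F(1))
    have *: "tsum (F i \<inter> Q) (fcoeff \<psi>) x = (\<Sum>n\<in>G. (if n \<in> F i then fcoeff \<psi> n else 0) * expo n x)"
      if "F i \<inter> Q \<subseteq> G" for i x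
      unfolding tsum_def by (rule sum.mono_neutral_cong_left) (use G that in \<open>auto simp: G_def\<close>)
    have "(\<lambda>x. p k x - p l x) = tsum G (fcoeff ?D)"
      unfolding p_def by (subst (1 2) *) (auto simp: G_def tsum_def D fun_eq_iff left_diff_distrib sum_subtractf)
    then have "(nrm (\<lambda>x. p k x - p l x))\<^sup>2 = (\<Sum>n\<in>G. (norm (fcoeff ?D n))\<^sup>2)"
      by (simp add: nrm_tsum G)
    also have "\<dots> \<le> (nrm ?D)\<^sup>2" by (intro Bessel G L2_diff S2)
    finally show ?thesis by (rule power2_le_imp_le) simp
  qed
  have Cauchy: "\<exists>N. \<forall>i\<ge>N. \<forall>j\<ge>N. nrm (\<lambda>x. p i x - p j x) < e" if "e > 0" for e
  proof -
    obtain N :: nat where N: "1 / real (Suc N) < e / 2"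
      by (rule nat_approx_posE[OF half_gt_zero[OF \<open>e > 0\<close>]])
    have "nrm (\<lambda>x. p i x - p j x) < e" if "i \<ge> N" "j \<ge> N" for i j
    proof -
      have i: "1 / real (Suc i) \<le> 1 / real (Suc N)" and j: "1 / real (Suc j) \<le> 1 / real (Suc N)"
        using that by (auto intro!: divide_left_mono)
      have "nrm (\<lambda>x. (S i x - \<psi> x) + (\<psi> x - S j x)) \<le> nrm (\<lambda>x. S i x - \<psi> x) + nrm (\<lambda>x. \<psi> x - S j x)"
        by (intro nrm_triangle L2_diff S2 \<psi>)
      then have "nrm (\<lambda>x. S i x - S j x) < e"
        using S[of i] S[of j] N i j by (simp add: nrm_minus_commute[of "S i"])
      with pS[of i j] show ?thesis by simp
    qed
    then show ?thesis by blast
  qed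
  obtain h r where h: "h \<in> L2" "(\<lambda>i. nrm (\<lambda>x. p i x - h x)) \<longlonglongrightarrow> 0"
    by (rule L2_complete[of p, OF p2 Cauchy])
  have Slim: "(\<lambda>i. nrm (\<lambda>x. S i x - \<psi> x)) \<longlonglongrightarrow> 0"
  proof (rule Lim_null_comparison)
    show "\<forall>\<^sub>F i in sequentially. norm (nrm (\<lambda>x. S i x - \<psi> x)) \<le> 1 / real (Suc i)"
      using S by (auto simp: nrm_minus_commute[of _ \<psi>] less_imp_le)
    show "(\<lambda>i. 1 / real (Suc i)) \<longlonglongrightarrow> 0" by (rule LIMSEQ_Suc[OF lim_1_over_n])
  qed
  have "fcoeff h n = (if n \<in> Q then fcoeff \<psi> n else 0)" for n
  proof -
    have l: "(\<lambda>i. fcoeff (p i) n) \<longlonglongrightarrow> fcoeff h n" by (rule fcoeff_tendsto[OF p2 h])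
    have "(\<lambda>i. if n \<in> Q then fcoeff (S i) n else 0) \<longlonglongrightarrow> (if n \<in> Q then fcoeff \<psi> n else 0)"
      using fcoeff_tendsto[OF S2 \<psi> Slim, of n] by simp
    moreover have "fcoeff (p i) n = (if n \<in> Q then fcoeff (S i) n else 0)" for i
      by (simp add: p_def S_def fcoeff_tsum F(1))
    ultimately have "(\<lambda>i. fcoeff (p i) n) \<longlonglongrightarrow> (if n \<in> Q then fcoeff \<psi> n else 0)"
      by (simp only:)
    with l show ?thesis by (rule LIMSEQ_unique)
  qed
  with h(1) show thesis by (rule that)
qed

subsection \<open>Bounding the Hankel norm\<close>

lemma esqrt_mono: "x \<le> y \<Longrightarrow> esqrt x \<le> esqrt y"
  by (auto simp: esqrt_def top.extremum_unique less_top intro!: ennreal_leI enn2real_mono)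

lemma Linf_AE_bound:
  assumes "Linfnorm f \<le> ennreal C" "0 \<le> C"
  shows "AE x in torusd. norm (f x) \<le> C"
proof -
  have "AE x in torusd. ennreal (norm (f x)) \<le> Linfnorm f"
    unfolding Linfnorm_def by (rule esssup_AE)
  then show ?thesis by eventually_elim (use assms in \<open>auto dest: order_trans\<close>)
qed

lemma hankel_norm_le:
  fixes \<psi> :: "('d::finite \<Rightarrow> real) \<Rightarrow> complex"
  assumes \<psi>: "\<psi> \<in> L2" and h: "h \<in> H2" and adm: "bmo_admissible (\<lambda>x. \<psi> x - h x) \<phi>0 \<Phi>"
  shows "hankel_norm \<psi> \<le> ennreal (sqrt (real CARD('d))) * Max (range (\<lambda>j. Linfnorm (\<Phi> j)))"
proof -
  let ?M = "Max (range (\<lambda>j. Linfnorm (\<Phi> j)))"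
  have "?M \<in> range (\<lambda>j. Linfnorm (\<Phi> j))" by (rule Max_in) auto
  then have "?M < \<infinity>" using adm by (auto simp: bmo_admissible_def Linf_def)
  then obtain C where C: "0 \<le> C" "?M = ennreal C"
    by (cases ?M) auto
  have AE: "AE x in torusd. norm (\<Phi> j x) \<le> C" for j
    by (rule Linf_AE_bound[OF _ C(1)]) (auto simp: C(2)[symmetric])
  have meas: "\<Phi> j \<in> borel_measurable torusd" for j using adm by (auto simp: bmo_admissible_def Linf_def)
  have \<Phi>2: "\<Phi> j \<in> L2" for j by (rule L2_bounded_AE[OF meas AE])
  have h2: "h \<in> L2" using h by (simp add: H2_def)
  have bound: "antiproj_norm (\<lambda>x. \<psi> x * f x) \<le> ennreal (sqrt (real CARD('d)) * C)"
    if f: "f \<in> H2" "L2norm f \<le> 1" for f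
  proof -
    have f2: "f \<in> L2" using f by (simp add: H2_def)
    have f1: "nrm f \<le> 1" using f(2) by (simp add: L2norm_eq[OF f2])
    have \<Phi>f: "(\<lambda>x. \<Phi> j x * f x) \<in> L2" for j by (rule L2_bounded_mult[OF meas AE f2])
    have nrm\<Phi>f: "(nrm (\<lambda>x. \<Phi> j x * f x))\<^sup>2 \<le> C\<^sup>2" for j
    proof -
      have "nrm (\<lambda>x. \<Phi> j x * f x) \<le> C * nrm f" by (rule nrm_bounded_mult[OF meas AE C(1) f2])
      also have "\<dots> \<le> C" using f1 C(1) by (simp add: mult_left_le)
      finally show ?thesis by (intro power_mono) auto
    qed
    have coeff: "fcoeff (\<lambda>x. \<psi> x * f x) n = fcoeff (\<lambda>x. \<Phi> j x * f x) n" if nj: "n j < 0" for n j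
    proof -
      have fH: "fcoeff f m = 0" if "m j < 0" for m using f(1) that by (auto simp: H2_def)
      have hH: "fcoeff h m = 0" if "m j < 0" for m using h that by (auto simp: H2_def)
      \<comment> \<open>Here \<psi> is split as \<open>?E + h + \<Phi> j\<close>. None of
        \<open>?E\<close>, \<open>h\<close>, \<open>f\<close> has frequencies negative in j, so the
        products \<open>?E * f\<close> and \<open>h * f\<close> contribute nothing at
        \<open>n\<close>.\<close>
      let ?E = "\<lambda>x. \<psi> x - \<Phi> j x - h x"
      have E2: "?E \<in> L2" by (intro L2_diff \<psi> \<Phi>2 h2)
      have Ez: "fcoeff ?E m = 0" if "m j < 0" for m
      proof -
        have "fcoeff (\<lambda>x. \<psi> x - h x) m = fcoeff (\<Phi> j) m"
          using adm that by (auto simp: bmo_admissible_def)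
        moreover have "fcoeff (\<lambda>x. \<psi> x - h x) m = fcoeff \<psi> m - fcoeff h m"
          and "fcoeff ?E m = fcoeff \<psi> m - fcoeff (\<Phi> j) m - fcoeff h m"
          by (simp_all add: fcoeff_diff L2_integrable L2_diff \<psi> \<Phi>2 h2)
        ultimately show ?thesis by (simp add: algebra_simps)
      qed
      have "fcoeff (\<lambda>x. ?E x * f x) n = 0"
      proof (rule fcoeff_mult_eq_0[OF E2 f2])
        fix m assume "fcoeff ?E m \<noteq> 0"
        then have "m j \<ge> 0" using Ez by force
        then show "fcoeff f (n - m) = 0" using nj by (intro fH) simp
      qed
      moreover have "fcoeff (\<lambda>x. h x * f x) n = 0"
      proof (rule fcoeff_mult_eq_0[OF h2 f2])
        fix m assume "fcoeff h m \<noteq> 0"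
        then have "m j \<ge> 0" using hH by force
        then show "fcoeff f (n - m) = 0" using nj by (intro fH) simp
      qed
      moreover have "(\<lambda>x. \<psi> x * f x) = (\<lambda>x. (?E x * f x + h x * f x) + \<Phi> j x * f x)"
        by (simp add: algebra_simps)
      moreover have "fcoeff (\<lambda>x. (?E x * f x + h x * f x) + \<Phi> j x * f x) n
          = (fcoeff (\<lambda>x. ?E x * f x) n + fcoeff (\<lambda>x. h x * f x) n) + fcoeff (\<lambda>x. \<Phi> j x * f x) n"
        by (subst fcoeff_add fcoeff_add | intro Bochner_Integration.integrable_add L2_mult_integrable E2 f2 h2 \<Phi>2)+ simp
      ultimately show ?thesis by simp
    qed
    have "(\<integral>\<^sup>+ n. ennreal ((norm (fcoeff (\<lambda>x. \<psi> x * f x) n))\<^sup>2) \<partial>count_space {n. \<exists>k. n k < 0})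
        \<le> ennreal (real CARD('d) * C\<^sup>2)"
    proof (rule nn_integral_count_space_le)
      fix F :: "('d \<Rightarrow> int) set" assume F: "finite F" "F \<subseteq> {n. \<exists>k. n k < 0}"
      let ?c = "\<lambda>n. (norm (fcoeff (\<lambda>x. \<psi> x * f x) n))\<^sup>2"
      \<comment> \<open>An index with several negative entries is counted once for each of them.
        This overcount, by at most d, is where the factor sqrt d arises.\<close>
      have "sum ?c F \<le> (\<Sum>n\<in>F. \<Sum>j\<in>UNIV. if n j < 0 then ?c n else 0)"
      proof (rule sum_mono)
        fix n assume "n \<in> F"
        then obtain k where "n k < 0" using F by auto
        then have "?c n = (if n k < 0 then ?c n else 0)" by simp
        also have "\<dots> \<le> (\<Sum>j\<in>UNIV. if n j < 0 then ?c n else 0)"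
          by (rule member_le_sum) auto
        finally show "?c n \<le> (\<Sum>j\<in>UNIV. if n j < 0 then ?c n else 0)" .
      qed
      also have "\<dots> = (\<Sum>j\<in>UNIV. \<Sum>n\<in>F. if n j < 0 then ?c n else 0)" by (rule sum.swap)
      also have "\<dots> \<le> (\<Sum>j\<in>(UNIV::'d set). C\<^sup>2)"
      proof (rule sum_mono)
        fix j :: 'd
        have "(\<Sum>n\<in>F. if n j < 0 then ?c n else 0) \<le> (\<Sum>n\<in>F. (norm (fcoeff (\<lambda>x. \<Phi> j x * f x) n))\<^sup>2)"
          by (intro sum_mono) (auto simp: coeff)
        also have "\<dots> \<le> (nrm (\<lambda>x. \<Phi> j x * f x))\<^sup>2" by (rule Bessel[OF \<Phi>f F(1)])
        also have "\<dots> \<le> C\<^sup>2" by (rule nrm\<Phi>f)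
        finally show "(\<Sum>n\<in>F. if n j < 0 then ?c n else 0) \<le> C\<^sup>2" .
      qed
      finally show "(\<Sum>n\<in>F. ennreal (?c n)) \<le> ennreal (real CARD('d) * C\<^sup>2)"
        by (subst sum_ennreal) (auto intro: ennreal_leI)
    qed
    from esqrt_mono[OF this] show ?thesis
      using C(1) unfolding antiproj_norm_def by (simp add: esqrt_ennreal real_sqrt_mult)
  qed
  have "hankel_norm \<psi> \<le> ennreal (sqrt (real CARD('d)) * C)"
    unfolding hankel_norm_def by (rule SUP_least) (use bound in auto)
  then show ?thesis using C by (simp add: ennreal_mult)
qed

subsection \<open>Multiplication by Blaschke products\<close>

lemma Linf_iff: "f \<in> Linf \<longleftrightarrow> f \<in> borel_measurable torusd \<and> (\<exists>C. AE x in torusd. norm (f x) \<le> C)"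
proof (intro iffI conjI)
  assume f: "f \<in> Linf"
  then show "f \<in> borel_measurable torusd" by (simp add: Linf_def)
  obtain C where "0 \<le> C" "Linfnorm f = ennreal C" using f by (cases "Linfnorm f") (auto simp: Linf_def)
  then show "\<exists>C. AE x in torusd. norm (f x) \<le> C" using Linf_AE_bound[of f C] by auto
next
  assume "f \<in> borel_measurable torusd \<and> (\<exists>C. AE x in torusd. norm (f x) \<le> C)"
  then obtain C where f: "f \<in> borel_measurable torusd" and C: "AE x in torusd. norm (f x) \<le> C" by auto
  have "Linfnorm f \<le> ennreal C"
    unfolding Linfnorm_def
    by (rule esssup_I) (use f C in \<open>auto elim!: eventually_mono intro: ennreal_leI\<close>)
  also have "\<dots> < \<infinity>" by simp
  finally show "f \<in> Linf" using f by (simp add: Linf_def)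
qed

lemma Linf_L2: "f \<in> Linf \<Longrightarrow> f \<in> L2"
  unfolding Linf_iff by (auto intro: L2_bounded_AE)

lemma LinfI: "f \<in> borel_measurable torusd \<Longrightarrow> (\<And>x. norm (f x) \<le> C) \<Longrightarrow> f \<in> Linf"
  unfolding Linf_iff by auto

text \<open>Averages along coordinate lines are taken below, and a line is a null set when there are
  further variables. Truncation provides a bound at every point, hence on every line, without
  changing any Fourier coefficient.\<close>

lemma Linf_bounded_version:
  assumes "f \<in> Linf"
  obtains g C where "g \<in> borel_measurable torusd" "\<And>x. norm (g x) \<le> C" "\<And>n. fcoeff g n = fcoeff f n"
proof -
  obtain C where [measurable]: "f \<in> borel_measurable torusd" and C: "AE x in torusd. norm (f x) \<le> C"
    using assms by (auto simp: Linf_iff)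
  let ?g = "\<lambda>x. if norm (f x) \<le> \<bar>C\<bar> then f x else 0"
  show thesis
  proof (rule that[of ?g "\<bar>C\<bar>"])
    show "fcoeff ?g n = fcoeff f n" for n
      unfolding fcoeff_expo
      by (rule integral_cong_AE) (use C in \<open>auto elim!: eventually_mono\<close>)
  qed auto
qed

definition bfactor :: "complex \<Rightarrow> 'd \<Rightarrow> ('d::finite \<Rightarrow> real) \<Rightarrow> complex" where
  "bfactor a k x = (cis (x k) - a) / (1 - cnj a * cis (x k))"

lemma bfactor_denom:
  assumes "norm a < 1" shows "1 - norm a \<le> norm (1 - cnj a * cis t)" "1 - cnj a * cis t \<noteq> 0"
proof -
  show "1 - norm a \<le> norm (1 - cnj a * cis t)"
    using norm_triangle_ineq2[of 1 "cnj a * cis t"] by (simp add: norm_mult)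
  with assms show "1 - cnj a * cis t \<noteq> 0" by auto
qed

lemma cis_measurable [measurable]: "(\<lambda>x. cis (x k)) \<in> borel_measurable torusd"
  unfolding expo_basis_freq[symmetric] by measurable

lemma bfactor_measurable [measurable]: "bfactor a k \<in> borel_measurable torusd"
  unfolding bfactor_def[abs_def] by measurable

lemma norm_bfactor: "norm a < 1 \<Longrightarrow> norm (bfactor a k x) = 1"
proof -
  assume a: "norm a < 1"
  have "norm (cis (x k) - a) = norm (cnj (cis (x k) - a))" by (simp only: complex_mod_cnj)
  also have "\<dots> = norm (cis (x k) * cnj (cis (x k) - a))" by (simp add: norm_mult)
  also have "cis (x k) * cnj (cis (x k) - a) = 1 - cnj a * cis (x k)"
    by (simp add: algebra_simps cis_cnj cis_mult)
  finally show ?thesis using bfactor_denom(2)[OF a] by (simp add: bfactor_def norm_divide)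
qed

lemma bfactor_mult_L2: "norm a < 1 \<Longrightarrow> f \<in> L2 \<Longrightarrow> (\<lambda>x. bfactor a k x * f x) \<in> L2"
  by (rule L2_bounded_mult[of _ 1]) (auto simp: norm_bfactor)

text \<open>The identity (1 - cnj a z) b f = (z - a) f with z = \<open>cis (x k)\<close>, read
  coefficientwise. It replaces the power series expansion of the Blaschke factor
  \<open>b\<close>.\<close>

lemma fcoeff_bfactor_rec:
  assumes a: "norm a < 1" and f: "f \<in> L2"
  shows "fcoeff (\<lambda>x. bfactor a k x * f x) n
    = cnj a * fcoeff (\<lambda>x. bfactor a k x * f x) (n - basis_freq k) + fcoeff f (n - basis_freq k) - a * fcoeff f n"
proof -
  let ?G = "\<lambda>x. bfactor a k x * f x"
  have G: "?G \<in> L2" by (rule bfactor_mult_L2[OF a f])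
  have e: "(\<lambda>x. expo (basis_freq k) x * g x) \<in> L2" if "g \<in> L2" for g
    by (rule L2_bounded_mult[of _ 1]) (auto simp: that)
  have "?G = (\<lambda>x. (cnj a * (expo (basis_freq k) x * ?G x) + expo (basis_freq k) x * f x) - a * f x)"
  proof
    fix x
    show "?G x = (cnj a * (expo (basis_freq k) x * ?G x) + expo (basis_freq k) x * f x) - a * f x"
      using bfactor_denom(2)[OF a, of "x k"]
      by (simp add: bfactor_def expo_basis_freq divide_simps) (simp add: algebra_simps)
  qed
  then have "fcoeff ?G n = fcoeff (\<lambda>x. (cnj a * (expo (basis_freq k) x * ?G x) + expo (basis_freq k) x * f x) - a * f x) n"
    by (rule arg_cong)
  also have "\<dots> = cnj a * fcoeff ?G (n - basis_freq k) + fcoeff f (n - basis_freq k) - a * fcoeff f n"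
    by (simp add: fcoeff_diff fcoeff_add L2_integrable L2_add L2_cmult e G f fcoeff_cmult fcoeff_expo_mult)
  finally show ?thesis .
qed

text \<open>Each step of the recursion gains a factor |a| < 1 while the coefficients of an L2
  function stay bounded, so following the recursion indefinitely forces the coefficient to be
  0.\<close>

lemma fcoeff_decay:
  assumes a: "norm a < 1" and G: "G \<in> L2"
    and step: "\<And>n. P n \<Longrightarrow> fcoeff G n = cnj a * fcoeff G (n - e)" "\<And>n. P n \<Longrightarrow> P (n - e)"
    and n: "P n"
  shows "fcoeff G n = 0"
proof -
  have bound: "norm (fcoeff G n) \<le> norm a ^ m * nrm G" if "P n" for m n
    using that
  proof (induction m arbitrary: n)
    case 0 then show ?case using norm_fcoeff_le[OF G] by simp
  next
    case (Suc m)
    have "norm (fcoeff G n) = norm a * norm (fcoeff G (n - e))"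
      by (subst step(1)[OF Suc.prems]) (simp add: norm_mult)
    also have "\<dots> \<le> norm a * (norm a ^ m * nrm G)"
      by (intro mult_left_mono Suc.IH step(2) Suc.prems) auto
    finally show ?case by (simp add: mult.assoc)
  qed
  have "(\<lambda>m. norm a ^ m * nrm G) \<longlonglongrightarrow> 0 * nrm G"
    by (intro tendsto_intros LIMSEQ_power_zero) (simp add: a)
  then have "norm (fcoeff G n) \<le> 0 * nrm G"
    by (rule LIMSEQ_le_const) (use bound[OF n] in auto)
  then show ?thesis by simp
qed

lemma basis_freq_nonneg [simp]: "0 \<le> basis_freq k j"
  by (simp add: basis_freq_def)

lemma basis_freq_self [simp]: "basis_freq k k = 1"
  by (simp add: basis_freq_def)

lemma basis_freq_other: "j \<noteq> k \<Longrightarrow> basis_freq k j = 0"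
  by (simp add: basis_freq_def)

text \<open>A Blaschke factor is analytic, hence creates no negative frequencies. Neither
  \<open>j = k\<close> nor \<open>j \<noteq> k\<close> is special: subtracting
  \<open>basis_freq k\<close> never leaves the half space n_j < 0, where the recursion becomes
  homogeneous.\<close>

lemma fcoeff_bfactor_eq_0:
  assumes a: "norm a < 1" and f: "f \<in> L2" and z: "\<And>m. m j < 0 \<Longrightarrow> fcoeff f m = 0" and n: "n j < 0"
  shows "fcoeff (\<lambda>x. bfactor a k x * f x) n = 0"
proof (rule fcoeff_decay[OF a bfactor_mult_L2[OF a f], where P = "\<lambda>n. n j < 0" and e = "basis_freq k"])
  have s: "(m - basis_freq k) j < 0" if "m j < 0" for m
    using less_le_trans[OF that basis_freq_nonneg[of k j]] by simp
  show "(m - basis_freq k) j < 0" if "m j < 0" for m by (rule s[of m, OF that])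
  show "fcoeff (\<lambda>x. bfactor a k x * f x) m = cnj a * fcoeff (\<lambda>x. bfactor a k x * f x) (m - basis_freq k)" if "m j < 0" for m
    by (subst fcoeff_bfactor_rec[OF a f]) (simp add: z[of m, OF that] z[of "m - basis_freq k", OF s[of m, OF that]])
qed (rule n)

section \<open>Averaging over one variable\<close>

text \<open>The projection onto the frequencies with n_k = 0. Unlike the projections onto half
  spaces it is an average, so it preserves sup bounds.\<close>

definition avg :: "'d \<Rightarrow> (('d::finite \<Rightarrow> real) \<Rightarrow> complex) \<Rightarrow> ('d \<Rightarrow> real) \<Rightarrow> complex" where
  "avg k W x = (LINT t|torus. W (x(k := t)))"

lemma fun_upd_measurable:
  "(\<lambda>(x, t). x(k := t)) \<in> measurable (torusd \<Otimes>\<^sub>M torus) (torusd :: ('d::finite \<Rightarrow> real) measure)"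
proof -
  have "(\<lambda>p. (fst p)(k := snd p)) \<in> measurable (torusd \<Otimes>\<^sub>M torus) (PiM UNIV (\<lambda>_::'d. torus))"
    by (rule measurable_fun_upd[where J=UNIV]) (auto simp: torusd_def)
  then show ?thesis by (simp add: torusd_def case_prod_beta')
qed

lemma avg_measurable:
  assumes [measurable]: "W \<in> borel_measurable torusd"
  shows "avg k W \<in> borel_measurable torusd"
proof -
  have "(\<lambda>(x, t). W (x(k := t))) \<in> borel_measurable (torusd \<Otimes>\<^sub>M torus)"
    using measurable_compose[OF fun_upd_measurable[of k] assms] by (simp add: case_prod_beta')
  then show ?thesis
    unfolding avg_def[abs_def] by (rule torus.borel_measurable_lebesgue_integral)
qed

lemma norm_avg_le:
  assumes "\<And>x. norm (W x) \<le> B" "0 \<le> B"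
  shows "norm (avg k W x) \<le> B"
\<comment> \<open>A slice that fails to be integrable has integral 0 by default, so the bound needs
  no measurability assumption.\<close>
proof (cases "integrable torus (\<lambda>t. W (x(k := t)))")
  case True
  have "norm (avg k W x) \<le> (LINT t|torus. norm (W (x(k := t))))"
    unfolding avg_def by (rule integral_norm_bound)
  also have "\<dots> \<le> (LINT t|torus. B)" by (intro integral_mono integrable_norm True) (auto intro: assms)
  finally show ?thesis using torus.prob_space by simp
qed (simp add: avg_def not_integrable_integral_eq assms)

lemma expo_fun_upd: "expo n (x(k := t)) = cis (of_int (n k) * t) * expo n (x(k := 0))"
proof -
  have "expo n (x(k := s)) = cis (of_int (n k) * s) * (\<Prod>i\<in>UNIV - {k}. cis (of_int (n i) * x i))" for s
    unfolding expo_prod by (subst prod.remove[of UNIV k]) (auto intro!: prod.cong)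
  from this[of t] this[of 0] show ?thesis by simp
qed

lemma integral_torusd_fun_upd:
  fixes f :: "('d::finite \<Rightarrow> real) \<Rightarrow> complex"
  assumes "integrable torusd f"
  shows "(LINT x|torusd. f x) = (LINT x|PiM (UNIV - {k}) (\<lambda>_. torus). LINT t|torus. f (x(k := t)))"
proof -
  have "insert k (UNIV - {k}) = UNIV" by auto
  then show ?thesis
    using torus_prod.product_integral_insert[of "UNIV - {k}" k f] assms by (simp add: torusd_def)
qed

text \<open>By Fubini the variable k is integrated innermost. The average does not depend on it, so
  that integral is the one of \<open>cis\<close> alone and detects n_k = 0.\<close>

lemma fcoeff_avg:
  assumes W: "W \<in> borel_measurable torusd" "\<And>x. norm (W x) \<le> B"
  shows "fcoeff (avg k W) n = (if n k = 0 then fcoeff W n else 0)"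
proof -
  have B: "0 \<le> B" using W(2)[of undefined] norm_ge_zero order_trans by blast
  have a2: "avg k W \<in> L2" by (rule L2_bounded[OF avg_measurable[OF W(1)] norm_avg_le[OF W(2) B]])
  have w2: "W \<in> L2" by (rule L2_bounded[OF W])
  let ?e = "\<lambda>x. expo (- n) (x(k := 0))"
  have "fcoeff (avg k W) n = (LINT x|PiM (UNIV - {k}) (\<lambda>_. torus). LINT t|torus. (avg k W x * ?e x) * cis (of_int (- n k) * t))"
    unfolding fcoeff_expo
    by (subst integral_torusd_fun_upd[where k=k], intro L2_mult_integrable a2 expo_L2)
       (subst expo_fun_upd, simp add: avg_def mult_ac)
  also have "\<dots> = (LINT x|PiM (UNIV - {k}) (\<lambda>_. torus). avg k W x * ?e x * of_bool (n k = 0))"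
    by (simp only: integral_mult_right_zero integral_cis) simp
  also have "\<dots> = (if n k = 0 then fcoeff W n else 0)"
  proof (cases "n k = 0")
    case True
    have "fcoeff W n = (LINT x|PiM (UNIV - {k}) (\<lambda>_. torus). LINT t|torus. W (x(k := t)) * ?e x)"
      unfolding fcoeff_expo
      by (subst integral_torusd_fun_upd[where k=k], intro L2_mult_integrable w2 expo_L2)
         (subst expo_fun_upd, simp add: True)
    also have "\<dots> = (LINT x|PiM (UNIV - {k}) (\<lambda>_. torus). avg k W x * ?e x)"
      by (simp add: avg_def)
    finally show ?thesis using True by simp
  qed simp
  finally show ?thesis .
qed

text \<open>Multiplying by a Blaschke factor in the variable k keeps the symbols for the negative
  frequencies. For the nonnegative ones the part of the symbol of negative frequency in the variable k
  leaks in; the leak is geometric in that frequency, so it is the projection of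
  an average over the variable k divided by the denominator of the factor.\<close>

lemma BMOr_bfactor:
  fixes \<phi> :: "('d::finite \<Rightarrow> real) \<Rightarrow> complex"
  assumes \<phi>: "\<phi> \<in> BMOr" and a: "norm a < 1"
  shows "(\<lambda>x. bfactor a k x * \<phi> x) \<in> BMOr"
proof -
  let ?b = "bfactor a k"
  obtain \<phi>0' \<Phi>' where adm: "bmo_admissible \<phi> \<phi>0' \<Phi>'" and \<phi>2: "\<phi> \<in> L2"
    using \<phi> by (auto simp: BMOr_def)
  obtain \<phi>0 C0 where \<phi>0 [measurable]: "\<phi>0 \<in> borel_measurable torusd" and C0: "\<And>x. norm (\<phi>0 x) \<le> C0"
    and c0: "\<And>n. fcoeff \<phi>0 n = fcoeff \<phi>0' n"
    using Linf_bounded_version[of \<phi>0'] adm by (auto simp: bmo_admissible_def)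
  have \<Phi>2: "\<Phi>' j \<in> L2" for j using adm by (auto simp: bmo_admissible_def intro: Linf_L2)
  obtain \<Psi> C1 where \<Psi> [measurable]: "\<Psi> \<in> borel_measurable torusd" and C1: "\<And>x. norm (\<Psi> x) \<le> C1"
    and c1: "\<And>n. fcoeff \<Psi> n = fcoeff (\<Phi>' k) n"
    using Linf_bounded_version[of "\<Phi>' k"] adm by (auto simp: bmo_admissible_def)
  have \<phi>02: "\<phi>0 \<in> L2" and \<Psi>2: "\<Psi> \<in> L2" by (rule L2_bounded[OF \<phi>0 C0], rule L2_bounded[OF \<Psi> C1])
  have pos: "fcoeff \<phi> n = fcoeff \<phi>0 n" if "\<And>j. n j \<ge> 0" for n
    using adm that by (auto simp: bmo_admissible_def c0)
  have neg: "fcoeff \<phi> n = fcoeff (\<Phi>' j) n" if "n j < 0" for n j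
    using adm that by (auto simp: bmo_admissible_def)
  have negk: "fcoeff \<phi> n = fcoeff \<Psi> n" if "n k < 0" for n
    using neg[of n k, OF that] by (simp add: c1)
  \<comment> \<open>W carries the coefficients of b (\<phi> - \<phi>0) at nonnegative frequencies
    with n_k = 0, as \<open>G0\<close> confirms. Write this function as b (\<phi> - \<Psi>) + b
    \<Psi> - b \<phi>0. The first summand has the coefficient -a times that of \<phi> - \<Psi>,
    because \<phi> - \<Psi> has no frequencies negative in k, and on the cone \<phi> may be replaced
    by \<phi>0.\<close>
  define W where "W x = (?b x * \<Psi> x - a * \<phi>0 x) + (a * \<Psi> x - ?b x * \<phi>0 x)" for x
  have Wm: "W \<in> borel_measurable torusd" unfolding W_def[abs_def] by measurable
  define B where "B = (C1 + norm a * C0) + (norm a * C1 + C0)"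
  have Wb: "norm (W x) \<le> B" for x
  proof -
    have "norm (W x) \<le> (norm (?b x * \<Psi> x) + norm (a * \<phi>0 x)) + (norm (a * \<Psi> x) + norm (?b x * \<phi>0 x))"
      unfolding W_def by (intro norm_triangle_mono norm_triangle_ineq4)
    also have "\<dots> \<le> B"
      unfolding B_def norm_mult norm_bfactor[OF a] mult_1
      by (intro add_mono mult_left_mono C0 C1) auto
    finally show ?thesis .
  qed
  have W2: "W \<in> L2" by (rule L2_bounded[OF Wm Wb])
  have B0: "0 \<le> B" using Wb[of undefined] norm_ge_zero order_trans by blast
  let ?A = "avg k W"
  have A: "?A \<in> borel_measurable torusd" "\<And>x. norm (?A x) \<le> B"
    by (rule avg_measurable[OF Wm], rule norm_avg_le[OF Wb B0])
  have A2: "?A \<in> L2" by (rule L2_bounded[OF A])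
  \<comment> \<open>The solution of (1 - cnj a z) u = \<open>?A\<close> with z =
    \<open>cis (x k)\<close>. Its coefficients vanish for n_k < 0, start from those of
    \<open>W\<close> at n_k = 0 and acquire a factor cnj a with each further step in the direction
    k.\<close>
  define u where "u x = ?A x / (1 - cnj a * cis (x k))" for x
  have um [measurable]: "u \<in> borel_measurable torusd" unfolding u_def[abs_def] using A(1) by measurable
  have ub: "norm (u x) \<le> B / (1 - norm a)" for x
    unfolding u_def norm_divide using a B0 bfactor_denom(1)[OF a, of "x k"] A(2)[of x]
    by (intro frac_le) auto
  have u2: "u \<in> L2" by (rule L2_bounded[OF um ub])
  have e2: "(\<lambda>x. expo (basis_freq k) x * g x) \<in> L2" if "g \<in> L2" for g
    by (rule L2_bounded_mult[of _ 1]) (auto simp: that)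
  have urec: "fcoeff u n = cnj a * fcoeff u (n - basis_freq k) + (if n k = 0 then fcoeff W n else 0)" for n
  proof -
    have "u = (\<lambda>x. cnj a * (expo (basis_freq k) x * u x) + ?A x)"
    proof
      fix x
      show "u x = cnj a * (expo (basis_freq k) x * u x) + ?A x"
        using bfactor_denom(2)[OF a, of "x k"]
        by (simp add: u_def expo_basis_freq divide_simps) (simp add: algebra_simps)
    qed
    then have "fcoeff u n = fcoeff (\<lambda>x. cnj a * (expo (basis_freq k) x * u x) + ?A x) n" by (rule arg_cong)
    also have "\<dots> = cnj a * fcoeff u (n - basis_freq k) + fcoeff ?A n"
      by (simp add: fcoeff_add L2_integrable L2_cmult e2 u2 A2 fcoeff_cmult fcoeff_expo_mult)
    finally show ?thesis by (simp only: fcoeff_avg[OF Wm Wb])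
  qed
  have uneg: "fcoeff u n = 0" if "n k < 0" for n
  proof (rule fcoeff_decay[OF a u2, where P = "\<lambda>n. n k < 0" and e = "basis_freq k"])
    show "fcoeff u m = cnj a * fcoeff u (m - basis_freq k)" if "m k < 0" for m
      by (subst urec) (use that in simp)
  qed (use that in simp_all)
  have b2: "(\<lambda>x. ?b x * f x) \<in> L2" if "f \<in> L2" for f by (rule bfactor_mult_L2[OF a that])
  let ?D = "\<lambda>x. \<phi> x - \<phi>0 x"
  have D2: "?D \<in> L2" by (intro L2_diff \<phi>2 \<phi>02)
  have Dz: "fcoeff ?D n = 0" if "\<And>j. n j \<ge> 0" for n
    using pos[OF that] by (simp add: fcoeff_diff L2_integrable \<phi>2 \<phi>02)
  let ?G = "\<lambda>x. ?b x * ?D x"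
  have Grec: "fcoeff ?G n = cnj a * fcoeff ?G (n - basis_freq k) + fcoeff ?D (n - basis_freq k) - a * fcoeff ?D n" for n
    by (rule fcoeff_bfactor_rec[OF a D2])
  have G0: "fcoeff ?G n = fcoeff W n" if n: "\<And>j. n j \<ge> 0" "n k = 0" for n
  proof -
    let ?E = "\<lambda>x. \<phi> x - \<Psi> x"
    have E2: "?E \<in> L2" by (intro L2_diff \<phi>2 \<Psi>2)
    have Ez: "fcoeff ?E m = 0" if "m k < 0" for m
      using negk[of m, OF that] by (simp add: fcoeff_diff L2_integrable \<phi>2 \<Psi>2)
    have m: "(n - basis_freq k) k < 0" using n(2) by simp
    have bE: "fcoeff (\<lambda>x. ?b x * ?E x) (n - basis_freq k) = 0"
      by (rule fcoeff_bfactor_eq_0[where j = k, OF a E2]) (rule Ez, use m in auto)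
    have "fcoeff (\<lambda>x. ?b x * ?E x) n = - (a * fcoeff ?E n)"
      by (subst fcoeff_bfactor_rec[OF a E2])
         (simp add: bE Ez[of "n - basis_freq k", OF m])
    moreover have "fcoeff ?E n = fcoeff \<phi>0 n - fcoeff \<Psi> n"
      using pos[OF n(1)] by (simp add: fcoeff_diff L2_integrable \<phi>2 \<Psi>2)
    moreover have "(\<lambda>x. ?b x * ?E x) = (\<lambda>x. ?b x * \<phi> x - ?b x * \<Psi> x)" "?G = (\<lambda>x. ?b x * \<phi> x - ?b x * \<phi>0 x)"
      by (simp_all add: right_diff_distrib)
    moreover have "fcoeff W n = (fcoeff (\<lambda>x. ?b x * \<Psi> x) n - a * fcoeff \<phi>0 n)
        + (a * fcoeff \<Psi> n - fcoeff (\<lambda>x. ?b x * \<phi>0 x) n)"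
      unfolding W_def[abs_def]
      by (simp add: fcoeff_diff fcoeff_add fcoeff_cmult L2_integrable L2_diff L2_add L2_cmult b2 \<Psi>2 \<phi>02)
    moreover have "fcoeff (\<lambda>x. ?b x * f x - ?b x * g x) n
        = fcoeff (\<lambda>x. ?b x * f x) n - fcoeff (\<lambda>x. ?b x * g x) n" if "f \<in> L2" "g \<in> L2" for f g
      by (simp add: fcoeff_diff L2_integrable b2 that)
    ultimately show ?thesis
      by (simp add: \<phi>2 \<Psi>2 \<phi>02 right_diff_distrib) (simp add: algebra_simps)
  qed
  \<comment> \<open>Induction on n_k. For n_k > 0 both inhomogeneous terms of \<open>Grec\<close>
    sit at nonnegative frequencies, where \<phi> - \<phi>0 has no coefficients, so \<open>u\<close>
    and \<open>?G\<close> obey the same recursion.\<close>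
  have uG: "fcoeff u n = fcoeff ?G n" if n: "\<And>j. n j \<ge> 0" for n
    using n
  proof (induction "nat (n k)" arbitrary: n)
    case 0
    then have nk: "n k = 0" by (metis antisym nat_eq_iff2 nat_0_iff)
    then have "(n - basis_freq k) k < 0" by simp
    then show ?case by (subst urec) (simp add: uneg nk G0[of n, OF 0(2) nk])
  next
    case (Suc m)
    then have nk: "n k > 0" by simp
    have p: "0 \<le> (n - basis_freq k) j" for j
      using Suc.prems[of j] nk by (cases "j = k") (auto simp: basis_freq_other)
    have "fcoeff u (n - basis_freq k) = fcoeff ?G (n - basis_freq k)"
      by (rule Suc.hyps(1)[of "n - basis_freq k", OF _ p]) (use Suc.hyps(2) in simp)
    then show ?case
      by (subst urec, subst Grec) (use nk Dz[of "n - basis_freq k", OF p] Dz[of n, OF Suc.prems] in simp)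
  qed
  \<comment> \<open>Only the symbol for the nonnegative frequencies needs the correction
    \<open>u\<close>; the others are simply multiplied by the factor.\<close>
  have "bmo_admissible (\<lambda>x. ?b x * \<phi> x) (\<lambda>x. ?b x * \<phi>0 x + u x) (\<lambda>j x. ?b x * \<Phi>' j x)"
    unfolding bmo_admissible_def
  proof (intro conjI allI impI)
    have "norm (?b x * \<phi>0 x + u x) \<le> C0 + B / (1 - norm a)" for x
      by (rule norm_triangle_mono) (simp_all add: norm_mult norm_bfactor[OF a] C0 ub)
    then show "(\<lambda>x. ?b x * \<phi>0 x + u x) \<in> Linf" by (intro LinfI) measurable
  next
    fix j
    from adm have "\<Phi>' j \<in> Linf" by (simp add: bmo_admissible_def)
    then show "(\<lambda>x. ?b x * \<Phi>' j x) \<in> Linf" by (auto simp: Linf_iff norm_mult norm_bfactor[OF a])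
  next
    fix j and n :: "'d \<Rightarrow> int" assume n: "n j < 0"
    let ?E = "\<lambda>x. \<phi> x - \<Phi>' j x"
    have E2: "?E \<in> L2" by (intro L2_diff \<phi>2 \<Phi>2)
    have "fcoeff (\<lambda>x. ?b x * ?E x) n = 0"
    proof (rule fcoeff_bfactor_eq_0[where j = j, OF a E2])
      show "fcoeff ?E m = 0" if "m j < 0" for m
        using neg[of m j, OF that] by (simp add: fcoeff_diff L2_integrable \<phi>2 \<Phi>2)
    qed (rule n)
    moreover have "(\<lambda>x. ?b x * ?E x) = (\<lambda>x. ?b x * \<phi> x - ?b x * \<Phi>' j x)"
      by (simp_all add: right_diff_distrib)
    ultimately show "fcoeff (\<lambda>x. ?b x * \<phi> x) n = fcoeff (\<lambda>x. ?b x * \<Phi>' j x) n"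
      by (simp add: fcoeff_diff L2_integrable b2 \<phi>2 \<Phi>2)
  next
    fix n :: "'d \<Rightarrow> int" assume "\<forall>j. n j \<ge> 0"
    then have "fcoeff u n = fcoeff ?G n" by (intro uG) auto
    moreover have "?G = (\<lambda>x. ?b x * \<phi> x - ?b x * \<phi>0 x)" by (simp add: right_diff_distrib)
    ultimately show "fcoeff (\<lambda>x. ?b x * \<phi> x) n = fcoeff (\<lambda>x. ?b x * \<phi>0 x + u x) n"
      by (simp add: fcoeff_diff fcoeff_add L2_integrable b2 \<phi>2 \<phi>02 u2)
  qed
  with b2[OF \<phi>2] show ?thesis by (auto simp: BMOr_def)
qed

lemma BMOr_cmult:
  assumes "\<phi> \<in> BMOr" shows "(\<lambda>x. c * \<phi> x) \<in> BMOr"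
proof -
  obtain \<phi>0 \<Phi> where adm: "bmo_admissible \<phi> \<phi>0 \<Phi>" and \<phi>2: "\<phi> \<in> L2"
    using assms by (auto simp: BMOr_def)
  have "(\<lambda>x. c * f x) \<in> Linf" if "f \<in> Linf" for f
  proof -
    from that obtain C where "AE x in torusd. norm (f x) \<le> C" by (auto simp: Linf_iff)
    then have "AE x in torusd. norm (c * f x) \<le> norm c * C"
      by eventually_elim (simp add: norm_mult mult_left_mono)
    with that show ?thesis by (auto simp: Linf_iff)
  qed
  with adm have "bmo_admissible (\<lambda>x. c * \<phi> x) (\<lambda>x. c * \<phi>0 x) (\<lambda>j x. c * \<Phi> j x)"
    by (auto simp: bmo_admissible_def fcoeff_cmult)
  with \<phi>2 show ?thesis by (auto simp: BMOr_def)
qed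

lemma BMOr_blaschke1:
  assumes "\<phi> \<in> BMOr" "\<forall>a\<in>set as. norm a < 1"
  shows "(\<lambda>x. blaschke1 c as (x k) * \<phi> x) \<in> BMOr"
proof -
  have "(\<lambda>x. (\<Prod>a\<leftarrow>as. (cis (x k) - a) / (1 - cnj a * cis (x k))) * \<phi> x) \<in> BMOr"
    using assms(2)
  proof (induction as)
    case (Cons a as)
    then have "(\<lambda>x. bfactor a k x * ((\<Prod>a\<leftarrow>as. (cis (x k) - a) / (1 - cnj a * cis (x k))) * \<phi> x)) \<in> BMOr"
      by (intro BMOr_bfactor) auto
    then show ?case by (simp add: bfactor_def mult.assoc)
  qed (simp add: assms)
  from BMOr_cmult[OF this, of c] show ?thesis by (simp add: blaschke1_def mult.assoc)
qed

lemma BMOr_Blaschke_set: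
  assumes \<phi>: "\<phi> \<in> BMOr" and b: "b \<in> Blaschke_set N"
  shows "(\<lambda>x. b x * \<phi> x) \<in> BMOr"
proof -
  obtain c as where as: "\<And>k. \<forall>a\<in>set (as k). norm a < 1"
    and b: "b = (\<lambda>x. \<Prod>k\<in>UNIV. blaschke1 (c k) (as k) (x k))"
    using b by (auto simp: Blaschke_set_def)
  have "(\<lambda>x. (\<Prod>k\<in>K. blaschke1 (c k) (as k) (x k)) * \<phi> x) \<in> BMOr" if "finite K" for K
    using that
  proof induction
    case (insert k K)
    from BMOr_blaschke1[OF insert.IH as, of "c k" k k] insert.hyps show ?case
      by (simp add: mult.assoc)
  qed (simp add: \<phi>)
  then show ?thesis by (simp add: b)
qed

subsection \<open>A Nehari theorem in one of the variables\<close>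

text \<open>Allows a function to be normalized by any \<open>r\<close> above its norm, so that a
  vanishing norm requires no case distinction.\<close>

lemma le_mult_of_le_greater:
  fixes A s c :: real
  assumes "\<And>r. c < r \<Longrightarrow> A \<le> s * r" shows "A \<le> s * c"
proof (rule LIMSEQ_le_const)
  have "(\<lambda>i. s * (c + 1 / real (Suc i))) \<longlonglongrightarrow> s * (c + 0)"
    by (intro tendsto_intros LIMSEQ_Suc[OF lim_1_over_n])
  then show "(\<lambda>i. s * (c + 1 / real (Suc i))) \<longlonglongrightarrow> s * c" by simp
  show "\<exists>N. \<forall>n\<ge>N. A \<le> s * (c + 1 / real (Suc n))" using assms by auto
qed

section \<open>From the Hankel norm to bilinear forms\<close>

lemma hankel_norm_coeff_bound:
  assumes s: "0 \<le> s" "hankel_norm \<psi> \<le> ennreal s" and f: "f \<in> H2"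
    and G: "finite G" "\<And>n. n \<in> G \<Longrightarrow> \<exists>k. n k < 0"
  shows "L2_set (\<lambda>n. norm (fcoeff (\<lambda>x. \<psi> x * f x) n)) G \<le> s * nrm f"
proof (rule le_mult_of_le_greater)
  fix r assume r: "nrm f < r"
  then have r0: "0 < r" using nrm_nonneg[of f] by linarith
  let ?g = "\<lambda>x. complex_of_real (1 / r) * f x"
  have f2: "f \<in> L2" using f by (simp add: H2_def)
  have "?g \<in> H2" using f unfolding H2_def by (auto simp: fcoeff_cmult simp del: of_real_divide)
  moreover have "L2norm ?g \<le> 1"
    using r r0 by (simp add: L2norm_eq[OF L2_cmult[OF f2]] nrm_cmult del: of_real_divide)
  ultimately have "antiproj_norm (\<lambda>x. \<psi> x * ?g x) \<le> hankel_norm \<psi>"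
    unfolding hankel_norm_def by (intro SUP_upper) auto
  with s(2) have le: "antiproj_norm (\<lambda>x. \<psi> x * ?g x) \<le> ennreal s" by simp
  have "fcoeff (\<lambda>x. \<psi> x * ?g x) n = complex_of_real (1 / r) * fcoeff (\<lambda>x. \<psi> x * f x) n" for n
    by (subst fcoeff_cmult[symmetric]) (simp add: mult_ac)
  then have c: "norm (fcoeff (\<lambda>x. \<psi> x * ?g x) n) = norm (fcoeff (\<lambda>x. \<psi> x * f x) n) / r" for n
    using r0 by (simp add: norm_mult norm_divide)
  let ?c = "\<lambda>n. norm (fcoeff (\<lambda>x. \<psi> x * f x) n)"
  have "ennreal (\<Sum>n\<in>G. (?c n / r)\<^sup>2) = (\<Sum>n\<in>G. ennreal ((norm (fcoeff (\<lambda>x. \<psi> x * ?g x) n))\<^sup>2))"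
    by (simp only: c) (simp add: sum_ennreal)
  also have "\<dots> \<le> (\<integral>\<^sup>+ n. ennreal ((norm (fcoeff (\<lambda>x. \<psi> x * ?g x) n))\<^sup>2) \<partial>count_space {n. \<exists>k. n k < 0})"
    by (rule sum_le_nn_integral_count_space) (use G in auto)
  finally have "esqrt (ennreal (\<Sum>n\<in>G. (?c n / r)\<^sup>2)) \<le> antiproj_norm (\<lambda>x. \<psi> x * ?g x)"
    unfolding antiproj_norm_def by (rule esqrt_mono)
  with le have "esqrt (ennreal (\<Sum>n\<in>G. (?c n / r)\<^sup>2)) \<le> ennreal s" by simp
  then have "L2_set (\<lambda>n. (1 / r) * ?c n) G \<le> s"
    using s(1) by (simp add: esqrt_ennreal sum_nonneg L2_set_def)
  then have "(1 / r) * L2_set ?c G \<le> s"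
    using r0 by (subst (asm) L2_set_right_distrib[symmetric]) auto
  then show "L2_set ?c G \<le> s * r" using r0 by (simp add: field_simps)
qed

text \<open>Pairing with \<open>expo n\<close> reads off the coefficient at -n. For n_j \<ge> 1 this
  frequency is negative in j, so the form only involves the part of \<psi> f that the Hankel
  operator retains, and Cauchy-Schwarz for finite sums applies.\<close>

lemma hankel_norm_bilinear_H2:
  assumes \<psi>: "\<psi> \<in> L2" and s: "0 \<le> s" "hankel_norm \<psi> \<le> ennreal s"
    and f: "f \<in> H2" and g: "g \<in> trigs {n. n j \<ge> 1}"
  shows "norm (LINT x|torusd. \<psi> x * f x * g x) \<le> s * nrm f * nrm g"
proof -
  obtain G c where G: "finite G" "G \<subseteq> {n. n j \<ge> 1}" "g = tsum G c" using g by (auto simp: trigs_def)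
  have i: "integrable torusd (\<lambda>x. \<psi> x * f x)" using f by (intro L2_mult_integrable \<psi>) (simp add: H2_def)
  let ?c = "\<lambda>n. norm (fcoeff (\<lambda>x. \<psi> x * f x) n)"
  have "(LINT x|torusd. \<psi> x * f x * g x) = (LINT x|torusd. (\<Sum>n\<in>G. c n * (\<psi> x * f x * expo n x)))"
    by (simp add: G tsum_def sum_distrib_left mult_ac)
  also have "\<dots> = (\<Sum>n\<in>G. c n * fcoeff (\<lambda>x. \<psi> x * f x) (- n))"
    by (subst Bochner_Integration.integral_sum)
       (auto simp: fcoeff_expo intro!: integrable_mult_right integrable_mult_expo i)
  also have "norm \<dots> \<le> (\<Sum>n\<in>G. \<bar>norm (c n)\<bar> * \<bar>?c (- n)\<bar>)"
    by (rule order_trans[OF norm_sum]) (simp add: norm_mult)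
  also have "\<dots> \<le> L2_set (\<lambda>n. norm (c n)) G * L2_set (\<lambda>n. ?c (- n)) G"
    by (rule L2_set_mult_ineq)
  also have "L2_set (\<lambda>n. norm (c n)) G = nrm g"
    using nrm_tsum[OF G(1), of c] nrm_nonneg[of g] by (simp add: L2_set_def G(3) real_sqrt_unique)
  also have "L2_set (\<lambda>n. ?c (- n)) G = L2_set ?c (uminus ` G)"
    by (simp add: L2_set_def sum.reindex inj_on_def)
  also have "nrm g * L2_set ?c (uminus ` G) \<le> nrm g * (s * nrm f)"
  proof (intro mult_left_mono hankel_norm_coeff_bound s f)
    show "\<exists>k. n k < 0" if "n \<in> uminus ` G" for n
      using that G(2) by (force intro!: exI[of _ j])
  qed (use G in auto)
  finally show ?thesis by (simp add: mult_ac)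
qed

lemma hankel_norm_bilinear:
  assumes \<psi>: "\<psi> \<in> L2" and s: "0 \<le> s" "hankel_norm \<psi> \<le> ennreal s"
    and f: "f \<in> trigs {n. n j \<ge> 0}" and g: "g \<in> trigs {n. n j \<ge> 1}"
  shows "norm (LINT x|torusd. \<psi> x * f x * g x) \<le> s * nrm f * nrm g"
proof -
  obtain F c where F: "finite F" "F \<subseteq> {n. n j \<ge> 0}" "f = tsum F c" using f by (auto simp: trigs_def)
  have "\<forall>n. \<exists>N. n \<in> (cube N :: ('a \<Rightarrow> int) set)" using ex_cube by blast
  then obtain N where N: "\<And>n. n \<in> (cube (N n) :: ('a \<Rightarrow> int) set)" by metis
  define L where "L = (\<Sum>n\<in>F. N n)"
  have L: "\<bar>n k\<bar> \<le> int L" if "n \<in> F" for n k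
  proof -
    have "N n \<le> L" unfolding L_def using that F(1) by (intro member_le_sum) auto
    then show ?thesis using N[of n] by (auto simp: cube_def intro: order_trans)
  qed
  \<comment> \<open>The shift by \<open>e\<close> makes all frequencies of \<open>f\<close>
    nonnegative in the other variables. It is 0 at \<open>j\<close>, so the spectral condition on
    \<open>g\<close> survives the opposite shift; both exponentials are unimodular and cancel in the
    product.\<close>
  define e :: "'a \<Rightarrow> int" where "e = (\<lambda>k. if k = j then 0 else int L)"
  let ?f = "\<lambda>x. expo e x * f x" and ?g = "\<lambda>x. expo (- e) x * g x"
  have "?f \<in> trigs {n. \<forall>k. n k \<ge> 0}"
  proof (rule trigs_mult)
    show "expo e \<in> trigs {e}" by (rule trigs_expo) simp
    show "f \<in> trigs F" using F by (simp add: trigs_tsum)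
    show "m + n \<in> {n. \<forall>k. n k \<ge> 0}" if "m \<in> {e}" "n \<in> F" for m n
    proof (intro CollectI allI)
      fix k
      show "0 \<le> (m + n) k" using that F(2) L[of n k] by (cases "k = j") (auto simp: e_def abs_le_iff)
    qed
  qed
  then have "?f \<in> H2"
    unfolding H2_def using trigs_fcoeff[of ?f] by (auto simp: trigs_L2 not_le[symmetric])
  moreover have "?g \<in> trigs {n. n j \<ge> 1}"
    by (rule trigs_mult[OF trigs_expo[of "- e" "{- e}"] g]) (auto simp: e_def)
  ultimately have "norm (LINT x|torusd. \<psi> x * ?f x * ?g x) \<le> s * nrm ?f * nrm ?g"
    by (rule hankel_norm_bilinear_H2[OF \<psi> s])
  moreover have "\<psi> x * ?f x * ?g x = \<psi> x * f x * g x" for x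
  proof -
    have "\<psi> x * ?f x * ?g x = \<psi> x * f x * g x * (expo e x * expo (- e) x)" by (simp only: mult_ac)
    then show ?thesis by simp
  qed
  ultimately show ?thesis by (simp add: nrm_def norm_mult)
qed

section \<open>Approximate outer functions\<close>

lemma trigs_real_polynomial:
  assumes "real_polynomial_function p" "(\<lambda>x. complex_of_real (v x)) \<in> trigs UNIV"
  shows "(\<lambda>x. complex_of_real (p (v x))) \<in> trigs UNIV"
  using assms(1)
proof induction
  case (linear h)
  have "h y = h 1 * y" for y :: real
    using linear_scale[OF bounded_linear.linear[OF linear], of y 1] by (simp add: mult.commute)
  then have "(\<lambda>x. complex_of_real (h (v x))) = (\<lambda>x. complex_of_real (h 1) * complex_of_real (v x))"
    by (metis of_real_mult)
  then show ?case using trigs_cmult[OF assms(2)] by simp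
next
  case (const c)
  have "(\<lambda>x. complex_of_real c * expo 0 x) \<in> trigs UNIV" by (intro trigs_cmult trigs_expo) simp
  then show ?case by simp
next
  case (mult p q)
  then show ?case by (auto intro: trigs_mult)
qed (auto intro: trigs_add)

text \<open>Conjugating the part with n_j < 0 moves it to n_j > 0 without changing its real part.
  The normalization is chosen so that |exp q|^2 = exp u.\<close>

lemma trigs_analytic_real_part:
  assumes "(\<lambda>x. complex_of_real (u x)) \<in> trigs UNIV"
  obtains q where "q \<in> trigs {n. n j \<ge> 0}" "\<And>x. u x = 2 * Re (q x)"
proof -
  obtain F c where F: "finite F" "(\<lambda>x. complex_of_real (u x)) = tsum F c"
    using assms by (auto simp: trigs_def)
  let ?A = "tsum {n\<in>F. n j \<ge> 0} c" and ?C = "tsum {n\<in>F. n j < 0} c"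
  have split: "complex_of_real (u x) = ?A x + ?C x" for x
  proof -
    have "complex_of_real (u x) = tsum F c x" using F(2) by metis
    also have "F = {n\<in>F. n j \<ge> 0} \<union> {n\<in>F. n j < 0}" by auto
    also have "tsum ({n\<in>F. n j \<ge> 0} \<union> {n\<in>F. n j < 0}) c x = ?A x + ?C x"
      unfolding tsum_def by (rule sum.union_disjoint) (use F in auto)
    finally show ?thesis .
  qed
  have "(\<lambda>x. cnj (?C x)) \<in> trigs (uminus ` {n\<in>F. n j < 0})"
    by (intro trigs_cnj trigs_tsum) (use F in auto)
  then have C: "(\<lambda>x. cnj (?C x)) \<in> trigs {n. n j \<ge> 0}" by (rule trigs_mono) auto
  have A: "?A \<in> trigs {n. n j \<ge> 0}" by (rule trigs_tsum) (use F in auto)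
  show thesis
  proof (rule that[OF trigs_cmult[OF trigs_add[OF A C], of "1/2"]])
    fix x
    have "u x = Re (?A x + ?C x)" by (simp flip: split)
    then show "u x = 2 * Re (1/2 * (?A x + cnj (?C x)))" by simp
  qed
qed

text \<open>Up to a factor \<open>exp e\<close>, the function exp q has square modulus |F| + e, as
  an outer function would. The summand \<open>e\<close> keeps the logarithm finite at the zeros of
  \<open>F\<close>. The polynomial is applied to |F|^2, which is a trigonometric polynomial, whereas
  |F| in general is not; hence the square root under the logarithm.\<close>

lemma outer_approximation:
  assumes F: "F \<in> trigs K" and e: "e > 0"
  obtains q where "q \<in> trigs {n. n j \<ge> 0}"
    "\<And>x. exp (2 * Re (q x)) \<le> exp e * (norm (F x) + e)"
    "\<And>x. norm (F x) + e \<le> exp e * exp (2 * Re (q x))"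
proof -
  obtain C where C: "0 \<le> C" "\<And>x. norm (F x) \<le> C" using trigs_bounded[OF F] by auto
  have "continuous_on {0..C\<^sup>2} (\<lambda>y. ln (sqrt y + e))"
    using e by (intro continuous_intros) (auto simp: add_nonneg_pos less_imp_neq[symmetric])
  then obtain p where p: "real_polynomial_function p"
    "\<And>y. y \<in> {0..C\<^sup>2} \<Longrightarrow> \<bar>ln (sqrt y + e) - p y\<bar> < e"
    using Stone_Weierstrass_real_polynomial_function[OF compact_Icc _ e] by metis
  have "(\<lambda>x. F x * cnj (F x)) \<in> trigs UNIV"
    by (rule trigs_mult[OF F trigs_cnj[OF F]]) simp
  then have "(\<lambda>x. complex_of_real ((norm (F x))\<^sup>2)) \<in> trigs UNIV"
    by (simp only: complex_norm_square)
  then obtain q where q: "q \<in> trigs {n. n j \<ge> 0}" "\<And>x. p ((norm (F x))\<^sup>2) = 2 * Re (q x)"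
    using trigs_analytic_real_part[OF trigs_real_polynomial[OF p(1)]] by metis
  have "\<bar>ln (norm (F x) + e) - 2 * Re (q x)\<bar> < e" for x
    using p(2)[of "(norm (F x))\<^sup>2"] C(2)[of x] by (simp add: q(2) power_mono)
  then have d: "2 * Re (q x) \<le> e + ln (norm (F x) + e)" "ln (norm (F x) + e) \<le> e + 2 * Re (q x)" for x
    by (smt (verit))+
  have pos: "0 < norm (F x) + e" for x using e by (simp add: add_nonneg_pos)
  show thesis
  proof (rule that[OF q(1)])
    fix x
    have "exp (2 * Re (q x)) \<le> exp (e + ln (norm (F x) + e))" using d(1)[of x] by simp
    then show "exp (2 * Re (q x)) \<le> exp e * (norm (F x) + e)" using pos[of x] by (simp add: exp_add)
    have "exp (ln (norm (F x) + e)) \<le> exp (e + 2 * Re (q x))" using d(2)[of x] by simp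
    then show "norm (F x) + e \<le> exp e * exp (2 * Re (q x))" using pos[of x] by (simp add: exp_add)
  qed
qed

lemma nrm_tendsto:
  assumes "\<And>i. f i \<in> L2" "g \<in> L2" "(\<lambda>i. nrm (\<lambda>x. f i x - g x)) \<longlonglongrightarrow> 0"
  shows "(\<lambda>i. nrm (f i)) \<longlonglongrightarrow> nrm g"
proof -
  have "(\<lambda>i. nrm (f i) - nrm g) \<longlonglongrightarrow> 0"
  proof (rule Lim_null_comparison[OF always_eventually[OF allI] assms(3)])
    fix i
    have "nrm (\<lambda>x. (f i x - g x) + g x) \<le> nrm (\<lambda>x. f i x - g x) + nrm g"
      and "nrm (\<lambda>x. (g x - f i x) + f i x) \<le> nrm (\<lambda>x. g x - f i x) + nrm (f i)"
      by (intro nrm_triangle L2_diff assms)+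
    then show "norm (nrm (f i) - nrm g) \<le> nrm (\<lambda>x. f i x - g x)"
      by (simp add: nrm_minus_commute[of g])
  qed
  then show ?thesis by (rule LIM_zero_cancel)
qed

text \<open>The truncation keeps both factors among the trigonometric polynomials, for which the
  bilinear bound is available.\<close>

definition exp_partial :: "nat \<Rightarrow> complex \<Rightarrow> complex" where
  "exp_partial k z = (\<Sum>i<k. z ^ i /\<^sub>R fact i)"

lemma exp_partial_tendsto: "(\<lambda>k. exp_partial k z) \<longlonglongrightarrow> exp z"
  using exp_converges[of z] by (simp add: sums_def exp_partial_def)

lemma norm_exp_partial_le: "norm (exp_partial k z) \<le> exp (norm z)"
proof -
  have "norm (exp_partial k z) \<le> (\<Sum>i<k. norm z ^ i /\<^sub>R fact i)"
    unfolding exp_partial_def by (rule order_trans[OF norm_sum]) (simp add: norm_power)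
  also have "\<dots> \<le> exp (norm z)"
    unfolding exp_def by (rule sum_le_suminf[OF summable_exp_generic]) auto
  finally show ?thesis .
qed

lemma trigs_exp_partial:
  assumes "q \<in> trigs {n. n j \<ge> 0}"
  shows "(\<lambda>x. exp_partial k (q x)) \<in> trigs {n. n j \<ge> 0}"
proof -
  have pow: "(\<lambda>x. q x ^ i) \<in> trigs {n. n j \<ge> 0}" for i
  proof (induction i)
    case 0
    have "expo 0 \<in> trigs {n. n j \<ge> 0}" by (rule trigs_expo) simp
    then show ?case by (simp add: expo_zero[abs_def] flip: expo_zero)
  next
    case (Suc i)
    have "(\<lambda>x. q x * q x ^ i) \<in> trigs {n. n j \<ge> 0}"
      by (rule trigs_mult[OF assms Suc]) simp
    then show ?case by simp
  qed
  show ?thesis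
    unfolding exp_partial_def scaleR_conv_of_real by (intro trigs_sum trigs_cmult pow)
qed

text \<open>The factorization F = exp q * (F exp (-q)), with both factors of square modulus close to the
  modulus of F, replaces the inner-outer factorization of the classical proof.\<close>

lemma hankel_norm_L1_bound:
  assumes \<psi>: "\<psi> \<in> L2" and s: "0 \<le> s" "hankel_norm \<psi> \<le> ennreal s"
    and F: "F \<in> trigs {n. n j \<ge> 1}"
  shows "norm (LINT x|torusd. \<psi> x * F x) \<le> s * (LINT x|torusd. norm (F x))"
proof -
  let ?L = "LINT x|torusd. norm (F x)" and ?I = "norm (LINT x|torusd. \<psi> x * F x)"
  have F2: "F \<in> L2" by (rule trigs_L2[OF F])
  have [measurable]: "F \<in> borel_measurable torusd" "\<psi> \<in> borel_measurable torusd"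
    using F2 \<psi> by (auto intro: L2_measurable)
  obtain C where C: "0 \<le> C" "\<And>x. norm (F x) \<le> C" using trigs_bounded[OF F] by auto
  have Fi: "integrable torusd (\<lambda>x. norm (F x))" by (intro integrable_norm L2_integrable F2)
  have L0: "0 \<le> ?L" by simp
  \<comment> \<open>Each of the two factors contributes one \<open>exp e\<close>; the remaining
    product comes from the separate bounds \<open>n1\<close> and \<open>n2\<close>.\<close>
  have main: "?I\<^sup>2 \<le> s\<^sup>2 * (exp e)\<^sup>2 * (?L + e) * ?L" if e: "e > 0" for e
  proof -
    obtain q where q: "q \<in> trigs {n. n j \<ge> 0}"
      and up: "\<And>x. exp (2 * Re (q x)) \<le> exp e * (norm (F x) + e)"
      and lo: "\<And>x. norm (F x) + e \<le> exp e * exp (2 * Re (q x))"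
      using outer_approximation[OF F e] by blast
    have [measurable]: "q \<in> borel_measurable torusd" by (rule trigs_measurable[OF q])
    obtain Q where Q: "0 \<le> Q" "\<And>x. norm (q x) \<le> Q" using trigs_bounded[OF q] by auto
    have q': "(\<lambda>x. - q x) \<in> trigs {n. n j \<ge> 0}" using trigs_cmult[OF q, of "-1"] by simp
    let ?f = "\<lambda>k x. exp_partial k (q x)" and ?h = "\<lambda>k x. exp_partial k (- q x)"
    have f: "?f k \<in> trigs {n. n j \<ge> 0}" and h: "?h k \<in> trigs {n. n j \<ge> 0}" for k
      by (rule trigs_exp_partial[OF q], rule trigs_exp_partial[OF q'])
    have g: "(\<lambda>x. F x * ?h k x) \<in> trigs {n. n j \<ge> 1}" for k
      by (rule trigs_mult[OF F h]) auto
    have fb: "norm (?f k x) \<le> exp Q" and hb: "norm (?h k x) \<le> exp Q" for k x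
      using norm_exp_partial_le[of k "q x"] norm_exp_partial_le[of k "- q x"] Q(2)[of x]
      by (auto intro: order_trans)
    have eb: "norm (exp (q x)) \<le> exp Q" "norm (exp (- q x)) \<le> exp Q" for x
      using norm_exp[of "q x"] norm_exp[of "- q x"] Q(2)[of x] by (auto intro: order_trans)
    have [measurable]: "?f k \<in> borel_measurable torusd" "?h k \<in> borel_measurable torusd" for k
      by (rule trigs_measurable[OF f], rule trigs_measurable[OF h])
    have eq2: "(\<lambda>x. exp (q x)) \<in> L2" by (rule L2_bounded[of _ "exp Q"]) (use eb in auto)
    have Feb: "norm (F x * exp (- q x)) \<le> C * exp Q" for x
      unfolding norm_mult by (intro mult_mono C eb) auto
    have Fhb: "norm (F x * ?h k x) \<le> C * exp Q" for k x
      unfolding norm_mult by (intro mult_mono C hb) auto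
    have Fe2: "(\<lambda>x. F x * exp (- q x)) \<in> L2" by (rule L2_bounded[OF _ Feb]) measurable
    have lim1: "(\<lambda>k. nrm (?f k)) \<longlonglongrightarrow> nrm (\<lambda>x. exp (q x))"
    proof (rule nrm_tendsto[OF trigs_L2[OF f] eq2], rule nrm_tendsto_zero)
      show "(\<lambda>x. complex_of_real (2 * exp Q)) \<in> L2" by simp
      show "AE x in torusd. (\<lambda>k. ?f k x - exp (q x)) \<longlonglongrightarrow> 0"
        by (intro AE_I2 LIM_zero exp_partial_tendsto)
      show "AE x in torusd. norm (?f k x - exp (q x)) \<le> norm (complex_of_real (2 * exp Q))" for k
      proof (rule AE_I2)
        fix x
        have "norm (?f k x - exp (q x)) \<le> exp Q + exp Q"
          by (rule order_trans[OF norm_triangle_ineq4]) (intro add_mono fb eb)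
        then show "norm (?f k x - exp (q x)) \<le> norm (complex_of_real (2 * exp Q))"
          unfolding norm_of_real by simp
      qed
    qed measurable
    have lim2: "(\<lambda>k. nrm (\<lambda>x. F x * ?h k x)) \<longlonglongrightarrow> nrm (\<lambda>x. F x * exp (- q x))"
    proof (rule nrm_tendsto[OF trigs_L2[OF g] Fe2], rule nrm_tendsto_zero)
      show "(\<lambda>x. complex_of_real (2 * (C * exp Q))) \<in> L2" by simp
      show "AE x in torusd. (\<lambda>k. F x * ?h k x - F x * exp (- q x)) \<longlonglongrightarrow> 0"
        by (intro AE_I2 LIM_zero tendsto_mult_left exp_partial_tendsto)
      show "AE x in torusd. norm (F x * ?h k x - F x * exp (- q x)) \<le> norm (complex_of_real (2 * (C * exp Q)))" for k
      proof (rule AE_I2)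
        fix x
        have "norm (F x * ?h k x - F x * exp (- q x)) \<le> C * exp Q + C * exp Q"
          by (rule order_trans[OF norm_triangle_ineq4]) (intro add_mono Fhb Feb)
        then show "norm (F x * ?h k x - F x * exp (- q x)) \<le> norm (complex_of_real (2 * (C * exp Q)))"
          unfolding norm_of_real by simp
      qed
    qed measurable
    \<comment> \<open>The truncations of exp q and exp (-q) are not inverse to each other, but their
      product tends boundedly to 1, so the form converges to the integral of \<psi> F.\<close>
    have lim3: "(\<lambda>k. LINT x|torusd. \<psi> x * ?f k x * (F x * ?h k x)) \<longlonglongrightarrow> (LINT x|torusd. \<psi> x * F x)"
    proof (rule integral_dominated_convergence)
      show "integrable torusd (\<lambda>x. norm (\<psi> x) * (exp Q * (C * exp Q)))"
        by (intro integrable_mult_left integrable_norm L2_integrable \<psi>)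
      show "AE x in torusd. (\<lambda>k. \<psi> x * ?f k x * (F x * ?h k x)) \<longlonglongrightarrow> \<psi> x * F x"
      proof (rule AE_I2)
        fix x
        have "(\<lambda>k. \<psi> x * ?f k x * (F x * ?h k x)) \<longlonglongrightarrow> \<psi> x * exp (q x) * (F x * exp (- q x))"
          by (intro tendsto_intros exp_partial_tendsto)
        then show "(\<lambda>k. \<psi> x * ?f k x * (F x * ?h k x)) \<longlonglongrightarrow> \<psi> x * F x"
          by (simp add: exp_minus field_simps)
      qed
      show "AE x in torusd. norm (\<psi> x * ?f k x * (F x * ?h k x)) \<le> norm (\<psi> x) * (exp Q * (C * exp Q))" for k
        by (rule AE_I2, subst norm_mult, subst norm_mult, subst mult.assoc)
           (intro mult_left_mono mult_mono fb Fhb, auto)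
    qed measurable
    have le: "?I \<le> s * nrm (\<lambda>x. exp (q x)) * nrm (\<lambda>x. F x * exp (- q x))"
      by (rule LIMSEQ_le[OF tendsto_norm[OF lim3] tendsto_mult[OF tendsto_mult[OF tendsto_const lim1] lim2]])
         (use hankel_norm_bilinear[OF \<psi> s f g] in auto)
    have n1: "(nrm (\<lambda>x. exp (q x)))\<^sup>2 \<le> exp e * (?L + e)"
    proof -
      have "(nrm (\<lambda>x. exp (q x)))\<^sup>2 \<le> (LINT x|torusd. exp e * (norm (F x) + e))"
        unfolding nrm_sq
      proof (rule integral_mono)
        show "(norm (exp (q x)))\<^sup>2 \<le> exp e * (norm (F x) + e)" for x
          using up[of x] by (simp add: norm_exp_eq_Re exp_double)
        show "integrable torusd (\<lambda>x. exp e * (norm (F x) + e))"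
          by (intro integrable_mult_right Bochner_Integration.integrable_add Fi torusd.integrable_const)
      qed (rule L2_square_integrable[OF eq2])
      also have "\<dots> = exp e * (?L + e)"
        using Fi by (simp add: torusd.prob_space[unfolded space_torusd])
      finally show ?thesis .
    qed
    \<comment> \<open>The square modulus is |F| |F| exp (-2 Re q), and the lower estimate
      \<open>lo\<close> lets one factor |F| be absorbed by exp (2 Re q) at the cost of
      \<open>exp e\<close>.\<close>
    have n2: "(nrm (\<lambda>x. F x * exp (- q x)))\<^sup>2 \<le> exp e * ?L"
    proof -
      have "(nrm (\<lambda>x. F x * exp (- q x)))\<^sup>2 \<le> (LINT x|torusd. exp e * norm (F x))"
        unfolding nrm_sq
      proof (rule integral_mono)
        fix x
        have "norm (F x) \<le> exp e * exp (2 * Re (q x))" using lo[of x] e by simp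
        then have le: "norm (F x) * norm (F x) \<le> (exp e * exp (2 * Re (q x))) * norm (F x)"
          by (intro mult_right_mono) auto
        have "(norm (F x * exp (- q x)))\<^sup>2 = (norm (F x) * norm (F x)) * exp (- (2 * Re (q x)))"
          by (simp add: norm_mult norm_exp_eq_Re power2_eq_square exp_add[symmetric] del: exp_minus_inverse)
        also have "\<dots> \<le> ((exp e * exp (2 * Re (q x))) * norm (F x)) * exp (- (2 * Re (q x)))"
          by (rule mult_right_mono[OF le]) simp
        also have "\<dots> = exp e * norm (F x)" by (simp add: exp_minus)
        finally show "(norm (F x * exp (- q x)))\<^sup>2 \<le> exp e * norm (F x)" .
      qed (use Fi L2_square_integrable[OF Fe2] in auto)
      then show ?thesis by simp
    qed
    have "?I\<^sup>2 \<le> (s * nrm (\<lambda>x. exp (q x)) * nrm (\<lambda>x. F x * exp (- q x)))\<^sup>2"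
      using le by (intro power_mono) auto
    also have "\<dots> = s\<^sup>2 * ((nrm (\<lambda>x. exp (q x)))\<^sup>2 * (nrm (\<lambda>x. F x * exp (- q x)))\<^sup>2)"
      by (simp add: power_mult_distrib mult.assoc)
    also have "\<dots> \<le> s\<^sup>2 * ((exp e * (?L + e)) * (exp e * ?L))"
      by (intro mult_left_mono mult_mono n1 n2) (use e L0 in auto)
    finally show ?thesis by (simp add: power2_eq_square mult_ac)
  qed
  have "?I\<^sup>2 \<le> s\<^sup>2 * (exp 0)\<^sup>2 * (?L + 0) * ?L"
  proof (rule LIMSEQ_le_const)
    show "(\<lambda>k. s\<^sup>2 * (exp (1 / real (Suc k)))\<^sup>2 * (?L + 1 / real (Suc k)) * ?L) \<longlonglongrightarrow> s\<^sup>2 * (exp 0)\<^sup>2 * (?L + 0) * ?L"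
      by (intro tendsto_intros LIMSEQ_Suc[OF lim_1_over_n])
    show "\<exists>N. \<forall>k\<ge>N. ?I\<^sup>2 \<le> s\<^sup>2 * (exp (1 / real (Suc k)))\<^sup>2 * (?L + 1 / real (Suc k)) * ?L"
      by (intro exI allI impI main) simp
  qed
  also have "\<dots> = (s * ?L)\<^sup>2" by (simp add: power2_eq_square)
  finally show ?thesis by (rule power2_le_imp_le) (use s L0 in simp)
qed

text \<open>Duality by a variational argument: a near minimizer of the coefficient error over the ball of
  radius s cannot be improved by moving towards minus s times the sign of the error polynomial R, and
  the L1 bound for the conjugate of R turns this into smallness of the error.\<close>

lemma approximate_symbol:
  fixes \<psi> :: "('d::finite \<Rightarrow> real) \<Rightarrow> complex"
  assumes \<psi>: "\<psi> \<in> L2" and s: "0 \<le> s" and S: "finite S" "S \<subseteq> {n. n j < 0}" and \<delta>: "\<delta> > 0"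
    and L1: "\<And>F. F \<in> trigs {n. n j \<ge> 1} \<Longrightarrow>
      norm (LINT x|torusd. \<psi> x * F x) \<le> s * (LINT x|torusd. norm (F x))"
  obtains \<Phi> where "\<Phi> \<in> borel_measurable torusd" "\<And>x. norm (\<Phi> x) \<le> s"
    "(\<Sum>n\<in>S. (norm (fcoeff \<Phi> n - fcoeff \<psi> n))\<^sup>2) \<le> \<delta>"
proof -
  define ball where "ball = {\<Phi> :: ('d \<Rightarrow> real) \<Rightarrow> complex. \<Phi> \<in> borel_measurable torusd \<and> (\<forall>x. norm (\<Phi> x) \<le> s)}"
  define \<rho> where "\<rho> \<Phi> = (\<Sum>n\<in>S. (norm (fcoeff \<Phi> n - fcoeff \<psi> n))\<^sup>2)" for \<Phi>
  \<comment> \<open>Moving by \<open>t\<close> towards the competitor changes the error to second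
    order by at most t^2 (2 s)^2. With the near-minimality tolerance t^2 and after division by 2 t
    this leaves at most t (1 + 2 s^2), which the choice of \<open>t\<close> keeps below
    \<delta>.\<close>
  define t where "t = min 1 (\<delta> / (1 + 2 * s\<^sup>2))"
  have c0: "0 < 1 + 2 * s\<^sup>2" by (simp add: add_pos_nonneg)
  have t: "0 < t" "t \<le> 1" and "t \<le> \<delta> / (1 + 2 * s\<^sup>2)" using \<delta> c0 by (auto simp: t_def)
  then have t\<delta>: "t * (1 + 2 * s\<^sup>2) \<le> \<delta>" using c0 by (simp add: le_divide_eq)
  have ball2: "\<Phi> \<in> L2" if "\<Phi> \<in> ball" for \<Phi> using that by (auto simp: ball_def intro: L2_bounded)
  have bdd: "bdd_below (\<rho> ` ball)" by (rule bdd_belowI[of _ 0]) (auto simp: \<rho>_def sum_nonneg)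
  have "(\<lambda>x. 0) \<in> ball" using s by (simp add: ball_def)
  then have ne: "\<rho> ` ball \<noteq> {}" by auto
  have "Inf (\<rho> ` ball) < Inf (\<rho> ` ball) + t\<^sup>2" using t(1) by simp
  from cInf_lessD[OF ne this] obtain \<Phi> where \<Phi>: "\<Phi> \<in> ball" "\<rho> \<Phi> < Inf (\<rho> ` ball) + t\<^sup>2"
    by blast
  have near: "\<rho> \<Phi> \<le> \<rho> \<Psi> + t\<^sup>2" if "\<Psi> \<in> ball" for \<Psi>
    using cInf_lower[OF imageI[OF that] bdd] \<Phi>(2) by linarith
  define r where "r n = fcoeff \<Phi> n - fcoeff \<psi> n" for n
  define R where "R = tsum S r"
  have R2: "R \<in> L2" by (simp add: R_def)
  have [measurable]: "R \<in> borel_measurable torusd" by (simp add: R_def)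
  \<comment> \<open>The extremal point of the ball for the linearized error: its real pairing with R
    attains the least possible value, -s times the L1 norm of R.\<close>
  define \<Phi>1 where "\<Phi>1 x = - complex_of_real s * sgn (R x)" for x
  have sgnm: "(\<lambda>x. sgn (R x)) \<in> borel_measurable torusd"
    unfolding sgn_div_norm by measurable
  have "norm (\<Phi>1 x) \<le> s" for x using s by (simp add: \<Phi>1_def norm_mult norm_sgn)
  then have \<Phi>1: "\<Phi>1 \<in> ball" unfolding ball_def \<Phi>1_def using sgnm by auto
  have \<Phi>L: "\<Phi> \<in> L2" "\<Phi>1 \<in> L2" by (rule ball2[OF \<Phi>(1)], rule ball2[OF \<Phi>1])
  define d where "d n = fcoeff \<Phi>1 n - fcoeff \<Phi> n" for n
  have d_eq: "d n = fcoeff (\<lambda>x. \<Phi>1 x - \<Phi> x) n" for n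
    by (simp add: d_def fcoeff_diff L2_integrable \<Phi>L)
  define \<Phi>t where "\<Phi>t x = complex_of_real (1 - t) * \<Phi> x + complex_of_real t * \<Phi>1 x" for x
  have \<Phi>t: "\<Phi>t \<in> ball"
  proof -
    have "norm (\<Phi>t x) \<le> (1 - t) * s + t * s" for x
    proof -
      have "norm (\<Phi>t x) \<le> norm (complex_of_real (1 - t) * \<Phi> x) + norm (complex_of_real t * \<Phi>1 x)"
        unfolding \<Phi>t_def by (rule norm_triangle_ineq)
      also have "\<dots> = (1 - t) * norm (\<Phi> x) + t * norm (\<Phi>1 x)"
        using t unfolding norm_mult norm_of_real by simp
      also have "\<dots> \<le> (1 - t) * s + t * s"
        using t \<Phi>(1) \<Phi>1 by (intro add_mono mult_left_mono) (auto simp: ball_def)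
      finally show ?thesis .
    qed
    moreover have "\<Phi>t \<in> borel_measurable torusd"
    proof -
      have [measurable]: "\<Phi> \<in> borel_measurable torusd" "\<Phi>1 \<in> borel_measurable torusd"
        by (rule L2_measurable[OF \<Phi>L(1)], rule L2_measurable[OF \<Phi>L(2)])
      show ?thesis unfolding \<Phi>t_def[abs_def] by measurable
    qed
    ultimately show ?thesis by (simp add: ball_def algebra_simps)
  qed
  have "fcoeff \<Phi>t n = complex_of_real (1 - t) * fcoeff \<Phi> n + complex_of_real t * fcoeff \<Phi>1 n" for n
    unfolding \<Phi>t_def[abs_def] by (simp only: fcoeff_add fcoeff_cmult L2_integrable L2_cmult \<Phi>L)
  then have ct: "fcoeff \<Phi>t n - fcoeff \<psi> n = r n + complex_of_real t * d n" for n
    by (simp add: r_def d_def algebra_simps)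
  have exp2: "(norm (z + complex_of_real t * w))\<^sup>2 = (norm z)\<^sup>2 + 2 * t * Re (cnj z * w) + t\<^sup>2 * (norm w)\<^sup>2" for z w
    by (simp only: cmod_power2) (simp add: power2_eq_square algebra_simps)
  \<comment> \<open>The linear term is the directional derivative of the squared error at \<Phi>,
    and \<open>d\<close> is the coefficient vector of \<Phi>1 - \<Phi>.\<close>
  have "\<rho> \<Phi>t = \<rho> \<Phi> + 2 * t * Re (\<Sum>n\<in>S. cnj (r n) * d n) + t\<^sup>2 * (\<Sum>n\<in>S. (norm (d n))\<^sup>2)"
    unfolding \<rho>_def ct exp2 r_def[symmetric] by (simp only: sum.distrib sum_distrib_left Re_sum)
  moreover have "(\<Sum>n\<in>S. (norm (d n))\<^sup>2) \<le> (2 * s)\<^sup>2"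
  proof -
    have "(\<Sum>n\<in>S. (norm (d n))\<^sup>2) \<le> (nrm (\<lambda>x. \<Phi>1 x - \<Phi> x))\<^sup>2"
      unfolding d_eq by (intro Bessel L2_diff \<Phi>L S)
    also have "\<dots> \<le> (2 * s)\<^sup>2"
    proof (intro power_mono nrm_const_bound)
      have "norm (\<Phi>1 x - \<Phi> x) \<le> s + s" for x
        by (rule order_trans[OF norm_triangle_ineq4], rule add_mono) (use \<Phi>(1) \<Phi>1 in \<open>auto simp: ball_def\<close>)
      then show "AE x in torusd. norm (\<Phi>1 x - \<Phi> x) \<le> 2 * s" by (intro AE_I2) simp
    qed (use s \<Phi>(1) \<Phi>1 in \<open>auto simp: ball_def\<close>)
    finally show ?thesis .
  qed
  then have "t\<^sup>2 * (\<Sum>n\<in>S. (norm (d n))\<^sup>2) \<le> t\<^sup>2 * (2 * s)\<^sup>2" by (intro mult_left_mono) auto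
  ultimately have step: "- (2 * t * Re (\<Sum>n\<in>S. cnj (r n) * d n)) \<le> t\<^sup>2 + t\<^sup>2 * (2 * s)\<^sup>2"
    using near[OF \<Phi>t] by linarith
  let ?ip = "\<lambda>f. Re (LINT x|torusd. f x * cnj (R x))"
  have ip: "(LINT x|torusd. f x * cnj (R x)) = (\<Sum>n\<in>S. cnj (r n) * fcoeff f n)" if "f \<in> L2" for f
    unfolding R_def by (rule integral_mult_cnj_tsum[OF L2_integrable[OF that]])
  have "(\<lambda>x. cnj (R x)) \<in> trigs (uminus ` S)"
    unfolding R_def by (rule trigs_cnj[OF trigs_tsum]) (auto simp: S)
  \<comment> \<open>Since S lies in n_j < 0, conjugation puts the frequencies at n_j \<ge> 1,
    exactly the class for which the L1 bound holds.\<close>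
  then have cR: "(\<lambda>x. cnj (R x)) \<in> trigs {n. n j \<ge> 1}" by (rule trigs_mono) (use S in auto)
  let ?N = "LINT x|torusd. norm (R x)"
  have "?ip \<psi> \<ge> - (s * ?N)"
    using L1[OF cR] abs_Re_le_cmod[of "LINT x|torusd. \<psi> x * cnj (R x)"] by simp
  moreover have "?ip \<Phi>1 = - (s * ?N)"
  proof -
    have "\<Phi>1 x * cnj (R x) = complex_of_real (- s * norm (R x))" for x
    proof -
      have "sgn (R x) * cnj (R x) = complex_of_real (norm (R x))"
        by (cases "R x = 0")
           (simp_all add: sgn_div_norm scaleR_conv_of_real mult.assoc complex_norm_square[symmetric] power2_eq_square)
      then show ?thesis by (simp add: \<Phi>1_def mult.assoc)
    qed
    then have "(LINT x|torusd. \<Phi>1 x * cnj (R x)) = (LINT x|torusd. complex_of_real (- s * norm (R x)))" by simp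
    also have "\<dots> = complex_of_real (- s * ?N)"
      by (simp only: integral_complex_of_real integral_mult_right_zero)
    finally show ?thesis by simp
  qed
  moreover have "Re (\<Sum>n\<in>S. cnj (r n) * d n) = ?ip \<Phi>1 - ?ip \<Phi>"
    by (simp only: ip \<Phi>L d_def right_diff_distrib sum_subtractf minus_complex.sel)
  moreover have "\<rho> \<Phi> = ?ip \<Phi> - ?ip \<psi>"
  proof -
    have "complex_of_real (\<rho> \<Phi>) = (\<Sum>n\<in>S. cnj (r n) * r n)"
      unfolding \<rho>_def r_def[symmetric] of_real_sum by (simp only: complex_norm_square mult.commute)
    also have "\<dots> = (\<Sum>n\<in>S. cnj (r n) * fcoeff \<Phi> n) - (\<Sum>n\<in>S. cnj (r n) * fcoeff \<psi> n)"
      unfolding sum_subtractf[symmetric] by (simp only: r_def right_diff_distrib)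
    finally have "Re (complex_of_real (\<rho> \<Phi>)) = ?ip \<Phi> - ?ip \<psi>"
      by (simp only: ip \<Phi>L \<psi> minus_complex.sel)
    then show ?thesis by simp
  qed
  \<comment> \<open>The L1 bound makes the pairing of \<psi> with R at least that of \<Phi>1. Hence
    the error, which is the pairing of \<Phi> - \<psi>, is at most that of \<Phi> - \<Phi>1, the
    descent available in the chosen direction.\<close>
  ultimately have "\<rho> \<Phi> \<le> - Re (\<Sum>n\<in>S. cnj (r n) * d n)" by linarith
  then have "2 * t * \<rho> \<Phi> \<le> 2 * t * (- Re (\<Sum>n\<in>S. cnj (r n) * d n))" using t by (intro mult_left_mono) auto
  also have "\<dots> \<le> t\<^sup>2 + t\<^sup>2 * (2 * s)\<^sup>2" using step by simp
  also have "\<dots> \<le> 2 * t * (t * (1 + 2 * s\<^sup>2))"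
    by (simp add: power2_eq_square algebra_simps)
  finally have "\<rho> \<Phi> \<le> t * (1 + 2 * s\<^sup>2)" using t by simp
  with t\<delta> have "\<rho> \<Phi> \<le> \<delta>" by simp
  then show thesis using \<Phi>(1) by (intro that[of \<Phi>]) (auto simp: ball_def \<rho>_def)
qed

section \<open>Strong limits of bounded symbols\<close>

lemma nrm_parallelogram:
  assumes "f \<in> L2" "g \<in> L2"
  shows "(nrm (\<lambda>x. f x - g x))\<^sup>2 + (nrm (\<lambda>x. f x + g x))\<^sup>2 = 2 * (nrm f)\<^sup>2 + 2 * (nrm g)\<^sup>2"
proof -
  have "(nrm (\<lambda>x. f x - - g x))\<^sup>2
      = (nrm f)\<^sup>2 - 2 * Re (LINT x|torusd. f x * cnj (- g x)) + (nrm (\<lambda>x. - g x))\<^sup>2"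
    using L2_cmult[OF assms(2), of "-1"] by (intro nrm_diff_sq assms) simp
  moreover have "nrm (\<lambda>x. - g x) = nrm g" by (simp add: nrm_def)
  ultimately show ?thesis using nrm_diff_sq[OF assms] by simp
qed

text \<open>Near minimizers of the L2 norm over a decreasing sequence of convex sets form a Cauchy
  sequence, by the parallelogram law.\<close>

lemma convex_nested_limit:
  assumes A2: "\<And>N f. f \<in> A N \<Longrightarrow> f \<in> L2" and ne: "\<And>N. A N \<noteq> {}"
    and dec: "\<And>N. A (Suc N) \<subseteq> A N"
    and bd: "\<And>N f. f \<in> A N \<Longrightarrow> nrm f \<le> C"
    and mid: "\<And>N f g. f \<in> A N \<Longrightarrow> g \<in> A N \<Longrightarrow> (\<lambda>x. 1/2 * (f x + g x)) \<in> A N"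
  obtains f g r where "\<And>N. f N \<in> A N" "g \<in> L2" "(\<lambda>i. nrm (\<lambda>x. f i x - g x)) \<longlonglongrightarrow> 0"
    "strict_mono r" "AE x in torusd. (\<lambda>i. f (r i) x) \<longlonglongrightarrow> g x"
proof -
  define m where "m N = Inf ((\<lambda>f. (nrm f)\<^sup>2) ` A N)" for N
  have bdd: "bdd_below ((\<lambda>f. (nrm f)\<^sup>2) ` A N)" for N by (rule bdd_belowI[of _ 0]) auto
  have m_le: "m N \<le> (nrm f)\<^sup>2" if "f \<in> A N" for f N
    unfolding m_def by (rule cInf_lower[OF imageI[OF that] bdd])
  have "\<forall>N. \<exists>f. f \<in> A N \<and> (nrm f)\<^sup>2 < m N + 1 / real (Suc N)"
  proof
    fix N
    have "m N < m N + 1 / real (Suc N)" by simp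
    then show "\<exists>f. f \<in> A N \<and> (nrm f)\<^sup>2 < m N + 1 / real (Suc N)"
      unfolding m_def using cInf_lessD[of "(\<lambda>f. (nrm f)\<^sup>2) ` A N"] ne by blast
  qed
  then obtain f where f: "\<And>N. f N \<in> A N" "\<And>N. (nrm (f N))\<^sup>2 < m N + 1 / real (Suc N)" by metis
  have f2: "f N \<in> L2" for N by (rule A2[OF f(1)])
  have sub: "A M \<subseteq> A N" if "N \<le> M" for N M
    using decseq_SucI[of A] dec that by (auto simp: decseq_def)
  \<comment> \<open>Infima over shrinking sets increase and stay below C^2; their convergence is
    what turns near-minimality into a Cauchy estimate.\<close>
  have "incseq m"
    unfolding m_def using ne dec by (intro incseq_SucI cInf_superset_mono bdd image_mono) auto
  moreover have "m N \<le> C\<^sup>2" for N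
    using m_le[OF f(1)] power_mono[OF bd[OF f(1)[of N]], of 2] by (meson nrm_nonneg order_trans)
  ultimately obtain l where l: "m \<longlonglongrightarrow> l" by (metis incseq_convergent)
  \<comment> \<open>Both functions lie in the larger set \<open>A N\<close>, hence so does their
    midpoint, whose squared norm is at least \<open>m N\<close>. The parallelogram law then bounds
    the difference.\<close>
  have diff: "(nrm (\<lambda>x. f N x - f M x))\<^sup>2 \<le> 2 * (m M - m N) + 4 / real (Suc N)" if "N \<le> M" for N M
  proof -
    have fM: "f M \<in> A N" using f(1) sub[OF that] by blast
    have "m N \<le> (nrm (\<lambda>x. 1/2 * (f N x + f M x)))\<^sup>2" by (rule m_le[OF mid[OF f(1) fM]])
    also have "\<dots> = (nrm (\<lambda>x. f N x + f M x))\<^sup>2 / 4"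
      by (subst nrm_cmult) (simp add: power_divide)
    finally have "4 * m N \<le> (nrm (\<lambda>x. f N x + f M x))\<^sup>2" by simp
    moreover have "1 / real (Suc M) \<le> 1 / real (Suc N)" using that by (intro divide_left_mono) auto
    ultimately show ?thesis
      using nrm_parallelogram[OF f2[of N] f2[of M]] f(2)[of N] f(2)[of M] by simp
  qed
  have Cauchy: "\<exists>N. \<forall>i\<ge>N. \<forall>j\<ge>N. nrm (\<lambda>x. f i x - f j x) < e" if e: "e > 0" for e
  proof -
    \<comment> \<open>With the weights 2 and 4 in \<open>diff\<close>, the tolerance e^2 / 8 yields
      a total of at most 6/8 e^2 < e^2.\<close>
    have e2: "e\<^sup>2 / 8 > 0" using e by simp
    then obtain N1 where N1: "\<And>i j. i \<ge> N1 \<Longrightarrow> j \<ge> N1 \<Longrightarrow> dist (m i) (m j) < e\<^sup>2 / 8"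
      using metric_CauchyD[OF LIMSEQ_imp_Cauchy[OF l] e2] by blast
    obtain N2 where N2: "1 / real (Suc N2) < e\<^sup>2 / 8" by (rule nat_approx_posE[OF e2])
    have "nrm (\<lambda>x. f i x - f j x) < e" if i: "i \<ge> max N1 N2" and "i \<le> j" for i j
    proof -
      have N2i: "1 / real (Suc i) \<le> 1 / real (Suc N2)" using i by (intro divide_left_mono) auto
      have mm: "m j - m i < e\<^sup>2 / 8"
        by (rule le_less_trans[OF abs_ge_self N1[of j i, unfolded dist_real_def]]) (use that in auto)
      have "X < E" if "X \<le> 2 * d + 4 * a" "a \<le> b" "b < E / 8" "d < E / 8" "0 < E / 8"
        for X d a b E :: real
        using that by linarith
      from this[OF _ N2i N2 mm e2] diff[OF that(2)]
      have "(nrm (\<lambda>x. f i x - f j x))\<^sup>2 < e\<^sup>2" by simp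
      then show ?thesis by (rule power2_less_imp_less) (use e in simp)
    qed
    note le = this
    have "nrm (\<lambda>x. f i x - f j x) < e" if ij: "i \<ge> max N1 N2" "j \<ge> max N1 N2" for i j
    proof (cases "i \<le> j")
      case True
      then show ?thesis by (rule le[OF ij(1)])
    next
      case False
      then show ?thesis by (subst nrm_minus_commute) (intro le ij, simp)
    qed
    then show ?thesis by blast
  qed
  obtain g r where "g \<in> L2" "(\<lambda>i. nrm (\<lambda>x. f i x - g x)) \<longlonglongrightarrow> 0"
    "strict_mono r" "AE x in torusd. (\<lambda>i. f (r i) x) \<longlonglongrightarrow> g x"
    by (rule L2_complete[of f, OF f2 Cauchy])
  with f(1) show thesis by (rule that)
qed

text \<open>The sets \<open>A N\<close> of symbols bounded by \<open>s\<close> that match \<psi> on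
  the half-space part of the cube \<open>N\<close> up to 1/(N+1) are nonempty, convex and
  decreasing. A strongly convergent selection takes the place of weak-star compactness: L2
  convergence preserves the coefficients, and the almost everywhere convergent subsequence preserves
  the bound \<open>s\<close> exactly.\<close>

lemma Nehari_one_variable:
  fixes \<psi> :: "('d::finite \<Rightarrow> real) \<Rightarrow> complex"
  assumes \<psi>: "\<psi> \<in> L2" and s: "0 \<le> s" "hankel_norm \<psi> \<le> ennreal s"
  obtains \<Phi> where "\<Phi> \<in> borel_measurable torusd" "AE x in torusd. norm (\<Phi> x) \<le> s"
    "\<And>n. n j < 0 \<Longrightarrow> fcoeff \<Phi> n = fcoeff \<psi> n"
proof -
  define S :: "nat \<Rightarrow> ('d \<Rightarrow> int) set" where "S N = cube N \<inter> {n. n j < 0}" for N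
  have S: "finite (S N)" "S N \<subseteq> {n. n j < 0}" for N by (auto simp: S_def)
  define A :: "nat \<Rightarrow> (('d \<Rightarrow> real) \<Rightarrow> complex) set" where
    "A N = {\<Phi>. \<Phi> \<in> borel_measurable torusd \<and> (\<forall>x. norm (\<Phi> x) \<le> s) \<and>
      (\<Sum>n\<in>S N. (norm (fcoeff \<Phi> n - fcoeff \<psi> n))\<^sup>2) \<le> 1 / real (Suc N)}" for N
  have A2: "\<Phi> \<in> L2" if "\<Phi> \<in> A N" for \<Phi> N using that by (auto simp: A_def intro: L2_bounded)
  obtain f g r where f: "\<And>N. f N \<in> A N" and g: "g \<in> L2" "(\<lambda>i. nrm (\<lambda>x. f i x - g x)) \<longlonglongrightarrow> 0"
    and r: "strict_mono r" "AE x in torusd. (\<lambda>i. f (r i) x) \<longlonglongrightarrow> g x"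
  proof (rule convex_nested_limit[of A s])
    show "\<Phi> \<in> L2" if "\<Phi> \<in> A N" for N \<Phi> by (rule A2[OF that])
    show "A N \<noteq> {}" for N
    proof -
      have "0 < 1 / real (Suc N)" by simp
      then obtain \<Phi> where "\<Phi> \<in> borel_measurable torusd" "\<And>x. norm (\<Phi> x) \<le> s"
        "(\<Sum>n\<in>S N. (norm (fcoeff \<Phi> n - fcoeff \<psi> n))\<^sup>2) \<le> 1 / real (Suc N)"
        by (rule approximate_symbol[OF \<psi> s(1) S _ hankel_norm_L1_bound[OF \<psi> s]]) auto
      then show ?thesis by (auto simp: A_def)
    qed
    show "A (Suc N) \<subseteq> A N" for N
    proof
      fix \<Phi> assume \<Phi>: "\<Phi> \<in> A (Suc N)"
      have "(\<Sum>n\<in>S N. (norm (fcoeff \<Phi> n - fcoeff \<psi> n))\<^sup>2) \<le> (\<Sum>n\<in>S (Suc N). (norm (fcoeff \<Phi> n - fcoeff \<psi> n))\<^sup>2)"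
        using cube_mono[of N "Suc N"] S by (intro sum_mono2) (auto simp: S_def)
      also have "\<dots> \<le> 1 / real (Suc (Suc N))" using \<Phi> by (simp add: A_def)
      also have "\<dots> \<le> 1 / real (Suc N)" by (intro divide_left_mono) auto
      finally show "\<Phi> \<in> A N" using \<Phi> by (simp add: A_def)
    qed
    show "nrm \<Phi> \<le> s" if "\<Phi> \<in> A N" for N \<Phi>
      using that s(1) by (intro nrm_const_bound) (auto simp: A_def)
    show "(\<lambda>x. 1/2 * (\<Phi> x + \<Psi> x)) \<in> A N" if \<Phi>: "\<Phi> \<in> A N" and \<Psi>: "\<Psi> \<in> A N" for N \<Phi> \<Psi>
    proof -
      have "fcoeff (\<lambda>x. 1/2 * (\<Phi> x + \<Psi> x)) n = 1/2 * (fcoeff \<Phi> n + fcoeff \<Psi> n)" for n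
        by (simp only: fcoeff_cmult fcoeff_add L2_integrable A2[OF \<Phi>] A2[OF \<Psi>])
      then have *: "fcoeff (\<lambda>x. 1/2 * (\<Phi> x + \<Psi> x)) n - fcoeff \<psi> n
          = 1/2 * ((fcoeff \<Phi> n - fcoeff \<psi> n) + (fcoeff \<Psi> n - fcoeff \<psi> n))" for n
        by (simp add: field_simps)
      have sq: "(norm (1/2 * (z + w)))\<^sup>2 \<le> ((norm z)\<^sup>2 + (norm w)\<^sup>2) / 2" for z w :: complex
      proof -
        have "(norm (1/2 * (z + w)))\<^sup>2 = (norm (z + w))\<^sup>2 / 4" by (simp add: norm_mult power_divide norm_divide)
        also have "\<dots> \<le> (norm z + norm w)\<^sup>2 / 4" by (intro divide_right_mono power_mono norm_triangle_ineq) auto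
        also have "\<dots> \<le> ((norm z)\<^sup>2 + (norm w)\<^sup>2) / 2"
          using two_mult_le_squares[of "norm z" "norm w"] by (simp add: power2_sum field_simps)
        finally show ?thesis .
      qed
      have "(\<Sum>n\<in>S N. (norm (fcoeff (\<lambda>x. 1/2 * (\<Phi> x + \<Psi> x)) n - fcoeff \<psi> n))\<^sup>2)
          \<le> (\<Sum>n\<in>S N. ((norm (fcoeff \<Phi> n - fcoeff \<psi> n))\<^sup>2 + (norm (fcoeff \<Psi> n - fcoeff \<psi> n))\<^sup>2) / 2)"
        unfolding * by (intro sum_mono sq)
      also have "\<dots> = ((\<Sum>n\<in>S N. (norm (fcoeff \<Phi> n - fcoeff \<psi> n))\<^sup>2) + (\<Sum>n\<in>S N. (norm (fcoeff \<Psi> n - fcoeff \<psi> n))\<^sup>2)) / 2"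
        by (simp add: sum_divide_distrib sum.distrib add_divide_distrib)
      also have "\<dots> \<le> 1 / real (Suc N)" using \<Phi> \<Psi> by (simp add: A_def)
      finally have 1: "(\<Sum>n\<in>S N. (norm (fcoeff (\<lambda>x. 1/2 * (\<Phi> x + \<Psi> x)) n - fcoeff \<psi> n))\<^sup>2) \<le> 1 / real (Suc N)" .
      have 2: "norm (1/2 * (\<Phi> x + \<Psi> x)) \<le> s" for x
      proof -
        have "norm (\<Phi> x + \<Psi> x) \<le> s + s"
          using \<Phi> \<Psi> by (intro norm_triangle_mono) (auto simp: A_def)
        then show ?thesis by (simp add: norm_mult norm_divide)
      qed
      have "\<Phi> \<in> borel_measurable torusd" "\<Psi> \<in> borel_measurable torusd" using \<Phi> \<Psi> by (auto simp: A_def)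
      then have "(\<lambda>x. 1/2 * (\<Phi> x + \<Psi> x)) \<in> borel_measurable torusd" by measurable
      with 1 2 show ?thesis unfolding A_def by blast
    qed
  qed (rule that)
  show thesis
  proof (rule that[of g])
    show "g \<in> borel_measurable torusd" by (rule L2_measurable[OF g(1)])
    show "AE x in torusd. norm (g x) \<le> s"
      using r(2)
    proof eventually_elim
      case (elim x)
      have "norm (f (r i) x) \<le> s" for i using f[of "r i"] by (simp add: A_def)
      then show ?case by (intro LIMSEQ_le_const2[OF tendsto_norm[OF elim]]) auto
    qed
    fix n :: "'d \<Rightarrow> int" assume n: "n j < 0"
    obtain N where N: "n \<in> cube N" using ex_cube by blast
    have "(\<lambda>i. (norm (fcoeff (f i) n - fcoeff \<psi> n))\<^sup>2) \<longlonglongrightarrow> 0"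
    proof (rule Lim_null_comparison)
      show "(\<lambda>i. 1 / real (Suc i)) \<longlonglongrightarrow> 0" by (rule LIMSEQ_Suc[OF lim_1_over_n])
      have "(norm (fcoeff (f i) n - fcoeff \<psi> n))\<^sup>2 \<le> 1 / real (Suc i)" if "N \<le> i" for i
      proof -
        have "n \<in> S i" using n N cube_mono[OF that] by (auto simp: S_def)
        then have "(norm (fcoeff (f i) n - fcoeff \<psi> n))\<^sup>2 \<le> (\<Sum>n\<in>S i. (norm (fcoeff (f i) n - fcoeff \<psi> n))\<^sup>2)"
          using S by (intro member_le_sum) auto
        also have "\<dots> \<le> 1 / real (Suc i)" using f[of i] by (simp add: A_def)
        finally show ?thesis .
      qed
      then show "\<forall>\<^sub>F i in sequentially. norm ((norm (fcoeff (f i) n - fcoeff \<psi> n))\<^sup>2) \<le> 1 / real (Suc i)"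
        by (auto simp: eventually_sequentially intro!: exI[of _ N])
    qed
    moreover have "(\<lambda>i. (norm (fcoeff (f i) n - fcoeff \<psi> n))\<^sup>2) \<longlonglongrightarrow> (norm (fcoeff g n - fcoeff \<psi> n))\<^sup>2"
      by (intro tendsto_intros fcoeff_tendsto g A2[OF f])
    ultimately have "(norm (fcoeff g n - fcoeff \<psi> n))\<^sup>2 = 0" by (intro LIMSEQ_unique)
    then show "fcoeff g n = fcoeff \<psi> n" by simp
  qed
qed

subsection \<open>The two inequalities\<close>

text \<open>Subtracting the nonnegative part \<open>h\<close> leaves only frequencies that are
  negative in some variable. Each half space is then served by its own Nehari symbol of sup norm at
  most the Hankel norm, and the maximum of these bounds introduces no constant.\<close>

lemma bmo_norm_le_hankel_norm:
  fixes \<psi> :: "('d::finite \<Rightarrow> real) \<Rightarrow> complex"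
  assumes \<psi>: "\<psi> \<in> BMOr"
  obtains h where "h \<in> BMOAr" "bmo_norm (\<lambda>x. \<psi> x - h x) \<le> hankel_norm \<psi>"
proof -
  have \<psi>2: "\<psi> \<in> L2" using \<psi> by (simp add: BMOr_def)
  obtain \<phi>0 \<Phi> where adm: "bmo_admissible \<psi> \<phi>0 \<Phi>" using \<psi> by (auto simp: BMOr_def)
  have zero: "(\<lambda>x. 0) \<in> Linf" by (rule LinfI[of _ 0]) auto
  obtain h where h: "h \<in> L2" "\<And>n. fcoeff h n = (if n \<in> {n. \<forall>k. n k \<ge> 0} then fcoeff \<psi> n else 0)"
    by (rule spectral_projection[OF \<psi>2, of "{n. \<forall>k. n k \<ge> 0}"]) (rule that)
  have hneg: "fcoeff h n = 0" if "n k < 0" for n k using that by (auto simp: h(2) not_le[symmetric])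
  \<comment> \<open>This is where membership of \<psi> in \<open>BMOr\<close> is used: its symbol
    \<phi>0 also represents \<open>h\<close>, and 0 represents \<open>h\<close> on every half space
    n_j < 0.\<close>
  have "bmo_admissible h \<phi>0 (\<lambda>_ _. 0)"
    using adm zero hneg by (auto simp: bmo_admissible_def h(2))
  with h(1) hneg have hB: "h \<in> BMOAr" by (auto simp: BMOAr_def BMOr_def H2_def)
  show thesis
  proof (cases "hankel_norm \<psi> = \<infinity>")
    case True
    then show thesis by (intro that[OF hB]) simp
  next
    case False
    then obtain s where s: "0 \<le> s" "hankel_norm \<psi> = ennreal s" by (cases "hankel_norm \<psi>") auto
    have "\<forall>j. \<exists>\<Phi>. \<Phi> \<in> borel_measurable torusd \<and> (AE x in torusd. norm (\<Phi> x) \<le> s) \<and>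
        (\<forall>n. n j < 0 \<longrightarrow> fcoeff \<Phi> n = fcoeff \<psi> n)"
    proof
      fix j
      show "\<exists>\<Phi>. \<Phi> \<in> borel_measurable torusd \<and> (AE x in torusd. norm (\<Phi> x) \<le> s) \<and>
        (\<forall>n. n j < 0 \<longrightarrow> fcoeff \<Phi> n = fcoeff \<psi> n)"
        by (rule Nehari_one_variable[OF \<psi>2 s(1), of j]) (use s in auto)
    qed
    then obtain \<Psi> where \<Psi>: "\<And>j. \<Psi> j \<in> borel_measurable torusd" "\<And>j. AE x in torusd. norm (\<Psi> j x) \<le> s"
      "\<And>j n. n j < 0 \<Longrightarrow> fcoeff (\<Psi> j) n = fcoeff \<psi> n" by metis
    have norm: "Linfnorm (\<Psi> j) \<le> ennreal s" for j
      unfolding Linfnorm_def using \<Psi>(1)[of j] \<Psi>(2)[of j]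
      by (intro esssup_I) (auto elim!: eventually_mono intro: ennreal_leI)
    \<comment> \<open>Since \<open>h\<close> has no frequencies negative in any variable, symbols
      for \<psi> on the half spaces are symbols for \<psi> - h, while on the cone the difference
      vanishes and 0 suffices.\<close>
    have adm': "bmo_admissible (\<lambda>x. \<psi> x - h x) (\<lambda>_. 0) \<Psi>"
      using zero \<Psi> hneg
      by (auto simp: bmo_admissible_def Linf_iff fcoeff_diff L2_integrable \<psi>2 h)
    then have B: "(\<lambda>x. \<psi> x - h x) \<in> BMOr" using L2_diff[OF \<psi>2 h(1)] by (auto simp: BMOr_def)
    have "bmo_norm (\<lambda>x. \<psi> x - h x)
        \<le> max (Linfnorm (\<lambda>_::'d \<Rightarrow> real. 0)) (Max (range (\<lambda>j. Linfnorm (\<Psi> j))))"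
      unfolding bmo_norm_def using B adm' by (auto intro!: INF_lower2[of "(\<lambda>_. 0, \<Psi>)"])
    also have "\<dots> \<le> ennreal s"
    proof (rule max.boundedI)
      show "Linfnorm (\<lambda>_::'d \<Rightarrow> real. 0) \<le> ennreal s"
        unfolding Linfnorm_def by (rule esssup_I) auto
      show "Max (range (\<lambda>j. Linfnorm (\<Psi> j))) \<le> ennreal s"
        by (subst Max_le_iff) (auto simp: norm)
    qed
    finally show thesis using s by (intro that[OF hB]) simp
  qed
qed

text \<open>Every admissible choice of symbols bounds the Hankel norm, so the infimum does. If there
  is no admissible choice, the right-hand side is infinite by convention.\<close>

lemma hankel_norm_le_bmo_norm:
  fixes \<psi> :: "('d::finite \<Rightarrow> real) \<Rightarrow> complex"
  assumes \<psi>: "\<psi> \<in> L2" and h: "h \<in> H2"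
  shows "ennreal (1 / sqrt (real CARD('d))) * hankel_norm \<psi> \<le> bmo_norm (\<lambda>x. \<psi> x - h x)"
proof (cases "(\<lambda>x. \<psi> x - h x) \<in> BMOr")
  case True
  have "ennreal (1 / sqrt (real CARD('d))) * hankel_norm \<psi>
      \<le> max (Linfnorm \<phi>0) (Max (range (\<lambda>j. Linfnorm (\<Phi> j))))"
    if "bmo_admissible (\<lambda>x. \<psi> x - h x) \<phi>0 \<Phi>" for \<phi>0 \<Phi>
  proof -
    have "ennreal (1 / sqrt (real CARD('d))) * hankel_norm \<psi>
        \<le> ennreal (1 / sqrt (real CARD('d))) * (ennreal (sqrt (real CARD('d))) * Max (range (\<lambda>j. Linfnorm (\<Phi> j))))"
      by (intro mult_left_mono hankel_norm_le[OF \<psi> h that]) auto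
    also have "\<dots> = Max (range (\<lambda>j. Linfnorm (\<Phi> j)))"
      by (simp add: mult.assoc[symmetric] ennreal_mult[symmetric])
    finally show ?thesis by (rule order_trans) simp
  qed
  then show ?thesis unfolding bmo_norm_def using True by (auto intro!: INF_greatest)
qed (simp add: bmo_norm_def)

theorem theorem4p3:
  fixes \<phi> :: "('d::finite \<Rightarrow> real) \<Rightarrow> complex" and n :: "'d \<Rightarrow> nat"
  assumes "CARD('d) > 1" and "\<phi> \<in> BMOr"
  shows "ennreal (1 / sqrt (real CARD('d))) * sigma_n n \<phi> \<le> delta_n n \<phi>
         \<and> delta_n n \<phi> \<le> sigma_n n \<phi>"
proof
  show "ennreal (1 / sqrt (real CARD('d))) * sigma_n n \<phi> \<le> delta_n n \<phi>"
    unfolding delta_n_def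
  \<comment> \<open>Both infima run over the same Blaschke products, so it suffices to compare for a
    fixed \<open>b\<close>; modifying the symbol by \<open>h\<close> in H2 does not affect the
    Hankel operator.\<close>
  proof (rule INF_greatest, clarify)
    fix h b assume h: "h \<in> (BMOAr :: (('d \<Rightarrow> real) \<Rightarrow> complex) set)" and b: "b \<in> Blaschke_set n"
    have "ennreal (1 / sqrt (real CARD('d))) * sigma_n n \<phi>
        \<le> ennreal (1 / sqrt (real CARD('d))) * hankel_norm (\<lambda>x. b x * \<phi> x)"
      unfolding sigma_n_def by (intro mult_left_mono INF_lower b) auto
    also have "\<dots> \<le> bmo_norm (\<lambda>x. b x * \<phi> x - h x)"
      using BMOr_Blaschke_set[OF assms(2) b] h
      by (intro hankel_norm_le_bmo_norm) (auto simp: BMOr_def BMOAr_def)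
    finally show "ennreal (1 / sqrt (real CARD('d))) * sigma_n n \<phi> \<le> bmo_norm (\<lambda>x. b x * \<phi> x - h x)" .
  qed
  show "delta_n n \<phi> \<le> sigma_n n \<phi>"
    unfolding sigma_n_def
  proof (rule INF_greatest)
    fix b assume b: "b \<in> Blaschke_set n"
    \<comment> \<open>The function \<open>h\<close> may depend on \<open>b\<close>, since the
      infimum in \<open>delta_n\<close> is taken over pairs.\<close>
    obtain h where "h \<in> BMOAr" "bmo_norm (\<lambda>x. b x * \<phi> x - h x) \<le> hankel_norm (\<lambda>x. b x * \<phi> x)"
      using bmo_norm_le_hankel_norm[OF BMOr_Blaschke_set[OF assms(2) b]] by blast
    with b show "delta_n n \<phi> \<le> hankel_norm (\<lambda>x. b x * \<phi> x)"
      unfolding delta_n_def by (intro INF_lower2[of "(h, b)"]) auto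
  qed
qed

end
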